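(* Let $0<r<1$ be fixed, let $D=B_1\setminus\overline{B_r}\subset\mathbb{R}^2$, and consider the weak ITP with parametric homogeneous refractive index $n_p\equiv p$, for $p\in\mathcal{P}=(p_{\min},p_{\max})\subset\mathbb{R}_{>0}\setminus\{1\}$. Let $\mathcal{P}\ni p\mapsto(\kappa_p,(v_p,w_p))\in\mathbb{C}_{\neq0}\times\mathcal{V}_{\neq0}$ be any continuous eigenpair trajectory whose nonzero eigenvalue is semisimple for all $p\in\mathcal{P}$ except at a finite set of values of $p$. Assume that the eigenpair trajectory corresponds to a Bessel index $m\in\mathbb{N}_0$, i.e., for all $p\in\mathcal{P}$, $$v_p(\rho,\theta)=\big(\alpha_pJ_m(\kappa_p\rho)+\beta_pY_m(\kappa_p\rho)\big)\phi(m\theta),\qquad w_p(\rho,\theta)=\big(\gamma_pJ_m(\sqrt{p}\,\kappa_p\rho)+\delta_pY_m(\sqrt{p}\,\kappa_p\rho)\big)\phi(m\theta),$$ for $\rho\in[r,1]$, $\theta\in[0,2\pi)$, with $(\alpha_p,\beta_p,\gamma_p,\delta_p)\neq(0,0,0,0)$, where $\alpha_p,\beta_p,\gamma_p,\delta_p,\kappa_p$ are continuous functions of $p$ and $\phi$ is either sine (if $m\neq0$) or cosine. Then the simplified indicator $$\overline{I}(p):=\frac{2}{a_m\pi(1-p)}\int_D\left(|v_p|^2-p\,|w_p|^2\right)$$ equals $$\overline{I}(p)=\|v_p\|_{L^\infty(\partial B_1;\mathbb{C})}^2-r^2\|v_p\|_{L^\infty(\partial B_r;\mathbb{C})}^2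 .$$
   Context: $\mathbb{C}_{\neq0}:=\mathbb{C}\setminus\{0\}$, $\mathbb{N}_0=\{0,1,2,\ldots\}$; $B_s$ is the open disk of radius $s$ centered at the origin; $(\rho,\theta)$ are polar coordinates; $J_m$ and $Y_m$ are the index-$m$ Bessel functions of the first and second kind. The constant $a_m$ equals $2$ if $m=0$ and $1$ otherwise. Let $\mathcal{V}=\{(\eta,\psi)\in[H^1(D;\mathbb{C})]^2:\eta-\psi=0\text{ on }\partial D\}$ and $\mathcal{V}_{\neq0}=\mathcal{V}\setminus\{(0,0)\}$. Weak interior transmission eigenvalue problem (weak ITP) with refractive index $n$: an eigenpair is $(\kappa,(v,w))\in\mathbb{C}_{\neq0}\times\mathcal{V}_{\neq0}$ such that $$\int_D(\nabla v\cdot\nabla\overline{\eta}-\nabla w\cdot\nabla\overline{\psi})=\kappa^2\int_D(v\overline{\eta}-nw\overline{\psi})\quad\text{for all }(\eta,\psi)\in\mathcal{V}.$$ For eigenfunctions of the separated form in the claim, this amounts to the boundary conditions $v=w$ and $\partial_\nu v=\partial_\nu w$ on $\partial D$, with $\nu$ the outward-pointing normal. For $n=n_p$ the problem can be written as $\mathbf{L}(\kappa,p)\mathbf{x}=\mathbf{0}$ with $\mathbf{x}=(v,w)$ and $\mathbf{L}(\kappa,p)$ the bounded operator on $\mathcal{V}$ representing the sesquilinear form $\int_D(\nabla v\cdot\nabla\overline{\eta}-\nabla w\cdot\nabla\overline{\psi})-\kappa^2\int_D(v\overline{\eta}-n_pw\overline{\psi})$. An eigenvalue $\kappa$ at parameter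 $p$ is semisimple if its algebraic and geometric multiplicities coincide; in terms of Jordan chains, $\partial_\kappa\mathbf{L}(\kappa,p)\mathbf{x}\notin\operatorname{Im}\mathbf{L}(\kappa,p)$ for all $\mathbf{x}\in\operatorname{Ker}\mathbf{L}(\kappa,p)\setminus\{0\}$. An eigenpair trajectory is a map $p\mapsto(\kappa_p,(v_p,w_p))$ such that, for each $p$, $(\kappa_p,(v_p,w_p))$ is an eigenpair of the weak ITP with refractive index $n_p$. Continuity of eigenpair trajectories is understood in $\mathbb{C}\times[H^1(D;\mathbb{C})]^2$.
   Formalization: The identity is asserted only at those p where κ_p² is real (κ_p real or purely imaginary); for nonreal κ_p² the indicator is always zero while the boundary expression generally is not, so the printed claim fails there. *)

theory Defs
  imports "HOL-Analysis.Analysis" "HOL-Probability.Essential_Supremum"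
begin

section \<open>Bessel functions of integer order\<close>

definition bessel_J :: "nat \<Rightarrow> complex \<Rightarrow> complex" where
  "bessel_J m z =
     (\<Sum>k. (-1) ^ k / (fact k * fact (m + k)) * (z / 2) ^ (2 * k + m))"

text \<open>Weber's function for integer order, by its standard series (DLMF 10.8.1); the logarithm is the
  principal one.\<close>

definition bessel_Y :: "nat \<Rightarrow> complex \<Rightarrow> complex" where
  "bessel_Y m z =
     of_real (2 / pi) * Ln (z / 2) * bessel_J m z
     - of_real (1 / pi) *
         (\<Sum>k<m. fact (m - k - 1) / fact k * ((z / 2) ^ (2 * k) / (z / 2) ^ m))
     - of_real (1 / pi) *
         (\<Sum>k. (Digamma (of_nat (k + 1)) + Digamma (of_nat (m + k + 1)))
               * ((-1) ^ k / (fact k * fact (m + k))) * (z / 2) ^ (2 * k + m))"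


section \<open>The Sobolev space \<open>H\<^sup>1\<close>\<close>

primrec Ck :: "nat \<Rightarrow> ('a::euclidean_space \<Rightarrow> 'b::real_normed_vector) \<Rightarrow> bool" where
  "Ck 0 f \<longleftrightarrow> continuous_on UNIV f"
| "Ck (Suc k) f \<longleftrightarrow> (\<forall>x. f differentiable (at x)) \<and>
     (\<forall>b\<in>Basis. Ck k (\<lambda>x. frechet_derivative f (at x) b))"

definition smooth :: "('a::euclidean_space \<Rightarrow> 'b::real_normed_vector) \<Rightarrow> bool" where
  "smooth f \<longleftrightarrow> (\<forall>k. Ck k f)"

definition test_function :: "'a::euclidean_space set \<Rightarrow> ('a \<Rightarrow> real) \<Rightarrow> bool" where
  "test_function D \<phi> \<longleftrightarrow>
     smooth \<phi> \<and> compact (closure {x. \<phi> x \<noteq> 0}) \<and> closure {x. \<phi> x \<noteq> 0} \<subseteq> D"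

definition square_integrable_on ::
    "('a::euclidean_space \<Rightarrow> 'b::real_normed_vector) \<Rightarrow> 'a set \<Rightarrow> bool" where
  "square_integrable_on f D \<longleftrightarrow>
     f \<in> borel_measurable (lebesgue_on D) \<and> integrable (lebesgue_on D) (\<lambda>x. (norm (f x))\<^sup>2)"

definition is_weak_grad ::
    "(real^'n) set \<Rightarrow> (real^'n \<Rightarrow> complex) \<Rightarrow> (real^'n \<Rightarrow> complex^'n) \<Rightarrow> bool" where
  "is_weak_grad D u G \<longleftrightarrow>
     square_integrable_on G D \<and>
     (\<forall>\<phi> i. test_function D \<phi> \<longrightarrow>
        (\<integral>x. frechet_derivative \<phi> (at x) (axis i 1) *\<^sub>R u x \<partial>lebesgue_on D)
        = - (\<integral>x. \<phi> x *\<^sub>R (G x $ i) \<partial>lebesgue_on D))"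

text \<open>Elements of \<open>L\<^sup>2\<close> and \<open>H\<^sup>1\<close> are represented by functions on the whole space; only their values
  almost everywhere on \<open>D\<close> matter.\<close>

definition H1 :: "(real^'n) set \<Rightarrow> (real^'n \<Rightarrow> complex) set" where
  "H1 D = {u. square_integrable_on u D \<and> (\<exists>G. is_weak_grad D u G)}"

definition weak_grad :: "(real^'n) set \<Rightarrow> (real^'n \<Rightarrow> complex) \<Rightarrow> real^'n \<Rightarrow> complex^'n" where
  "weak_grad D u = (SOME G. is_weak_grad D u G)"

definition H1_norm :: "(real^'n) set \<Rightarrow> (real^'n \<Rightarrow> complex) \<Rightarrow> real" where
  "H1_norm D u = sqrt ((\<integral>x. (cmod (u x))\<^sup>2 \<partial>lebesgue_on D)
                       + (\<integral>x. (norm (weak_grad D u x))\<^sup>2 \<partial>lebesgue_on D))"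

definition cinner :: "complex^'n \<Rightarrow> complex^'n \<Rightarrow> complex" where
  "cinner a b = (\<Sum>i\<in>UNIV. a $ i * cnj (b $ i))"


section \<open>The annulus and traces on its boundary circles\<close>

definition annulus :: "real \<Rightarrow> (real^2) set" where
  "annulus r = ball 0 1 - cball 0 r"

definition polar :: "real \<Rightarrow> real \<Rightarrow> real^2" where
  "polar \<rho> \<theta> = vector [\<rho> * cos \<theta>, \<rho> * sin \<theta>]"

text \<open>Arc length on the circle of radius \<open>s > 0\<close>. It lives on the circle only, so that
  measurability does not depend on values off the circle.\<close>

definition arc_measure :: "real \<Rightarrow> (real^2) measure" where
  "arc_measure s = distr (restrict_space lborel {0..<2 * pi * s})
     (restrict_space borel (sphere 0 s)) (\<lambda>t. polar s (t / s))"

definition Linf_norm :: "'a measure \<Rightarrow> ('a \<Rightarrow> complex) \<Rightarrow> real" where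
  "Linf_norm M f = real_of_ereal (esssup M (\<lambda>x. ereal (cmod (f x))))"

text \<open>The trace operator extends restriction to the boundary continuously from functions smooth up to
  the boundary to \<open>H\<^sup>1\<close>, with values in \<open>L\<^sup>2\<close> of the boundary, here the circles of radii \<open>r\<close> and \<open>1\<close>.\<close>

definition vanishing_trace :: "real \<Rightarrow> (real^2 \<Rightarrow> complex) \<Rightarrow> bool" where
  "vanishing_trace r u \<longleftrightarrow>
     (\<exists>\<Phi>. (\<forall>k::nat. smooth (\<Phi> k)) \<and>
          (\<lambda>k. H1_norm (annulus r) (\<lambda>x. \<Phi> k x - u x)) \<longlonglongrightarrow> 0 \<and>
          (\<forall>s\<in>{r, 1}. (\<lambda>k. \<integral>x. (cmod (\<Phi> k x))\<^sup>2 \<partial>arc_measure s) \<longlonglongrightarrow> 0))"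


section \<open>The weak interior transmission problem on the annulus\<close>

type_synonym fun_pair = "(real^2 \<Rightarrow> complex) \<times> (real^2 \<Rightarrow> complex)"

definition itp_space :: "real \<Rightarrow> fun_pair set" where
  "itp_space r = {(\<eta>, \<psi>). \<eta> \<in> H1 (annulus r) \<and> \<psi> \<in> H1 (annulus r) \<and>
                           vanishing_trace r (\<lambda>x. \<eta> x - \<psi> x)}"

definition itp_space_nonzero :: "real \<Rightarrow> fun_pair set" where
  "itp_space_nonzero r = {(v, w) \<in> itp_space r.
     \<not> (AE x in lebesgue_on (annulus r). v x = 0 \<and> w x = 0)}"

fun itp_stiffness :: "real \<Rightarrow> fun_pair \<Rightarrow> fun_pair \<Rightarrow> complex" where
  "itp_stiffness r (v, w) (\<eta>, \<psi>) =
     (\<integral>x. cinner (weak_grad (annulus r) v x) (weak_grad (annulus r) \<eta> x)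
          - cinner (weak_grad (annulus r) w x) (weak_grad (annulus r) \<psi> x)
        \<partial>lebesgue_on (annulus r))"

fun itp_mass :: "real \<Rightarrow> (real^2 \<Rightarrow> real) \<Rightarrow> fun_pair \<Rightarrow> fun_pair \<Rightarrow> complex" where
  "itp_mass r n (v, w) (\<eta>, \<psi>) =
     (\<integral>x. v x * cnj (\<eta> x) - of_real (n x) * w x * cnj (\<psi> x) \<partial>lebesgue_on (annulus r))"

definition itp_eigenpair ::
    "real \<Rightarrow> (real^2 \<Rightarrow> real) \<Rightarrow> complex \<Rightarrow> fun_pair \<Rightarrow> bool" where
  "itp_eigenpair r n \<kappa> x \<longleftrightarrow>
     \<kappa> \<noteq> 0 \<and> x \<in> itp_space_nonzero r \<and>
     (\<forall>y\<in>itp_space r. itp_stiffness r x y = \<kappa>\<^sup>2 * itp_mass r n x y)"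

definition itp_form ::
    "real \<Rightarrow> (real^2 \<Rightarrow> real) \<Rightarrow> complex \<Rightarrow> fun_pair \<Rightarrow> fun_pair \<Rightarrow> complex" where
  "itp_form r n \<kappa> x y = itp_stiffness r x y - \<kappa>\<^sup>2 * itp_mass r n x y"

text \<open>The operator \<open>L \<kappa>\<close> on \<open>itp_space r\<close> is the one that represents \<open>itp_form r n \<kappa>\<close>. Equations between
  its values, and those of its \<open>\<kappa>\<close>-derivative, are written as equations between the represented
  functionals: \<open>L \<kappa> x = 0\<close>, and \<open>\<partial>\<^sub>\<kappa> L \<kappa> x = L \<kappa> z\<close> with \<open>x\<close> and \<open>z\<close> fixed, both tested against all \<open>y\<close>.\<close>

definition itp_kernel :: "real \<Rightarrow> (real^2 \<Rightarrow> real) \<Rightarrow> complex \<Rightarrow> fun_pair set" where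
  "itp_kernel r n \<kappa> = {x \<in> itp_space r. \<forall>y\<in>itp_space r. itp_form r n \<kappa> x y = 0}"

definition itp_semisimple :: "real \<Rightarrow> (real^2 \<Rightarrow> real) \<Rightarrow> complex \<Rightarrow> bool" where
  "itp_semisimple r n \<kappa> \<longleftrightarrow>
     (\<forall>x \<in> itp_kernel r n \<kappa> \<inter> itp_space_nonzero r.
        \<not> (\<exists>z\<in>itp_space r. \<forall>y\<in>itp_space r.
             deriv (\<lambda>k. itp_form r n k x y) \<kappa> = itp_form r n \<kappa> z y))"

definition continuous_eigenpair_trajectory ::
    "real \<Rightarrow> real set \<Rightarrow> (real \<Rightarrow> real^2 \<Rightarrow> real) \<Rightarrow> (real \<Rightarrow> complex) \<Rightarrow>
     (real \<Rightarrow> real^2 \<Rightarrow> complex) \<Rightarrow> (real \<Rightarrow> real^2 \<Rightarrow> complex) \<Rightarrow> bool" where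
  "continuous_eigenpair_trajectory r P n \<kappa> v w \<longleftrightarrow>
     (\<forall>p\<in>P. itp_eigenpair r (n p) (\<kappa> p) (v p, w p)) \<and>
     continuous_on P \<kappa> \<and>
     (\<forall>p\<in>P. ((\<lambda>q. H1_norm (annulus r) (\<lambda>x. v q x - v p x)) \<longlongrightarrow> 0) (at p within P) \<and>
             ((\<lambda>q. H1_norm (annulus r) (\<lambda>x. w q x - w p x)) \<longlongrightarrow> 0) (at p within P))"

definition a_const :: "nat \<Rightarrow> real" where
  "a_const m = (if m = 0 then 2 else 1)"

text \<open>Testing the weak problem with the eigenfunctions themselves shows that the following quantity is
  \<open>0\<close> whenever \<open>\<kappa>\<^sup>2\<close> is not real; its boundary representation is therefore only claimed for real \<open>\<kappa>\<^sup>2\<close>.\<close>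

definition simplified_indicator ::
    "real \<Rightarrow> nat \<Rightarrow> real \<Rightarrow> (real^2 \<Rightarrow> complex) \<Rightarrow> (real^2 \<Rightarrow> complex) \<Rightarrow> real" where
  "simplified_indicator r m p v w =
     2 / (a_const m * pi * (1 - p)) *
       (\<integral>x. (cmod (v x))\<^sup>2 - p * (cmod (w x))\<^sup>2 \<partial>lebesgue_on (annulus r))"

end

theory Submission
  imports Defs
begin

text \<open>
  With \<open>f\<close>, \<open>g\<close> the radial profiles of \<open>v\<close>, \<open>w\<close>, testing the weak problem against
  \<open>\<eta> = \<psi> = e(\<rho>) \<phi>(m\<theta>)\<close> with \<open>e\<close> affine and integrating by parts leaves only the boundary terms, which
  give \<open>f' = g'\<close> at \<open>\<rho> = r\<close> and \<open>\<rho> = 1\<close>; a trace inequality turns membership in the trial space into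
  \<open>f = g\<close> there. For real \<open>q = \<kappa>\<^sup>2\<close>, Bessel's equation multiplied by \<open>\<rho>\<^sup>2 f'\<close> is the exact identity
  \<open>(\<bar>\<rho> f'\<bar>\<^sup>2 + (q \<rho>\<^sup>2 - m\<^sup>2) \<bar>f\<bar>\<^sup>2)' = 2 q \<rho> \<bar>f\<bar>\<^sup>2\<close>. Subtracting the one for \<open>g\<close>, where \<open>q\<close> is replaced by
  \<open>p q\<close>, and integrating over \<open>[r, 1]\<close>, everything cancels at the endpoints except
  \<open>q (1 - p) \<rho>\<^sup>2 \<bar>f\<bar>\<^sup>2\<close>.
\<close>

section \<open>Smooth bumps and the fundamental lemma\<close>

text \<open>Two features of the definitions shape the proof. \<open>weak_grad\<close> is an
  arbitrarily chosen weak gradient, so nothing can be computed from it until weak gradients are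
  known to be unique almost everywhere; the bump functions and the fundamental lemma serve this
  purpose. Moreover, \<open>v\<close> and \<open>w\<close> are prescribed only on the closed annulus
  and for angles in one period, whereas classical derivatives need full neighbourhoods, also of
  points on the two circles. Hence each of them is replaced by a function that is C^1 on the plane
  without the origin, agrees with it on the annulus and continues its radial profile to every
  positive radius. Bessel's equation enters as a first-order system for \<open>y\<close> and
  \<open>z = \<rho> y'\<close>. The endpoint derivatives are then values of the companion function
  \<open>z\<close>, and no second derivative has to be formed.\<close>

definition flat_exp :: "nat \<Rightarrow> real \<Rightarrow> real" where
  "flat_exp n t = (if t > 0 then exp (- (1 / t)) / t ^ n else 0)"

text \<open>From the right, the substitution \<open>s = 1 / t\<close> turns the quotient into
  \<open>s ^ n / exp s\<close> at infinity; from the left the function is constantly 0.\<close>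

lemma flat_exp_tendsto_0: "(flat_exp n \<longlongrightarrow> 0) (at 0)"
proof -
  have "((\<lambda>t. inverse t ^ n / exp (inverse t)) \<longlongrightarrow> 0) (at_right (0::real))"
    by (rule filterlim_compose[OF tendsto_power_div_exp_0 filterlim_inverse_at_top_right])
  then have "(flat_exp n \<longlongrightarrow> 0) (at_right 0)"
    by (rule Lim_transform_eventually)
      (auto simp: eventually_at_filter flat_exp_def exp_minus field_simps)
  moreover have "(flat_exp n \<longlongrightarrow> 0) (at_left 0)"
    by (rule tendsto_eventually) (auto simp: eventually_at_filter flat_exp_def)
  ultimately show ?thesis
    by (intro filterlim_split_at)
qed

lemma flat_exp_Suc: "flat_exp n t / t = flat_exp (Suc n) t"
  by (simp add: flat_exp_def)

text \<open>The negative powers of \<open>t\<close> are carried along because differentiation raises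
  them by one or two: up to linear combinations the family in \<open>n\<close> is closed under
  derivatives, which is what an induction over the order of smoothness needs.\<close>

lemma flat_exp_has_real_derivative:
  "(flat_exp n has_real_derivative flat_exp (n + 2) t - real n * flat_exp (n + 1) t) (at t)"
proof -
  consider "t > 0" | "t < 0" | "t = 0" by linarith
  then show ?thesis
  proof cases
    case 1
    have "((\<lambda>t. exp (- (1 / t)) / t ^ n) has_real_derivative
        flat_exp (n + 2) t - real n * flat_exp (n + 1) t) (at t)"
      using 1 by (auto intro!: derivative_eq_intros simp: flat_exp_def field_simps power2_eq_square)
        (cases n; simp add: field_simps)
    then show ?thesis
      by (rule DERIV_cong_ev[THEN iffD1, rotated -1])
        (use 1 eventually_nhds_in_open[of "{0<..}" t] in \<open>auto simp: flat_exp_def elim!: eventually_mono\<close>)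
  next
    case 2
    have "((\<lambda>t. 0) has_real_derivative
        flat_exp (n + 2) t - real n * flat_exp (n + 1) t) (at t)"
      using 2 by (auto simp: flat_exp_def)
    then show ?thesis
      by (rule DERIV_cong_ev[THEN iffD1, rotated -1])
        (use 2 eventually_nhds_in_open[of "{..<0}" t] in \<open>auto simp: flat_exp_def elim!: eventually_mono\<close>)
  next
    case 3
    \<comment> \<open>At 0 the difference quotient is itself a member of the family, so the
      derivative there is a limit that is already known.\<close>
    have "(\<lambda>h. flat_exp n h / h) = flat_exp (Suc n)"
      by (simp add: fun_eq_iff flat_exp_Suc)
    then show ?thesis
      using flat_exp_tendsto_0[of "Suc n"] 3
      by (simp add: DERIV_def) (simp add: flat_exp_def[of _ 0])
  qed
qed

text \<open>\<open>Ck\<close> speaks of the chosen \<open>frechet_derivative\<close>; uniqueness of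
  derivatives allows the closure rules below to supply an explicit one.\<close>

lemma Ck_SucI:
  assumes "\<And>x. (f has_derivative f' x) (at x)" "\<And>b. b \<in> Basis \<Longrightarrow> Ck k (\<lambda>x. f' x b)"
  shows "Ck (Suc k) f"
proof -
  have "frechet_derivative f (at x) = f' x" for x
    using assms(1) by (metis frechet_derivative_at)
  then show ?thesis using assms by (auto simp: differentiable_def)
qed

lemma Ck_Suc_D: "Ck (Suc k) f \<Longrightarrow> Ck k f"
proof (induction k arbitrary: f)
  case 0
  then show ?case
    by (auto intro!: continuous_at_imp_continuous_on differentiable_imp_continuous_within)
qed auto

lemma Ck_const: "Ck k (\<lambda>x. c)"
proof (induction k arbitrary: c)
  case (Suc k)
  show ?case by (rule Ck_SucI[where f'="\<lambda>_ _. 0"]) (auto intro: Suc)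
qed auto

lemma Ck_add: "Ck k f \<Longrightarrow> Ck k g \<Longrightarrow> Ck k (\<lambda>x. f x + g x)"
proof (induction k arbitrary: f g)
  case 0
  then show ?case by (auto intro: continuous_intros)
next
  case (Suc k)
  show ?case
    by (rule Ck_SucI[where f'="\<lambda>x h. frechet_derivative f (at x) h + frechet_derivative g (at x) h"])
      (use Suc in \<open>auto intro!: derivative_eq_intros simp: frechet_derivative_works\<close>)
qed

lemma Ck_mult:
  fixes f g :: "'a::euclidean_space \<Rightarrow> real"
  shows "Ck k f \<Longrightarrow> Ck k g \<Longrightarrow> Ck k (\<lambda>x. f x * g x)"
proof (induction k arbitrary: f g)
  case 0
  then show ?case by (auto intro: continuous_intros)
next
  case (Suc k)
  have "Ck k f" "Ck k g" using Suc.prems Ck_Suc_D by blast+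
  show ?case
    by (rule Ck_SucI[where f'="\<lambda>x h. f x * frechet_derivative g (at x) h + frechet_derivative f (at x) h * g x"])
      (use Suc \<open>Ck k f\<close> \<open>Ck k g\<close> in
        \<open>auto intro!: has_derivative_mult Ck_add simp: frechet_derivative_works[symmetric]\<close>)
qed

lemma Ck_prod:
  fixes f :: "'i \<Rightarrow> 'a::euclidean_space \<Rightarrow> real"
  assumes "\<And>i. i \<in> I \<Longrightarrow> Ck k (f i)"
  shows "Ck k (\<lambda>x. \<Prod>i\<in>I. f i x)"
  using assms
proof (induction I rule: infinite_finite_induct)
  case (insert i I)
  then show ?case by (simp add: Ck_mult)
qed (auto intro: Ck_const)

text \<open>The induction keeps \<open>n\<close> general since the derivative raises it. A negative
  \<open>c\<close> is allowed because the cutoff at the upper face of a box runs in the opposite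
  direction.\<close>

lemma Ck_flat_exp: "Ck k (\<lambda>x. flat_exp n (c * (x \<bullet> a) + d))"
proof (induction k arbitrary: n)
  case 0
  have "isCont (flat_exp n) t" for t
    using flat_exp_has_real_derivative DERIV_isCont by blast
  then have "continuous_on UNIV (flat_exp n)"
    by (simp add: continuous_at_imp_continuous_on)
  then show ?case
    by (auto intro!: continuous_intros continuous_on_compose2[of UNIV "flat_exp n"])
next
  case (Suc k)
  let ?g = "\<lambda>x. c * (x \<bullet> a) + d"
  have der: "((\<lambda>x. flat_exp n (?g x)) has_derivative
      (\<lambda>h. (c * (h \<bullet> a)) * (flat_exp (n + 2) (?g x) + - real n * flat_exp (n + 1) (?g x)))) (at x)" for x
  proof -
    have "(?g has_derivative (\<lambda>h. c * (h \<bullet> a))) (at x)"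
      by (auto intro!: derivative_eq_intros)
    from has_derivative_compose[OF this flat_exp_has_real_derivative[unfolded has_field_derivative_def]]
    show ?thesis by (simp add: mult.commute)
  qed
  show ?case
    by (rule Ck_SucI[OF der]) (intro Ck_mult Ck_add Ck_const Suc)
qed

text \<open>In each coordinate one factor switches off at the lower face and one at the upper face,
  so for \<open>c > 0\<close> the product is positive exactly on the open box. The parameter
  \<open>c\<close> controls how steeply it rises.\<close>

definition box_bump :: "real \<Rightarrow> 'a::euclidean_space \<Rightarrow> 'a \<Rightarrow> 'a \<Rightarrow> real" where
  "box_bump c a b x = (\<Prod>i\<in>Basis. flat_exp 0 (c * (x \<bullet> i - a \<bullet> i)) * flat_exp 0 (c * (b \<bullet> i - x \<bullet> i)))"

lemma smooth_box_bump: "smooth (box_bump c a b)"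
proof -
  have "Ck k (\<lambda>x. flat_exp 0 (c * (x \<bullet> i - a \<bullet> i)) * flat_exp 0 (c * (b \<bullet> i - x \<bullet> i)))" for k i
    using Ck_mult[OF Ck_flat_exp[of k 0 c i "- c * (a \<bullet> i)"] Ck_flat_exp[of k 0 "- c" i "c * (b \<bullet> i)"]]
    by (simp add: algebra_simps)
  then show ?thesis
    unfolding smooth_def box_bump_def[abs_def] by (auto intro: Ck_prod)
qed

lemma box_bump_eq_0:
  assumes "c > 0" "x \<notin> box a b"
  shows "box_bump c a b x = 0"
proof -
  obtain i where i: "i \<in> Basis" "x \<bullet> i \<le> a \<bullet> i \<or> b \<bullet> i \<le> x \<bullet> i"
    using assms(2) by (auto simp: mem_box not_less)
  show ?thesis
    unfolding box_bump_def
    by (rule prod_zero[OF finite_Basis], rule bexI[OF _ i(1)])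
      (use i(2) assms(1) in \<open>auto simp: flat_exp_def zero_less_mult_iff\<close>)
qed

lemma test_function_box_bump:
  assumes "c > 0" "cbox a b \<subseteq> D"
  shows "test_function D (box_bump c a b)"
proof -
  have "closure {x. box_bump c a b x \<noteq> 0} \<subseteq> cbox a b"
    using box_bump_eq_0[OF assms(1)] box_subset_cbox by (intro closure_minimal) blast+
  then show ?thesis
    using assms(2) smooth_box_bump unfolding test_function_def
    by (metis bounded_cbox bounded_subset closed_closure compact_eq_bounded_closed order_trans)
qed

text \<open>Since \<open>exp (-1 / (c t))\<close> increases to 1 as \<open>c \<rightarrow> \<infinity>\<close> for \<open>t > 0\<close>, no normalised cutoff is needed.\<close>

lemma box_bump_tendsto: "(\<lambda>n. box_bump (real (Suc n)) a b x) \<longlonglongrightarrow> indicator (box a b) x"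
proof (cases "x \<in> box a b")
  case False
  then show ?thesis by (simp add: box_bump_eq_0)
next
  case True
  have "(\<lambda>n. flat_exp 0 (real (Suc n) * t)) \<longlonglongrightarrow> 1" if "t > 0" for t
  proof -
    have "(\<lambda>n. exp (- ((1 / t) * inverse (real (Suc n))))) \<longlonglongrightarrow> exp (- ((1 / t) * 0))"
      by (intro tendsto_intros LIMSEQ_inverse_real_of_nat)
    moreover have "flat_exp 0 (real (Suc n) * t) = exp (- ((1 / t) * inverse (real (Suc n))))" for n
      using that by (simp add: flat_exp_def divide_simps del: of_nat_Suc)
    ultimately show ?thesis by simp
  qed
  then have "(\<lambda>n. box_bump (real (Suc n)) a b x) \<longlonglongrightarrow> (\<Prod>i\<in>(Basis::'a set). 1 * 1)"
    unfolding box_bump_def using True by (intro tendsto_intros) (auto simp: mem_box)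
  then show ?thesis using True by simp
qed

lemma box_bump_bounds: "0 \<le> box_bump c a b x" "box_bump c a b x \<le> 1"
proof -
  have *: "0 \<le> flat_exp 0 t" "flat_exp 0 t \<le> 1" for t by (auto simp: flat_exp_def)
  show "0 \<le> box_bump c a b x" "box_bump c a b x \<le> 1"
    unfolding box_bump_def by (auto intro!: prod_nonneg prod_le_1 mult_nonneg_nonneg mult_le_one *)
qed

lemma borel_measurable_box_bump [measurable]: "box_bump c a b \<in> borel_measurable borel"
proof -
  have "Ck 0 (box_bump c a b)" using smooth_box_bump smooth_def by blast
  then show ?thesis by (simp add: borel_measurable_continuous_onI)
qed

section \<open>Integrable functions whose integrals over all boxes vanish\<close>

lemma sigma_finite_lebesgue: "sigma_finite_measure (lebesgue :: 'a::euclidean_space measure)"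
proof
  let ?A = "\<lambda>n::nat. box (- (real n *\<^sub>R One)) (real n *\<^sub>R One) :: 'a set"
  have "emeasure lebesgue (?A n) \<noteq> \<infinity>" for n by simp
  then show "\<exists>A. countable A \<and> A \<subseteq> sets (lebesgue :: 'a measure) \<and> \<Union>A = space (lebesgue :: 'a measure) \<and>
      (\<forall>a\<in>A. emeasure (lebesgue :: 'a measure) a \<noteq> \<infinity>)"
    using UN_box_eq_UNIV by (intro exI[of _ "range ?A"]) auto
qed

text \<open>Boxes are stable under intersection and generate the Borel sets, so a Dynkin argument
  spreads the vanishing of the integral from boxes to Borel sets; a Lebesgue set differs from a
  Borel set by a null set.\<close>

lemma AE_zero_if_box_integrals_zero:
  fixes f :: "'a::euclidean_space \<Rightarrow> 'b::{second_countable_topology, banach}"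
  assumes f: "integrable lebesgue f"
    and box: "\<And>a b. (\<integral>x\<in>box a b. f x \<partial>lebesgue) = 0"
  shows "AE x in lebesgue. f x = 0"
proof (rule sigma_finite_measure.density_zero[OF sigma_finite_lebesgue f])
  have int: "set_integrable lebesgue A f" if "A \<in> sets lebesgue" for A
    using that f unfolding set_integrable_def by (rule integrable_mult_indicator)
  \<comment> \<open>The complement step of the Dynkin argument subtracts from the integral over the
    whole space, which is not a box but an increasing union of boxes.\<close>
  have UNIV0: "(\<integral>x\<in>UNIV. f x \<partial>lebesgue) = 0"
  proof -
    let ?A = "\<lambda>n::nat. box (- (real n *\<^sub>R One)) (real n *\<^sub>R One) :: 'a set"
    have "mono ?A"
      by (auto simp: mono_def mem_box algebra_simps) (smt (verit) of_nat_mono)+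
    then have "(\<lambda>n. \<integral>x\<in>?A n. f x \<partial>lebesgue) \<longlonglongrightarrow> (\<integral>x\<in>(\<Union>n. ?A n). f x \<partial>lebesgue)"
      by (intro set_integral_cont_up int) (auto simp: incseq_def mono_def)
    then show ?thesis
      using box UN_box_eq_UNIV[where 'a='a] by (simp add: LIMSEQ_const_iff)
  qed
  have borel: "(\<integral>x\<in>B. f x \<partial>lebesgue) = 0" if "B \<in> sets borel" for B
  proof -
    have "Int_stable (range (\<lambda>(a, b). box a b :: 'a set))"
      by (auto simp: Int_stable_def box_Int_box)
    moreover have "range (\<lambda>(a, b). box a b) \<subseteq> Pow (UNIV :: 'a set)" by simp
    moreover have "B \<in> sigma_sets UNIV (range (\<lambda>(a, b). box a b))"
      using that by (simp add: borel_eq_box)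
    ultimately show ?thesis
    proof (induction rule: sigma_sets_induct_disjoint)
      case (basic A)
      then show ?case using box by auto
    next
      case empty
      then show ?case by (simp add: set_lebesgue_integral_def)
    next
      case (compl A)
      have A: "A \<in> sets lebesgue"
        using compl(1) by (intro sets_completionI_sets) (simp add: borel_eq_box)
      have "(\<integral>x\<in>UNIV. f x \<partial>lebesgue) = (\<integral>x\<in>A \<union> (UNIV - A). f x \<partial>lebesgue)" by simp
      also have "\<dots> = (\<integral>x\<in>A. f x \<partial>lebesgue) + (\<integral>x\<in>UNIV - A. f x \<partial>lebesgue)"
        using A by (intro set_integral_Un int) auto
      finally show ?case using UNIV0 compl by simp
    next
      case (union A)
      have A: "A n \<in> sets lebesgue" for n
        using union(2) by (intro sets_completionI_sets) (auto simp: borel_eq_box)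
      have "(\<integral>x\<in>(\<Union>n. A n). f x \<partial>lebesgue) = (\<Sum>n. \<integral>x\<in>A n. f x \<partial>lebesgue)"
        using union(1) A
        by (intro lebesgue_integral_countable_add int) (auto simp: disjoint_family_on_def)
      then show ?case using union by simp
    qed
  qed
  fix A :: "'a set" assume "A \<in> sets lebesgue"
  then obtain C N where C: "fsigma C" and N: "N \<in> null_sets lebesgue" and "C \<union> N = A"
    using lebesgue_set_almost_fsigma by metis
  have "C \<in> sets borel" using C by cases auto
  have "AE x in lebesgue. x \<notin> N" using N by (rule AE_not_in)
  then have "(\<integral>x\<in>A. f x \<partial>lebesgue) = (\<integral>x\<in>C. f x \<partial>lebesgue)"
    using \<open>C \<union> N = A\<close> \<open>A \<in> sets lebesgue\<close> \<open>C \<in> sets borel\<close> f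
    unfolding set_lebesgue_integral_def
    by (intro integral_cong_AE borel_measurable_scaleR borel_measurable_indicator)
      (auto simp: indicator_def)
  then show "(\<integral>x\<in>A. f x \<partial>lebesgue) = 0" using borel[OF \<open>C \<in> sets borel\<close>] by simp
qed

text \<open>Bumps converge boundedly to the indicator of a box, so \<open>f\<close> has integral 0
  over every box whose closure lies in \<open>D\<close>. Cutting \<open>f\<close> off to one such
  box makes the criterion on box integrals applicable, and countably many such boxes cover
  \<open>D\<close>.\<close>

lemma fundamental_lemma_calculus_of_variations:
  fixes f :: "'a::euclidean_space \<Rightarrow> 'b::{second_countable_topology, banach}"
  assumes D: "open D" and f: "integrable (lebesgue_on D) f"
    and test: "\<And>\<phi>. test_function D \<phi> \<Longrightarrow> (\<integral>x. \<phi> x *\<^sub>R f x \<partial>lebesgue_on D) = 0"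
  shows "AE x in lebesgue_on D. f x = 0"
proof -
  have D': "D \<in> sets lebesgue" using D by simp
  have fD: "integrable lebesgue (\<lambda>x. indicator D x *\<^sub>R f x)"
    using f D' by (simp add: integrable_restrict_space)
  have box0: "(\<integral>x. indicator (box a b) x *\<^sub>R (indicator D x *\<^sub>R f x) \<partial>lebesgue) = 0" if "cbox a b \<subseteq> D" for a b
  proof -
    have "(\<lambda>n. \<integral>x. box_bump (real (Suc n)) a b x *\<^sub>R (indicator D x *\<^sub>R f x) \<partial>lebesgue)
        \<longlonglongrightarrow> (\<integral>x. indicator (box a b) x *\<^sub>R (indicator D x *\<^sub>R f x) \<partial>lebesgue)"
    proof (rule integral_dominated_convergence)
      show "integrable lebesgue (\<lambda>x. norm (indicator D x *\<^sub>R f x))"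
        using fD by (rule integrable_norm)
      show "(\<lambda>x. indicator (box a b) x *\<^sub>R (indicator D x *\<^sub>R f x)) \<in> borel_measurable lebesgue"
        by (intro borel_measurable_scaleR[OF _ borel_measurable_integrable[OF fD]]
            borel_measurable_indicator) auto
      show "(\<lambda>x. box_bump (real (Suc n)) a b x *\<^sub>R (indicator D x *\<^sub>R f x)) \<in> borel_measurable lebesgue" for n
        by (intro borel_measurable_scaleR[OF _ borel_measurable_integrable[OF fD]]
            measurable_completion) auto
      show "AE x in lebesgue. (\<lambda>n. box_bump (real (Suc n)) a b x *\<^sub>R (indicator D x *\<^sub>R f x))
          \<longlonglongrightarrow> indicator (box a b) x *\<^sub>R (indicator D x *\<^sub>R f x)"
        by (intro AE_I2 tendsto_intros box_bump_tendsto)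
      show "AE x in lebesgue. norm (box_bump (real (Suc n)) a b x *\<^sub>R (indicator D x *\<^sub>R f x))
          \<le> norm (indicator D x *\<^sub>R f x)" for n
        unfolding norm_scaleR[of "box_bump _ _ _ _"]
        by (intro AE_I2 mult_left_le_one_le) (auto simp: box_bump_bounds)
    qed
    moreover have "(\<integral>x. box_bump (real (Suc n)) a b x *\<^sub>R (indicator D x *\<^sub>R f x) \<partial>lebesgue) = 0" for n
    proof -
      have "(\<integral>x. box_bump (real (Suc n)) a b x *\<^sub>R (indicator D x *\<^sub>R f x) \<partial>lebesgue)
          = (\<integral>x. indicator D x *\<^sub>R (box_bump (real (Suc n)) a b x *\<^sub>R f x) \<partial>lebesgue)"
        by (rule Bochner_Integration.integral_cong) auto
      also have "\<dots> = (\<integral>x. box_bump (real (Suc n)) a b x *\<^sub>R f x \<partial>lebesgue_on D)"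
        using D' by (simp add: integral_restrict_space)
      also have "\<dots> = 0"
        using that by (intro test test_function_box_bump) auto
      finally show ?thesis .
    qed
    ultimately show ?thesis by (simp add: LIMSEQ_const_iff)
  qed
  have sub: "AE x in lebesgue. x \<in> box c d \<longrightarrow> f x = 0" if cd: "cbox c d \<subseteq> D" for c d
  proof -
    have "AE x in lebesgue. indicator (box c d) x *\<^sub>R (indicator D x *\<^sub>R f x) = 0"
    proof (rule AE_zero_if_box_integrals_zero)
      show "integrable lebesgue (\<lambda>x. indicator (box c d) x *\<^sub>R (indicator D x *\<^sub>R f x))"
        by (intro integrable_mult_indicator[OF _ fD]) auto
      fix a b
      \<comment> \<open>The criterion asks for all boxes, also those that leave \<open>D\<close>;
        after the cutoff only the intersection with \<open>box c d\<close> matters, and it is again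
        a box, with corners \<open>e\<close> and \<open>g\<close>.\<close>
      define e g where "e = (\<Sum>i\<in>Basis. max (a \<bullet> i) (c \<bullet> i) *\<^sub>R i)" and "g = (\<Sum>i\<in>Basis. min (b \<bullet> i) (d \<bullet> i) *\<^sub>R i)"
      have eg: "box a b \<inter> box c d = box e g" by (simp add: e_def g_def box_Int_box)
      have "(\<integral>x\<in>box a b. indicator (box c d) x *\<^sub>R (indicator D x *\<^sub>R f x) \<partial>lebesgue)
          = (\<integral>x. indicator (box e g) x *\<^sub>R (indicator D x *\<^sub>R f x) \<partial>lebesgue)"
        unfolding set_lebesgue_integral_def eg[symmetric]
        by (rule Bochner_Integration.integral_cong) (auto simp: indicator_def)
      also have "\<dots> = 0"
      proof (cases "box e g = {}")
        case False
        then have "cbox e g = closure (box e g)" by simp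
        also have "\<dots> \<subseteq> cbox c d"
          by (intro closure_minimal) (use eg box_subset_cbox in blast)+
        finally show ?thesis using cd by (intro box0) auto
      qed simp
      finally show "(\<integral>x\<in>box a b. indicator (box c d) x *\<^sub>R (indicator D x *\<^sub>R f x) \<partial>lebesgue) = 0" .
    qed
    then show ?thesis
      by (rule AE_mp) (use cd box_subset_cbox in \<open>auto simp: indicator_def split: if_splits intro!: AE_I2\<close>)
  qed
  \<comment> \<open>A countable subfamily is extracted because almost-everywhere statements combine
    only countably.\<close>
  define \<F> where "\<F> = {box c d |c d. cbox c d \<subseteq> D}"
  have "\<And>S. S \<in> \<F> \<Longrightarrow> open S" by (auto simp: \<F>_def)
  then obtain F where F: "F \<subseteq> \<F>" "countable F" "\<Union>F = \<Union>\<F>"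
    by (rule Lindelof)
  have "D \<subseteq> \<Union>\<F>"
    unfolding \<F>_def by (smt (verit, ccfv_threshold) D UnionI mem_Collect_eq open_contains_cbox subsetI)
  have "AE x in lebesgue. \<forall>B\<in>F. x \<in> B \<longrightarrow> f x = 0"
    unfolding AE_ball_countable[OF F(2)]
  proof
    fix B assume "B \<in> F"
    then obtain c d where "B = box c d" "cbox c d \<subseteq> D" using F(1) by (auto simp: \<F>_def)
    then show "AE x in lebesgue. x \<in> B \<longrightarrow> f x = 0" using sub by simp
  qed
  then have "AE x in lebesgue. x \<in> D \<longrightarrow> f x = 0"
    by (rule AE_mp) (use F(3) \<open>D \<subseteq> \<Union>\<F>\<close> in \<open>auto intro!: AE_I2\<close>)
  then show ?thesis using D' by (simp add: AE_restrict_space_iff)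
qed

section \<open>Weak and classical gradients\<close>

text \<open>Differentiability is required at \<open>x\<close>, not within \<open>S\<close>. With the
  plane without the origin as \<open>S\<close>, this gives regularity across both boundary circles
  of the annulus.\<close>

definition C1_on :: "'a::euclidean_space set \<Rightarrow> ('a \<Rightarrow> 'b::real_normed_vector) \<Rightarrow> bool" where
  "C1_on S u \<longleftrightarrow> (\<forall>x\<in>S. u differentiable (at x)) \<and>
     (\<forall>b\<in>Basis. continuous_on S (\<lambda>x. frechet_derivative u (at x) b))"

lemma C1_onI:
  assumes "\<And>x. x \<in> S \<Longrightarrow> (u has_derivative u' x) (at x)"
    and "\<And>b. b \<in> Basis \<Longrightarrow> continuous_on S (\<lambda>x. u' x b)"
  shows "C1_on S u"
proof -
  have "frechet_derivative u (at x) = u' x" if "x \<in> S" for x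
    using assms(1)[OF that] by (metis frechet_derivative_at)
  then show ?thesis
    using assms by (auto simp: C1_on_def differentiable_def cong: continuous_on_cong)
qed

lemma C1_on_has_derivative:
  "C1_on S u \<Longrightarrow> x \<in> S \<Longrightarrow> (u has_derivative frechet_derivative u (at x)) (at x)"
  by (simp add: C1_on_def frechet_derivative_works)

lemma C1_on_continuous_frechet_derivative:
  "C1_on S u \<Longrightarrow> b \<in> Basis \<Longrightarrow> continuous_on S (\<lambda>x. frechet_derivative u (at x) b)"
  by (simp add: C1_on_def)

lemma C1_on_subset: "C1_on S u \<Longrightarrow> T \<subseteq> S \<Longrightarrow> C1_on T u"
  by (auto simp: C1_on_def intro: continuous_on_subset)

lemma C1_on_imp_continuous_on: "C1_on S u \<Longrightarrow> continuous_on S u"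
  by (auto simp: C1_on_def intro!: continuous_at_imp_continuous_on differentiable_imp_continuous_within)

lemma smooth_imp_C1_on: "smooth u \<Longrightarrow> C1_on S u"
  using continuous_on_subset unfolding smooth_def C1_on_def
  by (metis Ck.simps subset_UNIV)

lemma C1_on_diff:
  assumes "C1_on S u" "C1_on S v"
  shows "C1_on S (\<lambda>x. u x - v x)"
  by (rule C1_onI[where u'="\<lambda>x h. frechet_derivative u (at x) h - frechet_derivative v (at x) h"])
    (auto intro!: derivative_eq_intros C1_on_has_derivative[OF assms(1)] C1_on_has_derivative[OF assms(2)]
       continuous_intros assms C1_on_continuous_frechet_derivative)

lemma C1_on_mult:
  fixes u v :: "'a::euclidean_space \<Rightarrow> 'b::real_normed_algebra"
  assumes "C1_on S u" "C1_on S v"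
  shows "C1_on S (\<lambda>x. u x * v x)"
  by (rule C1_onI[where u'="\<lambda>x h. u x * frechet_derivative v (at x) h + frechet_derivative u (at x) h * v x"])
    (auto intro!: has_derivative_mult C1_on_has_derivative[OF assms(1)] C1_on_has_derivative[OF assms(2)]
       continuous_intros assms[THEN C1_on_imp_continuous_on] C1_on_continuous_frechet_derivative[OF assms(1)]
       C1_on_continuous_frechet_derivative[OF assms(2)])

section \<open>Integration by parts without boundary terms\<close>

lemma integrable_compact_support:
  fixes f :: "'a::euclidean_space \<Rightarrow> 'b::euclidean_space"
  assumes "continuous_on UNIV f" "compact K" "\<And>x. x \<notin> K \<Longrightarrow> f x = 0"
  shows "integrable lborel f"
proof -
  have "integrable lborel (\<lambda>x. indicator K x *\<^sub>R f x)"
    using assms by (intro borel_integrable_compact) (auto intro: continuous_on_subset)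
  moreover have "(\<lambda>x. indicator K x *\<^sub>R f x) = f"
    using assms(3) by (auto simp: indicator_def)
  ultimately show ?thesis by simp
qed

lemma has_vector_derivative_imp_tendsto:
  assumes "(f has_vector_derivative v) (at 0)"
  shows "((\<lambda>t. (f t - f 0) /\<^sub>R t) \<longlongrightarrow> v) (at 0)"
proof -
  have "((\<lambda>t. norm (f t - f 0 - t *\<^sub>R v) / norm t) \<longlongrightarrow> 0) (at 0)"
    using assms unfolding has_vector_derivative_def has_derivative_at by simp
  then have "((\<lambda>t. norm ((f t - f 0) /\<^sub>R t - v)) \<longlongrightarrow> 0) (at 0)"
  proof (rule Lim_transform_eventually)
    have "norm (f t - f 0 - t *\<^sub>R v) / norm t = norm ((f t - f 0) /\<^sub>R t - v)" if "t \<noteq> 0" for t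
    proof -
      have "(f t - f 0) /\<^sub>R t - v = (f t - f 0 - t *\<^sub>R v) /\<^sub>R t"
        using that by (simp add: scaleR_diff_right)
      then show ?thesis by (simp add: divide_inverse)
    qed
    then show "\<forall>\<^sub>F t in at 0. norm (f t - f 0 - t *\<^sub>R v) / norm t = norm ((f t - f 0) /\<^sub>R t - v)"
      by (auto simp: eventually_at_filter)
  qed
  then show ?thesis by (simp add: tendsto_norm_zero_iff LIM_zero_iff)
qed

text \<open>The difference quotients have integral 0 by translation invariance and converge dominatedly.\<close>

lemma integral_frechet_derivative_eq_0:
  fixes h :: "'a::euclidean_space \<Rightarrow> 'b::euclidean_space"
  assumes h: "C1_on UNIV h" and K: "compact K" "\<And>x. x \<notin> K \<Longrightarrow> h x = 0" and e: "e \<in> Basis"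
  shows "(\<integral>x. frechet_derivative h (at x) e \<partial>lborel) = 0"
proof -
  define g where "g x = frechet_derivative h (at x) e" for x
  have cg: "continuous_on UNIV g"
    unfolding g_def using h e by (rule C1_on_continuous_frechet_derivative)
  have ch: "continuous_on UNIV h" using h by (rule C1_on_imp_continuous_on)
  have g0: "g x = 0" if "x \<notin> K" for x
  proof -
    have "(h has_derivative (\<lambda>_. 0)) (at x)"
      by (rule has_derivative_transform_within_open[of "\<lambda>_. 0" _ _ UNIV "- K"])
        (use that K in \<open>auto simp: compact_imp_closed open_Compl\<close>)
    then have "frechet_derivative h (at x) = (\<lambda>_. 0)" by (metis frechet_derivative_at)
    then show ?thesis by (simp add: g_def)
  qed
  obtain M where M: "\<And>x. norm (g x) \<le> M"
  proof -
    have "compact (g ` K)" using K(1) cg by (intro compact_continuous_image) (auto intro: continuous_on_subset)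
    then obtain M where "\<And>y. y \<in> g ` K \<Longrightarrow> norm y \<le> M" by (meson bounded_iff compact_imp_bounded)
    then have "norm (g x) \<le> max M 0" for x using g0[of x] by (cases "x \<in> K") force+
    then show ?thesis using that by blast
  qed
  obtain R where R: "K \<subseteq> cball 0 R"
    using compact_imp_bounded[OF K(1)] bounded_subset_ballD[of K 0] ball_subset_cball by blast
  have line: "((\<lambda>s. h (x + s *\<^sub>R e)) has_vector_derivative g (x + s *\<^sub>R e)) (at s)" for x s
  proof -
    have "((\<lambda>s. x + s *\<^sub>R e) has_derivative (\<lambda>t. t *\<^sub>R e)) (at s)"
      by (auto intro!: derivative_eq_intros)
    from has_derivative_compose[OF this C1_on_has_derivative[OF h UNIV_I]]
    have "((\<lambda>s. h (x + s *\<^sub>R e)) has_derivative (\<lambda>t. frechet_derivative h (at (x + s *\<^sub>R e)) (t *\<^sub>R e))) (at s)" .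
    moreover have "linear (frechet_derivative h (at (x + s *\<^sub>R e)))"
      using h by (simp add: C1_on_def linear_frechet_derivative)
    ultimately show ?thesis
      by (simp add: has_vector_derivative_def g_def linear_cmul)
  qed
  define q where "q n x = (h (x + inverse (real (Suc n)) *\<^sub>R e) - h x) /\<^sub>R inverse (real (Suc n))" for n x
  have "(\<lambda>n. \<integral>x. q n x \<partial>lborel) \<longlonglongrightarrow> (\<integral>x. g x \<partial>lborel)"
  proof (rule integral_dominated_convergence)
    \<comment> \<open>The steps are at most 1, so every difference quotient vanishes outside the
      ball of radius \<open>R + 1\<close>; the mean value inequality bounds it by \<open>M\<close>
      inside.\<close>
    show "integrable lborel (\<lambda>x. indicator (cball 0 (R + 1)) x *\<^sub>R M :: real)"
      by (rule borel_integrable_compact) auto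
    show "g \<in> borel_measurable lborel" using cg by (simp add: borel_measurable_continuous_onI)
    show "q n \<in> borel_measurable lborel" for n
      unfolding q_def using ch by (auto intro!: borel_measurable_continuous_onI continuous_intros intro: continuous_on_compose2)
    show "AE x in lborel. (\<lambda>n. q n x) \<longlonglongrightarrow> g x"
    proof (rule AE_I2)
      fix x
      have "((\<lambda>t. (h (x + t *\<^sub>R e) - h x) /\<^sub>R t) \<longlongrightarrow> g x) (at 0)"
        using has_vector_derivative_imp_tendsto[OF line[of x 0]] by simp
      moreover have "filterlim (\<lambda>n. inverse (real (Suc n))) (at 0) sequentially"
        using LIMSEQ_inverse_real_of_nat by (auto simp: filterlim_at)
      ultimately show "(\<lambda>n. q n x) \<longlonglongrightarrow> g x"
        unfolding q_def by (rule filterlim_compose)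
    qed
    show "AE x in lborel. norm (q n x) \<le> indicator (cball 0 (R + 1)) x *\<^sub>R M" for n
    proof (rule AE_I2)
      fix x
      let ?t = "inverse (real (Suc n))"
      have t: "0 < ?t" "?t \<le> 1" by (auto simp: field_simps)
      show "norm (q n x) \<le> indicator (cball 0 (R + 1)) x *\<^sub>R M"
      proof (cases "x \<in> cball 0 (R + 1)")
        case False
        have "norm (?t *\<^sub>R e) \<le> 1" using t e by simp
        then have "norm (x + ?t *\<^sub>R e) > R"
          using False norm_triangle_ineq4[of "x + ?t *\<^sub>R e" "?t *\<^sub>R e"] by simp
        moreover have "norm x > R" using False by simp
        ultimately have "x \<notin> K" "x + ?t *\<^sub>R e \<notin> K" using R by auto
        then show ?thesis using False by (simp add: q_def K)
      next
        case True
        have "norm (h (x + ?t *\<^sub>R e) - h (x + 0 *\<^sub>R e)) \<le> ?t * M"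
        proof -
          have "continuous_on {0..?t} (\<lambda>s. h (x + s *\<^sub>R e))"
            by (intro continuous_on_compose2[OF ch]) (auto intro!: continuous_intros)
          then obtain s where "norm (h (x + ?t *\<^sub>R e) - h (x + 0 *\<^sub>R e)) \<le> norm ((?t - 0) *\<^sub>R g (x + s *\<^sub>R e))"
            using mvt_general[OF t(1), of "\<lambda>s. h (x + s *\<^sub>R e)" "\<lambda>s t. t *\<^sub>R g (x + s *\<^sub>R e)"]
              line[unfolded has_vector_derivative_def] by blast
          also have "\<dots> = ?t * norm (g (x + s *\<^sub>R e))" using t(1) by simp
          also have "\<dots> \<le> ?t * M" by (rule mult_left_mono[OF M]) simp
          finally show ?thesis .
        qed
        then have "norm (q n x) \<le> M"
          by (simp add: q_def pos_le_divide_eq inverse_eq_divide mult.commute del: of_nat_Suc)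
        moreover have "indicator (cball 0 (R + 1)) x = (1::real)"
          using True by (rule indicator_eq_1_iff[THEN iffD2])
        ultimately show ?thesis by simp
      qed
    qed
  qed
  moreover have "(\<integral>x. q n x \<partial>lborel) = 0" for n
  proof -
    let ?t = "inverse (real (Suc n))"
    have h_int: "integrable lborel h" using ch K by (rule integrable_compact_support)
    have "integrable (distr lborel borel ((+) (?t *\<^sub>R e))) h"
      using h_int by (simp add: lborel_distr_plus)
    then have i: "integrable lborel (\<lambda>x. h (x + ?t *\<^sub>R e))"
      using ch by (subst (asm) integrable_distr_eq) (auto simp: add.commute intro: borel_measurable_continuous_onI)
    have "(\<integral>x. h x \<partial>lborel) = (\<integral>x. h x \<partial>distr lborel borel ((+) (?t *\<^sub>R e)))"
      by (simp add: lborel_distr_plus)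
    also have "\<dots> = (\<integral>x. h (x + ?t *\<^sub>R e) \<partial>lborel)"
      using ch by (subst integral_distr) (auto simp: add.commute intro: borel_measurable_continuous_onI)
    finally show ?thesis using i h_int by (simp add: q_def)
  qed
  ultimately show ?thesis by (simp add: g_def LIMSEQ_const_iff)
qed

text \<open>\<open>D\<close> and the complement of \<open>K\<close> are open, cover the space, and
  the extension is continuous on each of them.\<close>

lemma continuous_on_extend_zero:
  fixes g :: "'a::topological_space \<Rightarrow> 'b::real_normed_vector"
  assumes "open D" "closed K" "K \<subseteq> D" "continuous_on D g" "\<And>x. x \<in> D - K \<Longrightarrow> g x = 0"
  shows "continuous_on UNIV (\<lambda>x. if x \<in> D then g x else 0)"
proof -
  have "continuous_on D (\<lambda>x. if x \<in> D then g x else 0)"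
    using assms(4) by (simp cong: continuous_on_cong)
  moreover have "continuous_on (- K) (\<lambda>x. if x \<in> D then g x else 0)"
    by (rule continuous_on_eq[OF continuous_on_const[of _ 0]]) (use assms(5) in auto)
  moreover have "D \<union> - K = UNIV" using assms(3) by blast
  ultimately show ?thesis
    using continuous_on_open_Un[OF assms(1) open_Compl[OF assms(2)]] by metis
qed

text \<open>Since the support of \<open>\<phi>\<close> is a compact subset of \<open>D\<close>, the
  product \<open>\<phi> u\<close> extended by 0 is C^1 on the whole space whatever \<open>u\<close>
  does near the boundary of \<open>D\<close>. Its partial derivatives have integral 0, and the
  product rule splits them into \<open>A\<close> and \<open>B\<close>.\<close>

lemma integration_by_parts_test_function:
  fixes u :: "'a::euclidean_space \<Rightarrow> 'b::euclidean_space"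
  assumes D: "open D" and u: "C1_on D u" and \<phi>: "test_function D \<phi>" and e: "e \<in> Basis"
  shows "(\<integral>x. frechet_derivative \<phi> (at x) e *\<^sub>R u x \<partial>lebesgue_on D)
       = - (\<integral>x. \<phi> x *\<^sub>R frechet_derivative u (at x) e \<partial>lebesgue_on D)"
proof -
  define K where "K = closure {x. \<phi> x \<noteq> 0}"
  have K: "compact K" "closed K" "K \<subseteq> D" "\<And>x. x \<notin> K \<Longrightarrow> \<phi> x = 0"
    using \<phi> closure_subset[of "{x. \<phi> x \<noteq> 0}"] by (auto simp: test_function_def K_def)
  have C1\<phi>: "C1_on UNIV \<phi>" using \<phi> by (simp add: test_function_def smooth_imp_C1_on)
  have \<phi>'0: "frechet_derivative \<phi> (at x) = (\<lambda>_. 0)" if "x \<notin> K" for x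
  proof -
    have "(\<phi> has_derivative (\<lambda>_. 0)) (at x)"
      by (rule has_derivative_transform_within_open[of "\<lambda>_. 0" _ _ UNIV "- K"])
        (use that K in \<open>auto simp: open_Compl\<close>)
    then show ?thesis by (metis frechet_derivative_at)
  qed
  define A where "A b x = (if x \<in> D then \<phi> x *\<^sub>R frechet_derivative u (at x) b else 0)" for b x
  define B where "B b x = (if x \<in> D then frechet_derivative \<phi> (at x) b *\<^sub>R u x else 0)" for b x
  have cA: "continuous_on UNIV (A b)" if "b \<in> Basis" for b
    unfolding A_def
    by (rule continuous_on_extend_zero[OF D K(2,3)])
      (use K that C1_on_continuous_frechet_derivative[OF u that] C1_on_imp_continuous_on[OF C1\<phi>] in
        \<open>auto intro!: continuous_on_scaleR intro: continuous_on_subset\<close>)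
  have cB: "continuous_on UNIV (B b)" if "b \<in> Basis" for b
    unfolding B_def
    by (rule continuous_on_extend_zero[OF D K(2,3)])
      (use \<phi>'0 C1_on_continuous_frechet_derivative[OF C1\<phi> that] C1_on_imp_continuous_on[OF u] in
        \<open>auto intro!: continuous_on_scaleR intro: continuous_on_subset\<close>)
  define h where "h x = (if x \<in> D then \<phi> x *\<^sub>R u x else 0)" for x
  have h': "(h has_derivative (\<lambda>k. if x \<in> D then \<phi> x *\<^sub>R frechet_derivative u (at x) k + frechet_derivative \<phi> (at x) k *\<^sub>R u x else 0)) (at x)" for x
  proof (cases "x \<in> D")
    case True
    have "((\<lambda>x. \<phi> x *\<^sub>R u x) has_derivative
        (\<lambda>k. \<phi> x *\<^sub>R frechet_derivative u (at x) k + frechet_derivative \<phi> (at x) k *\<^sub>R u x)) (at x)"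
      using True by (intro has_derivative_scaleR C1_on_has_derivative[OF u] C1_on_has_derivative[OF C1\<phi>]) auto
    then have "(h has_derivative
        (\<lambda>k. \<phi> x *\<^sub>R frechet_derivative u (at x) k + frechet_derivative \<phi> (at x) k *\<^sub>R u x)) (at x)"
      by (rule has_derivative_transform_within_open[OF _ D True]) (auto simp: h_def)
    then show ?thesis using True by simp
  next
    case False
    have "(h has_derivative (\<lambda>_. 0)) (at x)"
      by (rule has_derivative_transform_within_open[of "\<lambda>_. 0" _ _ UNIV "- K"])
        (use False K in \<open>auto simp: open_Compl h_def\<close>)
    then show ?thesis using False by simp
  qed
  have eq: "frechet_derivative h (at x) b = A b x + B b x" for x b
    using frechet_derivative_at[OF h'[of x], symmetric] by (simp add: A_def B_def)
  have "C1_on UNIV h"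
    unfolding C1_on_def eq using h' cA cB by (auto simp: differentiable_def intro!: continuous_on_add)
  then have "(\<integral>x. A e x + B e x \<partial>lborel) = 0"
    using integral_frechet_derivative_eq_0[of h K e] K e by (auto simp: eq h_def)
  moreover have "integrable lborel (A e)" "integrable lborel (B e)"
    by (intro integrable_compact_support[OF _ K(1)] cA cB e; use K \<phi>'0 in \<open>simp add: A_def B_def\<close>)+
  ultimately have "(\<integral>x. B e x \<partial>lborel) = - (\<integral>x. A e x \<partial>lborel)"
    by (simp add: eq_neg_iff_add_eq_0 add.commute)
  moreover have "(\<integral>x. B e x \<partial>lborel) = (\<integral>x. frechet_derivative \<phi> (at x) e *\<^sub>R u x \<partial>lebesgue_on D)"
  proof -
    have "(\<integral>x. B e x \<partial>lborel) = (\<integral>x. B e x \<partial>lebesgue)"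
      using cB[OF e] by (simp add: integral_completion borel_measurable_continuous_onI)
    also have "\<dots> = (\<integral>x. indicator D x *\<^sub>R (frechet_derivative \<phi> (at x) e *\<^sub>R u x) \<partial>lebesgue)"
      by (rule Bochner_Integration.integral_cong) (auto simp: B_def)
    finally show ?thesis using D by (simp add: integral_restrict_space)
  qed
  moreover have "(\<integral>x. A e x \<partial>lborel) = (\<integral>x. \<phi> x *\<^sub>R frechet_derivative u (at x) e \<partial>lebesgue_on D)"
  proof -
    have "(\<integral>x. A e x \<partial>lborel) = (\<integral>x. A e x \<partial>lebesgue)"
      using cA[OF e] by (simp add: integral_completion borel_measurable_continuous_onI)
    also have "\<dots> = (\<integral>x. indicator D x *\<^sub>R (\<phi> x *\<^sub>R frechet_derivative u (at x) e) \<partial>lebesgue)"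
      by (rule Bochner_Integration.integral_cong) (auto simp: A_def)
    finally show ?thesis using D by (simp add: integral_restrict_space)
  qed
  ultimately show ?thesis by simp
qed

section \<open>Classical gradients as weak gradients\<close>

definition classical_grad :: "(real^'n \<Rightarrow> complex) \<Rightarrow> real^'n \<Rightarrow> complex^'n" where
  "classical_grad u x = (\<chi> i. frechet_derivative u (at x) (axis i 1))"

lemma continuous_on_classical_grad: "C1_on S u \<Longrightarrow> continuous_on S (classical_grad u)"
  unfolding classical_grad_def
  by (rule continuous_on_vec_lambda, erule C1_on_continuous_frechet_derivative) (simp add: axis_in_Basis_iff)

lemma integrable_lebesgue_on_if_continuous_on:
  fixes f :: "'a::euclidean_space \<Rightarrow> 'b::euclidean_space"
  assumes "open D" "bounded D" "continuous_on S f" "closure D \<subseteq> S"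
  shows "integrable (lebesgue_on D) f"
proof -
  have D: "D \<in> lmeasurable" using assms by (simp add: bounded_set_imp_lmeasurable)
  have "compact (f ` closure D)"
    using assms by (intro compact_continuous_image) (auto intro: continuous_on_subset)
  then obtain M where M: "\<And>y. y \<in> f ` closure D \<Longrightarrow> norm y \<le> M"
    by (meson bounded_iff compact_imp_bounded)
  have "continuous_on D f" using assms closure_subset by (meson continuous_on_subset)
  then have "f \<in> borel_measurable (lebesgue_on D)"
    using D by (intro continuous_imp_measurable_on_sets_lebesgue) auto
  moreover have "AE x in lebesgue_on D. norm (f x) \<le> M"
    using M closure_subset by (intro AE_I2) (auto simp: space_restrict_space)
  ultimately show ?thesis
    by (intro finite_measure.integrable_const_bound[OF finite_measure_lebesgue_on[OF D]])
qed

lemma square_integrable_on_if_continuous_on: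
  fixes f :: "'a::euclidean_space \<Rightarrow> 'b::euclidean_space"
  assumes "open D" "bounded D" "continuous_on S f" "closure D \<subseteq> S"
  shows "square_integrable_on f D"
proof -
  have "continuous_on S (\<lambda>x. (norm (f x))\<^sup>2)" using assms(3) by (intro continuous_intros)
  then show ?thesis
    unfolding square_integrable_on_def
    using integrable_lebesgue_on_if_continuous_on[OF assms(1,2) _ assms(4)]
      integrable_lebesgue_on_if_continuous_on[OF assms, THEN borel_measurable_integrable] by auto
qed

lemma is_weak_grad_classical_grad:
  assumes "open D" "bounded D" "C1_on S u" "closure D \<subseteq> S"
  shows "is_weak_grad D u (classical_grad u)"
proof -
  have "C1_on D u" using assms closure_subset by (meson C1_on_subset order_trans)
  moreover have "square_integrable_on (classical_grad u) D"
    using assms square_integrable_on_if_continuous_on continuous_on_classical_grad by blast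
  ultimately show ?thesis
    using integration_by_parts_test_function[OF assms(1) \<open>C1_on D u\<close>]
    by (simp add: is_weak_grad_def classical_grad_def axis_in_Basis_iff)
qed

lemma integrable_if_square_integrable_on:
  fixes f :: "'a::euclidean_space \<Rightarrow> 'b::euclidean_space"
  assumes "D \<in> lmeasurable" "square_integrable_on f D"
  shows "integrable (lebesgue_on D) f"
proof -
  interpret finite_measure "lebesgue_on D" using assms(1) by (rule finite_measure_lebesgue_on)
  have "norm (f x) \<le> 1 + (norm (f x))\<^sup>2" for x
    using zero_le_power2[of "norm (f x) - 1"] by (simp add: power2_diff) (smt (verit) norm_ge_zero)
  then show ?thesis
    using assms(2) unfolding square_integrable_on_def
    by (intro Bochner_Integration.integrable_bound[of _ "\<lambda>x. 1 + (norm (f x))\<^sup>2" f]) auto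
qed

text \<open>Each component of the difference is annihilated by all test functions. Boundedness of
  \<open>D\<close> makes the square integrable gradients integrable, as the fundamental lemma
  demands.\<close>

lemma is_weak_grad_unique:
  assumes D: "open D" "bounded D" and G: "is_weak_grad D u G" and H: "is_weak_grad D u H"
  shows "AE x in lebesgue_on D. G x = H x"
proof -
  have Dl: "D \<in> lmeasurable" using D by (simp add: bounded_set_imp_lmeasurable)
  have int: "integrable (lebesgue_on D) G" "integrable (lebesgue_on D) H"
    using G H integrable_if_square_integrable_on[OF Dl] by (auto simp: is_weak_grad_def)
  have comp: "integrable (lebesgue_on D) (\<lambda>x. F x $ i)" if "integrable (lebesgue_on D) F" for F :: "real^'a \<Rightarrow> complex^'a" and i
    using that by (rule integrable_bounded_linear[OF bounded_linear_vec_nth])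
  have "AE x in lebesgue_on D. G x $ i - H x $ i = 0" for i
  proof (rule fundamental_lemma_calculus_of_variations[OF D(1)])
    show "integrable (lebesgue_on D) (\<lambda>x. G x $ i - H x $ i)"
      using int comp by auto
    fix \<phi> assume \<phi>: "test_function D \<phi>"
    have "continuous_on UNIV \<phi>"
      using \<phi> by (auto simp: test_function_def intro: C1_on_imp_continuous_on smooth_imp_C1_on)
    moreover have "\<exists>M. \<forall>x. \<bar>\<phi> x\<bar> \<le> M"
    proof -
      let ?K = "closure {x. \<phi> x \<noteq> 0}"
      have "compact (\<phi> ` ?K)"
        using \<open>continuous_on UNIV \<phi>\<close> \<phi> by (intro compact_continuous_image) (auto intro: continuous_on_subset simp: test_function_def)
      then obtain M where M: "\<And>y. y \<in> \<phi> ` ?K \<Longrightarrow> norm y \<le> M"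
        by (meson bounded_iff compact_imp_bounded)
      have "\<bar>\<phi> x\<bar> \<le> max M 0" for x
        using M[of "\<phi> x"] closure_subset[of "{x. \<phi> x \<noteq> 0}"] by (cases "\<phi> x = 0") force+
      then show ?thesis by blast
    qed
    then obtain M where M: "\<And>x. \<bar>\<phi> x\<bar> \<le> M" by blast
    ultimately have i: "integrable (lebesgue_on D) (\<lambda>x. \<phi> x *\<^sub>R f x)" if "integrable (lebesgue_on D) f" for f :: "_ \<Rightarrow> complex"
    proof (intro Bochner_Integration.integrable_bound[of _ "\<lambda>x. M * norm (f x)" "\<lambda>x. \<phi> x *\<^sub>R f x"])
      show "(\<lambda>x. \<phi> x *\<^sub>R f x) \<in> borel_measurable (lebesgue_on D)"
        using \<open>continuous_on UNIV \<phi>\<close>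
        by (intro borel_measurable_scaleR[OF _ borel_measurable_integrable[OF that]])
          (auto intro!: measurable_restrict_space1 measurable_completion borel_measurable_continuous_onI)
      show "AE x in lebesgue_on D. norm (\<phi> x *\<^sub>R f x) \<le> norm (M * norm (f x))"
        using order_trans[OF M abs_ge_self] by (intro AE_I2) (simp add: abs_mult mult_right_mono)
    qed (use that in auto)
    have "(\<integral>x. \<phi> x *\<^sub>R (G x $ i - H x $ i) \<partial>lebesgue_on D)
        = (\<integral>x. \<phi> x *\<^sub>R (G x $ i) \<partial>lebesgue_on D) - (\<integral>x. \<phi> x *\<^sub>R (H x $ i) \<partial>lebesgue_on D)"
      using i int comp by (simp add: scaleR_diff_right)
    also have "\<dots> = 0"
    proof -
      have "- (\<integral>x. \<phi> x *\<^sub>R (G x $ i) \<partial>lebesgue_on D) = - (\<integral>x. \<phi> x *\<^sub>R (H x $ i) \<partial>lebesgue_on D)"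
        using G H \<phi> unfolding is_weak_grad_def by (metis (no_types, lifting))
      then show ?thesis by simp
    qed
    finally show "(\<integral>x. \<phi> x *\<^sub>R (G x $ i - H x $ i) \<partial>lebesgue_on D) = 0" .
  qed
  then have "AE x in lebesgue_on D. \<forall>i. G x $ i - H x $ i = 0"
    by (simp add: AE_all_countable)
  then show ?thesis by (rule AE_mp) (auto simp: vec_eq_iff intro!: AE_I2)
qed

lemma is_weak_grad_cong:
  assumes "\<And>x. x \<in> D \<Longrightarrow> u x = v x"
  shows "is_weak_grad D u = is_weak_grad D v"
proof -
  have "(\<integral>x. c x *\<^sub>R u x \<partial>lebesgue_on D) = (\<integral>x. c x *\<^sub>R v x \<partial>lebesgue_on D)" for c :: "_ \<Rightarrow> real"
    using assms by (intro Bochner_Integration.integral_cong) (auto simp: space_restrict_space)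
  then show ?thesis by (auto simp: is_weak_grad_def fun_eq_iff)
qed

text \<open>This is the bridge from the chosen \<open>weak_grad\<close> to computable derivatives.
  The function \<open>v\<close> may take any values off \<open>D\<close>, so it need not be
  differentiable at boundary points; only its C^1 companion \<open>u\<close> is.\<close>

lemma
  assumes D: "open D" "bounded D" and u: "C1_on S u" "closure D \<subseteq> S" and eq: "\<And>x. x \<in> D \<Longrightarrow> v x = u x"
  shows is_weak_grad_weak_grad: "is_weak_grad D v (weak_grad D v)"
    and AE_weak_grad_eq_classical_grad: "AE x in lebesgue_on D. weak_grad D v x = classical_grad u x"
proof -
  have c: "is_weak_grad D v (classical_grad u)"
    using is_weak_grad_classical_grad[OF D u] is_weak_grad_cong[of D v u] eq by simp
  then show w: "is_weak_grad D v (weak_grad D v)"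
    unfolding weak_grad_def by (rule someI[where P="is_weak_grad D v"])
  show "AE x in lebesgue_on D. weak_grad D v x = classical_grad u x"
    using is_weak_grad_unique[OF D w c] .
qed

lemma H1_if_C1_on:
  assumes "open D" "bounded D" "C1_on S u" "closure D \<subseteq> S"
  shows "u \<in> H1 D"
  using is_weak_grad_classical_grad[OF assms] square_integrable_on_if_continuous_on[OF assms(1,2) _ assms(4)]
    C1_on_imp_continuous_on[OF assms(3)] by (auto simp: H1_def)

section \<open>Polar coordinates on the annulus\<close>

lemma polar_nth [simp]: "polar \<rho> \<theta> $ 1 = \<rho> * cos \<theta>" "polar \<rho> \<theta> $ 2 = \<rho> * sin \<theta>"
  by (auto simp: polar_def)

lemma vec2_eq_iff: "(x :: real^2) = y \<longleftrightarrow> x $ 1 = y $ 1 \<and> x $ 2 = y $ 2"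
  by (auto simp: vec_eq_iff forall_2)

lemma norm_polar [simp]: "norm (polar \<rho> \<theta>) = \<bar>\<rho>\<bar>"
proof -
  have "(\<rho> * cos \<theta>)\<^sup>2 + (\<rho> * sin \<theta>)\<^sup>2 = \<rho>\<^sup>2"
    by (simp add: power_mult_distrib flip: distrib_left)
  then show ?thesis
    by (simp add: norm_vec_def L2_set_def sum_2)
qed

lemma polar_ne_0: "\<rho> \<noteq> 0 \<Longrightarrow> polar \<rho> \<theta> \<noteq> 0"
  by (metis abs_eq_0_iff norm_eq_zero norm_polar)

lemma annulus_iff: "x \<in> annulus r \<longleftrightarrow> r < norm x \<and> norm x < 1"
  by (auto simp: annulus_def)

lemma open_annulus: "open (annulus r)"
  by (simp add: annulus_def open_Diff)

lemma bounded_annulus: "bounded (annulus r)"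
  by (simp add: annulus_def bounded_diff)

lemma closure_annulus_subset: "0 < r \<Longrightarrow> closure (annulus r) \<subseteq> - {0}"
proof -
  assume "0 < r"
  have "closure (annulus r) \<subseteq> {x. r \<le> norm x}"
    by (rule closure_minimal) (auto simp: annulus_iff intro!: closed_Collect_le continuous_intros)
  then show ?thesis using \<open>0 < r\<close> by auto
qed

lemma polar_representation:
  obtains \<theta> where "\<theta> \<in> {0..<2 * pi}" "x = polar (norm x) \<theta>"
proof (cases "x = 0")
  case True
  then show ?thesis using that[of 0] by (simp add: vec2_eq_iff)
next
  case False
  then have n: "norm x > 0" by simp
  have "(norm x)\<^sup>2 = (x $ 1)\<^sup>2 + (x $ 2)\<^sup>2"
    by (simp add: norm_vec_def L2_set_def sum_2)
  moreover have "(x $ 1 / norm x)\<^sup>2 + (x $ 2 / norm x)\<^sup>2 = ((x $ 1)\<^sup>2 + (x $ 2)\<^sup>2) / (norm x)\<^sup>2"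
    by (simp add: power_divide add_divide_distrib)
  ultimately have "(x $ 1 / norm x)\<^sup>2 + (x $ 2 / norm x)\<^sup>2 = 1"
    using n by (metis divide_self less_irrefl power_not_zero)
  then obtain t where "0 \<le> t" "t < 2 * pi" "x $ 1 / norm x = cos t" "x $ 2 / norm x = sin t"
    using sincos_total_2pi by metis
  then have "x = polar (norm x) t"
    unfolding vec2_eq_iff polar_nth using n by (metis nonzero_mult_div_cancel_left times_divide_eq_right less_irrefl)
  then show ?thesis using that \<open>0 \<le> t\<close> \<open>t < 2 * pi\<close> by simp
qed

lemma continuous_on_polar [continuous_intros]:
  assumes "continuous_on S f" "continuous_on S g"
  shows "continuous_on S (\<lambda>x. polar (f x) (g x))"
proof -
  have [continuous_intros]: "continuous_on S (\<lambda>x. cos (g x))" "continuous_on S (\<lambda>x. sin (g x))"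
    by (rule continuous_on_compose2[of UNIV _ S g]; use assms(2) in \<open>auto intro: continuous_intros\<close>)+
  have "continuous_on S (\<lambda>x. (\<chi> i. if i = 1 then f x * cos (g x) else f x * sin (g x)) :: real^2)"
  proof (rule continuous_on_vec_lambda)
    fix i :: 2
    show "continuous_on S (\<lambda>x. if i = 1 then f x * cos (g x) else f x * sin (g x))"
      by (cases "i = 1") (auto intro!: continuous_intros assms)
  qed
  moreover have "polar a b = (\<chi> i. if i = 1 then a * cos b else a * sin b)" for a b
    by (simp add: vec2_eq_iff)
  ultimately show ?thesis by simp
qed

text \<open>The bijection \<open>T\<close> from pairs to vectors preserves the content of boxes, so
  Fubini's theorem carries over from the product type.\<close>

lemma integral_cbox_vec2:
  fixes f :: "real^2 \<Rightarrow> real"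
  assumes "continuous_on (cbox (vector [a, c]) (vector [b, d])) f"
  shows "integral (cbox (vector [a, c]) (vector [b, d])) f
       = integral {a..b} (\<lambda>x. integral {c..d} (\<lambda>y. f (vector [x, y])))"
proof -
  define T :: "real \<times> real \<Rightarrow> real^2" where "T p = vector [fst p, snd p]" for p
  define T' :: "real^2 \<Rightarrow> real \<times> real" where "T' x = (x $ 1, x $ 2)" for x
  have inv: "T' (T p) = p" "T (T' x) = x" for p x
    by (auto simp: T_def T'_def vec2_eq_iff)
  have cbox: "cbox (vector [a, c] :: real^2) (vector [b, d]) = {x. a \<le> x $ 1 \<and> x $ 1 \<le> b \<and> c \<le> x $ 2 \<and> x $ 2 \<le> d}" for a b c d :: real
    by (auto simp: mem_box_cart forall_2)
  have img: "T ` A = {x. T' x \<in> A}" "T' ` B = {p. T p \<in> B}" for A B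
    using inv by (auto simp: image_iff) metis+
  have T_img: "T ` cbox u v = cbox (vector [fst u, snd u]) (vector [fst v, snd v])" for u v
  proof -
    show ?thesis unfolding cbox img by (cases u; cases v) (auto simp: T'_def cbox_Pair_eq)
  qed
  have T'_img: "T' ` cbox u v = cbox (u $ 1, u $ 2) (v $ 1, v $ 2)" for u v
  proof -
    have "u = vector [u $ 1, u $ 2]" "v = vector [v $ 1, v $ 2]" by (simp_all add: vec2_eq_iff)
    then show ?thesis using cbox[of "u $ 1" "u $ 2" "v $ 1" "v $ 2"]
      by (auto simp: img T_def cbox_Pair_eq)
  qed
  have contT: "continuous_on UNIV T"
  proof -
    have "continuous_on UNIV (\<lambda>p. (\<chi> i. if i = 1 then fst p else snd p) :: real^2)"
    proof (rule continuous_on_vec_lambda)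
      fix i :: 2
      show "continuous_on UNIV (\<lambda>p::real \<times> real. if i = 1 then fst p else snd p)"
        by (cases "i = 1") (auto intro!: continuous_intros)
    qed
    moreover have "T = (\<lambda>p. \<chi> i. if i = 1 then fst p else snd p)"
      by (simp add: T_def vec2_eq_iff fun_eq_iff)
    ultimately show ?thesis by simp
  qed
  have content: "measure lborel (T ` cbox u v) = 1 * measure lborel (cbox u v)" for u v
  proof (cases u; cases v)
    fix u1 u2 v1 v2 assume uv: "u = (u1, u2)" "v = (v1, v2)"
    show ?thesis
    proof (cases "u1 \<le> v1 \<and> u2 \<le> v2")
      case True
      then have "measure lborel (cbox (vector [u1, u2] :: real^2) (vector [v1, v2])) = (v1 - u1) * (v2 - u2)"
        by (subst content_cbox_cart) (auto simp: cbox UNIV_2 intro!: exI[of _ "vector [u1, u2] :: real^2"])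
      then show ?thesis using True by (simp add: T_img uv content_Pair content_cbox)
    next
      case False
      then have "cbox (vector [u1, u2] :: real^2) (vector [v1, v2]) = {}" "cbox u v = {}"
        by (auto simp: cbox uv cbox_Pair_eq)
      then show ?thesis by (simp add: T_img uv)
    qed
  qed
  have "(f has_integral integral (cbox (vector [a, c]) (vector [b, d])) f) (cbox (vector [a, c]) (vector [b, d]))"
    using assms by (intro integrable_integral integrable_continuous)
  then have "((\<lambda>x. f (T x)) has_integral (1 / 1) *\<^sub>R integral (cbox (vector [a, c]) (vector [b, d])) f)
      (T' ` cbox (vector [a, c]) (vector [b, d]))"
    by (intro has_integral_twiddle[of 1 T' T])
      (use inv contT T_img T'_img content in \<open>auto simp: continuous_on_eq_continuous_at\<close>)
  then have "integral (cbox (vector [a, c]) (vector [b, d])) f = integral (cbox (a, c) (b, d)) (\<lambda>x. f (T x))"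
    by (simp add: T'_img integral_unique)
  also have "\<dots> = integral (cbox a b) (\<lambda>x. integral (cbox c d) (\<lambda>y. f (T (x, y))))"
  proof (rule integral_prod_continuous, rule continuous_on_compose2[OF assms])
    show "continuous_on (cbox (a, c) (b, d)) T" using contT by (rule continuous_on_subset) simp
    show "T ` cbox (a, c) (b, d) \<subseteq> cbox (vector [a, c]) (vector [b, d])" by (simp add: T_img)
  qed
  finally show ?thesis by (simp add: T_def)
qed

lemma sin_cos_inj:
  assumes "s \<in> {0..<2 * pi}" "t \<in> {0..<2 * pi}" "cos s = cos t" "sin s = sin t"
  shows "s = t"
proof -
  obtain n :: int where n: "s = t + 2 * pi * n"
    using assms(3,4) sin_cos_eq_iff by metis
  then have "\<bar>2 * pi * n\<bar> < 2 * pi" using assms(1,2) by auto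
  then have "\<bar>real_of_int n\<bar> < 1" by (simp add: abs_mult)
  then show ?thesis using n by simp
qed

text \<open>On the open rectangle \<open>S\<close> polar coordinates are injective with Jacobian
  determinant \<open>\<rho>\<close>, and the image fills the annulus up to a null set.\<close>

lemma polar_integral_annulus:
  fixes h :: "real^2 \<Rightarrow> real"
  assumes r: "0 < r" "r < 1" and h: "continuous_on (- {0}) h"
  shows "(\<integral>x. h x \<partial>lebesgue_on (annulus r))
       = integral {0..2 * pi} (\<lambda>\<theta>. integral {r..1} (\<lambda>\<rho>. \<rho> * h (polar \<rho> \<theta>)))"
proof -
  define S :: "(real^2) set" where "S = box (vector [r, 0]) (vector [1, 2 * pi])"
  have S: "y \<in> S \<longleftrightarrow> r < y $ 1 \<and> y $ 1 < 1 \<and> 0 < y $ 2 \<and> y $ 2 < 2 * pi" for y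
    by (auto simp: S_def mem_box_cart forall_2)
  define g :: "real^2 \<Rightarrow> real^2" where "g y = polar (y $ 1) (y $ 2)" for y
  define g' :: "real^2 \<Rightarrow> real^2 \<Rightarrow> real^2" where
    "g' y k = vector [k $ 1 * cos (y $ 2) - y $ 1 * sin (y $ 2) * k $ 2,
                      k $ 1 * sin (y $ 2) + y $ 1 * cos (y $ 2) * k $ 2]" for y k
  have der: "(g has_derivative g' y) (at y within S)" for y
  proof (subst has_derivative_componentwise_within, intro ballI)
    fix b :: "real^2" assume "b \<in> Basis"
    then obtain i where b: "b = axis i 1" by (auto simp: Basis_vec_def)
    have "i = 1 \<or> i = 2" using exhaust_2 by blast
    then show "((\<lambda>x. g x \<bullet> b) has_derivative (\<lambda>x. g' y x \<bullet> b)) (at y within S)"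
      by (auto simp: b inner_axis g_def g'_def algebra_simps
          intro!: derivative_eq_intros bounded_linear_imp_has_derivative[OF bounded_linear_vec_nth])
  qed
  have lin: "det (matrix (g' y)) = y $ 1" for y
  proof -
    have entries: "matrix (g' y) $ 1 $ 1 = cos (y $ 2)" "matrix (g' y) $ 1 $ 2 = - (y $ 1) * sin (y $ 2)"
      "matrix (g' y) $ 2 $ 1 = sin (y $ 2)" "matrix (g' y) $ 2 $ 2 = y $ 1 * cos (y $ 2)"
      by (simp_all add: matrix_def g'_def axis_def)
    have "det (matrix (g' y)) = cos (y $ 2) * (y $ 1 * cos (y $ 2)) - - (y $ 1) * sin (y $ 2) * sin (y $ 2)"
      unfolding det_2 entries ..
    also have "\<dots> = y $ 1 * ((sin (y $ 2))\<^sup>2 + (cos (y $ 2))\<^sup>2)" by algebra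
    finally show ?thesis by simp
  qed
  have inj: "inj_on g S"
  proof (rule inj_onI)
    fix x y assume x: "x \<in> S" and y: "y \<in> S" and eq: "g x = g y"
    have "norm (g x) = norm (g y)" using eq by simp
    then have 1: "x $ 1 = y $ 1" using x y r by (simp add: S g_def)
    moreover have "x $ 1 \<noteq> 0" using x r by (simp add: S)
    ultimately have "cos (x $ 2) = cos (y $ 2)" "sin (x $ 2) = sin (y $ 2)"
      using eq by (auto simp: g_def vec2_eq_iff)
    then have "x $ 2 = y $ 2"
      by (rule sin_cos_inj[rotated 2]) (use x y in \<open>simp_all add: S\<close>)
    with 1 show "x = y" by (simp add: vec2_eq_iff)
  qed
  have img: "g ` S \<subseteq> annulus r"
    using r by (auto simp: S g_def annulus_iff)
  \<comment> \<open>A point of the annulus outside the image has angle 0 and hence lies on the first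
    coordinate axis.\<close>
  have neg: "negligible (annulus r - g ` S)"
  proof (rule negligible_subset)
    show "negligible {x::real^2. axis 2 1 \<bullet> x = 0}"
      by (rule negligible_hyperplane) (simp add: axis_eq_0_iff)
    show "annulus r - g ` S \<subseteq> {x. axis 2 1 \<bullet> x = 0}"
    proof
      fix x assume x: "x \<in> annulus r - g ` S"
      obtain \<theta> where \<theta>: "\<theta> \<in> {0..<2 * pi}" "x = polar (norm x) \<theta>" by (rule polar_representation)
      have "\<theta> = 0"
      proof (rule ccontr)
        assume "\<theta> \<noteq> 0"
        then have "vector [norm x, \<theta>] \<in> S" using x \<theta>(1) by (auto simp: S annulus_iff)
        moreover have "g (vector [norm x, \<theta>]) = x" using \<theta>(2) by (simp add: g_def)
        ultimately show False using x by force
      qed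
      then have "x $ 2 = 0" using \<theta>(2) by (metis mult_zero_right polar_nth(2) sin_zero)
      then show "x \<in> {x. axis 2 1 \<bullet> x = 0}" by (simp add: inner_axis')
    qed
  qed
  have int: "integrable (lebesgue_on (annulus r)) h"
    using open_annulus bounded_annulus h closure_annulus_subset[OF r(1)]
    by (rule integrable_lebesgue_on_if_continuous_on)
  have aint: "h absolutely_integrable_on annulus r"
    using int open_annulus by (simp add: set_integrable_def integrable_restrict_space)
  have neg_h: "negligible {x \<in> annulus r - g ` S. h x \<noteq> 0}" "negligible {x \<in> g ` S - annulus r. h x \<noteq> 0}"
    using img by (auto intro: negligible_subset[OF neg] simp: subset_iff)
  have "h absolutely_integrable_on g ` S"
    using aint neg_h by (rule absolutely_integrable_spike_set)
  \<comment> \<open>The change of variables formula is applied to functions with values in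
    \<open>real^1\<close>; \<open>vec\<close> and the component 1 translate to and from
    \<open>real\<close>.\<close>
  then have vint: "(\<lambda>x. vec (h x) :: real^1) absolutely_integrable_on g ` S"
    using absolutely_integrable_linear[where f=h, OF _ linear_vec[THEN linear_conv_bounded_linear[THEN iffD1]]] by (simp add: o_def)
  have "(\<integral>x. h x \<partial>lebesgue_on (annulus r)) = integral (annulus r) h"
    using int open_annulus by (simp add: lebesgue_integral_eq_integral)
  also have "\<dots> = integral (g ` S) h"
    using neg_h by (rule integral_spike_set)
  also have "\<dots> = integral (g ` S) (\<lambda>x. vec (h x) :: real^1) $ 1"
    using integral_linear[OF set_lebesgue_integral_eq_integral(1)[OF vint] bounded_linear_vec_nth[of 1]]
    by (simp add: o_def)
  also have "integral (g ` S) (\<lambda>x. vec (h x) :: real^1) = integral S (\<lambda>y. \<bar>det (matrix (g' y))\<bar> *\<^sub>R vec (h (g y)))"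
    by (rule integral_change_of_variables) (use der inj vint in \<open>auto simp: S_def\<close>)
  also have "\<dots> $ 1 = integral S (\<lambda>y. y $ 1 * h (g y))"
  proof -
    have "(\<lambda>y. \<bar>det (matrix (g' y))\<bar> *\<^sub>R (vec (h (g y)) :: real^1)) absolutely_integrable_on S"
      using vint by (subst absolutely_integrable_change_of_variables[symmetric]) (use der inj in \<open>auto simp: S_def\<close>)
    then have "integral S (\<lambda>y. \<bar>det (matrix (g' y))\<bar> *\<^sub>R (vec (h (g y)) :: real^1)) $ 1
        = integral S (\<lambda>y. \<bar>det (matrix (g' y))\<bar> * h (g y))"
      using integral_linear[OF set_lebesgue_integral_eq_integral(1) bounded_linear_vec_nth[of 1]]
      by (fastforce simp: o_def)
    also have "\<dots> = integral S (\<lambda>y. y $ 1 * h (g y))"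
      by (rule Henstock_Kurzweil_Integration.integral_cong) (use r in \<open>auto simp: lin S\<close>)
    finally show ?thesis .
  qed
  also have "\<dots> = integral (cbox (vector [r, 0]) (vector [1, 2 * pi])) (\<lambda>y. y $ 1 * h (g y))"
    unfolding S_def by (rule integral_open_interval)
  also have "\<dots> = integral {r..1} (\<lambda>\<rho>. integral {0..2 * pi} (\<lambda>\<theta>. \<rho> * h (polar \<rho> \<theta>)))"
  proof (subst integral_cbox_vec2)
    show "continuous_on (cbox (vector [r, 0]) (vector [1, 2 * pi])) (\<lambda>y. y $ 1 * h (g y))"
      unfolding g_def using r
      by (intro continuous_intros continuous_on_compose2[OF h])
        (auto simp: mem_box_cart forall_2 polar_ne_0)
  qed (simp add: g_def)
  \<comment> \<open>The radial integral is moved inside because that is where the fundamental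
    theorem of calculus and Bessel's equation will act, at a fixed angle.\<close>
  also have "\<dots> = integral {0..2 * pi} (\<lambda>\<theta>. integral {r..1} (\<lambda>\<rho>. \<rho> * h (polar \<rho> \<theta>)))"
  proof -
    have "continuous_on (cbox (r, 0) (1, 2 * pi)) (\<lambda>(\<rho>, \<theta>). \<rho> * h (polar \<rho> \<theta>))"
      unfolding case_prod_unfold using r
      by (intro continuous_intros continuous_on_compose2[OF h]) (auto simp: cbox_Pair_eq polar_ne_0)
    from integral_swap_continuous[OF this] show ?thesis by simp
  qed
  finally show ?thesis .
qed

section \<open>Radial and tangential derivatives\<close>

lemma has_vector_derivative_polar_radius:
  assumes E: "C1_on (- {0}) E" and \<rho>: "\<rho> \<noteq> 0"
  shows "((\<lambda>\<rho>. E (polar \<rho> \<theta>)) has_vector_derivative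
           frechet_derivative E (at (polar \<rho> \<theta>)) (polar 1 \<theta>)) (at \<rho>)"
proof -
  have eq: "(\<lambda>\<rho>. polar \<rho> \<theta>) = (\<lambda>\<rho>. \<rho> *\<^sub>R polar 1 \<theta>)"
    by (simp add: vec2_eq_iff fun_eq_iff)
  have "((\<lambda>\<rho>. polar \<rho> \<theta>) has_vector_derivative polar 1 \<theta>) (at \<rho>)"
    unfolding eq by (auto intro!: derivative_eq_intros)
  from vector_derivative_diff_chain_within[OF this has_derivative_at_withinI[OF C1_on_has_derivative[OF E]]] \<rho>
  show ?thesis by (simp add: o_def polar_ne_0)
qed

text \<open>A quarter turn of the radial unit vector is the unit tangent, so
  \<open>polar 1 (\<theta> + pi / 2)\<close> describes it in the same notation; moving along the
  circle has speed \<open>\<rho>\<close> in the angle.\<close>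

lemma has_vector_derivative_polar_angle:
  assumes E: "C1_on (- {0}) E" and \<rho>: "\<rho> \<noteq> 0"
  shows "((\<lambda>\<theta>. E (polar \<rho> \<theta>)) has_vector_derivative
           \<rho> *\<^sub>R frechet_derivative E (at (polar \<rho> \<theta>)) (polar 1 (\<theta> + pi / 2))) (at \<theta>)"
proof -
  have eq: "polar \<rho> \<theta> = (\<rho> * cos \<theta>) *\<^sub>R axis 1 1 + (\<rho> * sin \<theta>) *\<^sub>R axis 2 1" for \<theta>
    by (simp add: vec2_eq_iff axis_def)
  have "((\<lambda>\<theta>. polar \<rho> \<theta>) has_vector_derivative
      (\<rho> * - sin \<theta>) *\<^sub>R axis 1 1 + (\<rho> * cos \<theta>) *\<^sub>R axis 2 1) (at \<theta>)"
    unfolding eq by (auto intro!: derivative_eq_intros has_vector_derivative_add simp: has_vector_derivative_scaleR mult.commute)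
  moreover have "(\<rho> * - sin \<theta>) *\<^sub>R axis 1 1 + (\<rho> * cos \<theta>) *\<^sub>R axis 2 1 = \<rho> *\<^sub>R polar 1 (\<theta> + pi / 2)"
    by (simp add: vec2_eq_iff axis_def sin_add cos_add)
  ultimately have "((\<lambda>\<theta>. polar \<rho> \<theta>) has_vector_derivative \<rho> *\<^sub>R polar 1 (\<theta> + pi / 2)) (at \<theta>)"
    by simp
  from vector_derivative_diff_chain_within[OF this has_derivative_at_withinI[OF C1_on_has_derivative[OF E]]] \<rho>
  have "((\<lambda>\<theta>. E (polar \<rho> \<theta>)) has_vector_derivative
      frechet_derivative E (at (polar \<rho> \<theta>)) (\<rho> *\<^sub>R polar 1 (\<theta> + pi / 2))) (at \<theta>)"
    by (simp add: o_def polar_ne_0)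
  moreover have "linear (frechet_derivative E (at (polar \<rho> \<theta>)))"
    using E \<rho> by (simp add: C1_on_def linear_frechet_derivative polar_ne_0)
  ultimately show ?thesis by (simp add: linear_cmul)
qed

text \<open>The radial and tangential unit vectors form an orthonormal frame, and the sum of
  products of directional derivatives is the same in every such frame: the mixed terms cancel and
  squares of sine and cosine add up to 1.\<close>

lemma cinner_classical_grad_polar:
  fixes u w :: "real^2 \<Rightarrow> complex"
  assumes "u differentiable (at x)" "w differentiable (at x)"
  defines "U \<equiv> frechet_derivative u (at x)" and "W \<equiv> frechet_derivative w (at x)"
  shows "cinner (classical_grad u x) (classical_grad w x)
       = U (polar 1 \<theta>) * cnj (W (polar 1 \<theta>)) + U (polar 1 (\<theta> + pi / 2)) * cnj (W (polar 1 (\<theta> + pi / 2)))"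
proof -
  have lin: "linear U" "linear W"
    using assms by (auto simp: linear_frechet_derivative)
  have dec: "polar 1 \<theta> = cos \<theta> *\<^sub>R axis 1 1 + sin \<theta> *\<^sub>R axis 2 1"
     "polar 1 (\<theta> + pi / 2) = (- sin \<theta>) *\<^sub>R axis 1 1 + cos \<theta> *\<^sub>R axis 2 1"
    by (simp_all add: vec2_eq_iff axis_def sin_add cos_add)
  have dec': "L (polar 1 \<theta>) = of_real (cos \<theta>) * L (axis 1 1) + of_real (sin \<theta>) * L (axis 2 1)"
    "L (polar 1 (\<theta> + pi / 2)) = - of_real (sin \<theta>) * L (axis 1 1) + of_real (cos \<theta>) * L (axis 2 1)"
    if "linear L" for L :: "real^2 \<Rightarrow> complex"
    unfolding dec by (simp_all only: linear_add[OF that] linear_cmul[OF that])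
      (simp_all add: scaleR_conv_of_real)
  have sc: "(of_real (sin \<theta>))\<^sup>2 + (of_real (cos \<theta>) :: complex)\<^sup>2 = 1"
    by (simp flip: of_real_power of_real_add)
  have "U (polar 1 \<theta>) * cnj (W (polar 1 \<theta>)) + U (polar 1 (\<theta> + pi / 2)) * cnj (W (polar 1 (\<theta> + pi / 2)))
      = ((of_real (sin \<theta>))\<^sup>2 + (of_real (cos \<theta>))\<^sup>2) * (U (axis 1 1) * cnj (W (axis 1 1)) + U (axis 2 1) * cnj (W (axis 2 1)))"
    unfolding dec'[OF lin(1)] dec'[OF lin(2)] by (simp add: algebra_simps power2_eq_square)
  then show ?thesis
    unfolding sc by (simp add: cinner_def classical_grad_def sum_2 U_def W_def)
qed

lemma mult_cnj_eq_norm_square: "z * cnj z = (of_real (cmod z))\<^sup>2"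
  by (metis complex_norm_square of_real_power)

lemma norm_vec_complex_eq_cinner: "of_real ((norm a)\<^sup>2) = cinner a (a :: complex^'n)"
proof -
  have "(norm a)\<^sup>2 = (\<Sum>i\<in>UNIV. (norm (a $ i))\<^sup>2)"
    by (simp add: norm_vec_def L2_set_def sum_nonneg)
  then show ?thesis by (simp add: cinner_def mult_cnj_eq_norm_square)
qed

lemma norm_classical_grad_polar:
  assumes "u differentiable (at x)"
  shows "(norm (classical_grad u x))\<^sup>2 = (cmod (frechet_derivative u (at x) (polar 1 \<theta>)))\<^sup>2
           + (cmod (frechet_derivative u (at x) (polar 1 (\<theta> + pi / 2))))\<^sup>2"
proof -
  have "complex_of_real ((norm (classical_grad u x))\<^sup>2) = of_real ((cmod (frechet_derivative u (at x) (polar 1 \<theta>)))\<^sup>2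
           + (cmod (frechet_derivative u (at x) (polar 1 (\<theta> + pi / 2))))\<^sup>2)"
    unfolding norm_vec_complex_eq_cinner cinner_classical_grad_polar[OF assms assms, of \<theta>]
    by (simp add: mult_cnj_eq_norm_square)
  then show ?thesis by (simp only: of_real_eq_iff)
qed

section \<open>Traces on the boundary circles\<close>

text \<open>The fundamental theorem of calculus for \<open>a \<bar>E\<bar>\<^sup>2\<close> along the ray, where the affine weight \<open>a\<close> is 1 at
  \<open>s\<close> and 0 at the other end.\<close>

lemma trace_inequality_ray:
  fixes E :: "real^2 \<Rightarrow> complex"
  assumes r: "0 < r" "r < 1" and E: "C1_on (- {0}) E" and s: "s \<in> {r, 1}"
  shows "(cmod (E (polar s \<theta>)))\<^sup>2 \<le> integral {r..1} (\<lambda>\<rho>. \<rho> *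
           ((1 + 1 / (1 - r)) / r * ((cmod (E (polar \<rho> \<theta>)))\<^sup>2 + (norm (classical_grad E (polar \<rho> \<theta>)))\<^sup>2)))"
proof -
  \<comment> \<open>The endpoint of \<open>{r..1}\<close> opposite to \<open>s\<close>.\<close>
  define t where "t = r + 1 - s"
  have st: "\<bar>s - t\<bar> = 1 - r" "s - t \<noteq> 0" using s r by (auto simp: t_def)
  define a where "a \<rho> = (\<rho> - t) / (s - t)" for \<rho>
  define e where "e \<rho> = E (polar \<rho> \<theta>)" for \<rho>
  define e' where "e' \<rho> = frechet_derivative E (at (polar \<rho> \<theta>)) (polar 1 \<theta>)" for \<rho>
  define G where "G \<rho> = norm (classical_grad E (polar \<rho> \<theta>))" for \<rho>
  \<comment> \<open>Origin of the constant: \<open>1 / (1 - r)\<close> is the size of the slope of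
    \<open>a\<close>; the summand 1 comes from \<open>\<bar>a\<bar> \<le> 1\<close> and from
    estimating twice a product by the sum of squares; the division by \<open>r\<close> uses
    \<open>\<rho> / r \<ge> 1\<close> to bring in the area weight \<open>\<rho>\<close>.\<close>
  define B where "B \<rho> = \<rho> * ((1 + 1 / (1 - r)) / r * ((cmod (e \<rho>))\<^sup>2 + (G \<rho>)\<^sup>2))" for \<rho>
  define d where "d \<rho> = (cmod (e \<rho>))\<^sup>2 / (s - t) + a \<rho> * (2 * (e \<rho> \<bullet> e' \<rho>))" for \<rho>
  have e: "(e has_vector_derivative e' \<rho>) (at \<rho>)" if "\<rho> \<in> {r..1}" for \<rho>
    unfolding e_def[abs_def] e'_def using r that by (intro has_vector_derivative_polar_radius E) auto
  have "((\<lambda>\<rho>. a \<rho> * (e \<rho> \<bullet> e \<rho>)) has_real_derivative d \<rho>) (at \<rho>)" if "\<rho> \<in> {r..1}" for \<rho>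
  proof -
    have "((\<lambda>\<rho>. e \<rho> \<bullet> e \<rho>) has_derivative (\<lambda>h. e \<rho> \<bullet> (h *\<^sub>R e' \<rho>) + (h *\<^sub>R e' \<rho>) \<bullet> e \<rho>)) (at \<rho>)"
      using e[OF that] by (intro has_derivative_inner) (auto simp: has_vector_derivative_def)
    then have "((\<lambda>\<rho>. e \<rho> \<bullet> e \<rho>) has_real_derivative 2 * (e \<rho> \<bullet> e' \<rho>)) (at \<rho>)"
      by (rule has_derivative_imp_has_field_derivative) (simp add: inner_commute)
    moreover have "(a has_real_derivative 1 / (s - t)) (at \<rho>)"
      unfolding a_def[abs_def] using st(2) by (auto intro!: derivative_eq_intros)
    ultimately have "((\<lambda>\<rho>. a \<rho> * (e \<rho> \<bullet> e \<rho>)) has_real_derivative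
        1 / (s - t) * (e \<rho> \<bullet> e \<rho>) + 2 * (e \<rho> \<bullet> e' \<rho>) * a \<rho>) (at \<rho>)"
      by (intro DERIV_mult)
    then show ?thesis by (simp add: d_def dot_square_norm algebra_simps)
  qed
  then have ftc: "(d has_integral a 1 * (e 1 \<bullet> e 1) - a r * (e r \<bullet> e r)) {r..1}"
    using r by (intro fundamental_theorem_of_calculus)
      (auto simp: has_real_derivative_iff_has_vector_derivative intro: has_vector_derivative_at_within)
  have bound: "norm (d \<rho>) \<le> B \<rho>" if \<rho>: "\<rho> \<in> {r..1}" for \<rho>
  proof -
    have "cmod (e' \<rho>) \<le> G \<rho>"
    proof (rule power2_le_imp_le)
      have "E differentiable (at (polar \<rho> \<theta>))" using E \<rho> r by (simp add: C1_on_def polar_ne_0)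
      from norm_classical_grad_polar[OF this, of \<theta>] show "(cmod (e' \<rho>))\<^sup>2 \<le> (G \<rho>)\<^sup>2"
        by (simp add: e'_def G_def)
    qed (simp add: G_def)
    have "\<bar>\<rho> - t\<bar> \<le> 1 - r" using s \<rho> r by (auto simp: t_def)
    then have "\<bar>a \<rho>\<bar> \<le> 1"
      unfolding a_def abs_divide st(1) using r by simp
    have "\<bar>e \<rho> \<bullet> e' \<rho>\<bar> \<le> cmod (e \<rho>) * G \<rho>"
      using Cauchy_Schwarz_ineq2[of "e \<rho>" "e' \<rho>"] \<open>cmod (e' \<rho>) \<le> G \<rho>\<close>
      by (meson mult_left_mono norm_ge_zero order_trans)
    moreover have "2 * (cmod (e \<rho>) * G \<rho>) \<le> (cmod (e \<rho>))\<^sup>2 + (G \<rho>)\<^sup>2"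
      using zero_le_power2[of "cmod (e \<rho>) - G \<rho>"] by (simp add: power2_diff)
    ultimately have "\<bar>2 * (e \<rho> \<bullet> e' \<rho>)\<bar> \<le> (cmod (e \<rho>))\<^sup>2 + (G \<rho>)\<^sup>2"
      by linarith
    then have "\<bar>a \<rho> * (2 * (e \<rho> \<bullet> e' \<rho>))\<bar> \<le> 1 * ((cmod (e \<rho>))\<^sup>2 + (G \<rho>)\<^sup>2)"
      unfolding abs_mult[of "a \<rho>"] using \<open>\<bar>a \<rho>\<bar> \<le> 1\<close> by (intro mult_mono) auto
    moreover have "\<bar>(cmod (e \<rho>))\<^sup>2 / (s - t)\<bar> \<le> 1 / (1 - r) * ((cmod (e \<rho>))\<^sup>2 + (G \<rho>)\<^sup>2)"
      unfolding abs_divide st(1) using r by (simp add: divide_right_mono)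
    ultimately have "\<bar>d \<rho>\<bar> \<le> 1 / (1 - r) * ((cmod (e \<rho>))\<^sup>2 + (G \<rho>)\<^sup>2) + 1 * ((cmod (e \<rho>))\<^sup>2 + (G \<rho>)\<^sup>2)"
      unfolding d_def by (rule order_trans[OF abs_triangle_ineq add_mono[rotated]])
    also have "\<dots> = (1 + 1 / (1 - r)) * ((cmod (e \<rho>))\<^sup>2 + (G \<rho>)\<^sup>2)"
      by (simp only: distrib_right add.commute)
    also have "\<dots> \<le> \<rho> / r * ((1 + 1 / (1 - r)) * ((cmod (e \<rho>))\<^sup>2 + (G \<rho>)\<^sup>2))"
    proof -
      have "1 \<le> \<rho> / r" using \<rho> r by simp
      moreover have "0 \<le> (1 + 1 / (1 - r)) * ((cmod (e \<rho>))\<^sup>2 + (G \<rho>)\<^sup>2)"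
        using r by (intro mult_nonneg_nonneg) auto
      ultimately show ?thesis using mult_right_mono by fastforce
    qed
    finally show ?thesis by (simp add: B_def)
  qed
  have "continuous_on {r..1} B"
    unfolding B_def e_def G_def using r
    by (intro continuous_intros continuous_on_compose2[OF C1_on_imp_continuous_on[OF E]]
        continuous_on_compose2[OF continuous_on_classical_grad[OF E]]) (auto simp: polar_ne_0)
  then have "B integrable_on {r..1}" by (rule integrable_continuous_real)
  have "a s = 1" "a t = 0" using st(2) by (auto simp: a_def)
  \<comment> \<open>The boundary term has a positive sign for \<open>s = 1\<close> and a negative
    one for \<open>s = r\<close>; the norm treats both cases at once.\<close>
  then have "(cmod (e s))\<^sup>2 = norm (a 1 * (e 1 \<bullet> e 1) - a r * (e r \<bullet> e r))"
    using s by (auto simp: t_def dot_square_norm)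
  also have "\<dots> = norm (integral {r..1} d)" using ftc by (simp add: integral_unique)
  also have "\<dots> \<le> integral {r..1} B"
    using ftc bound \<open>B integrable_on {r..1}\<close> by (intro integral_norm_bound_integral) auto
  finally show ?thesis unfolding B_def e_def G_def .
qed

lemma trace_inequality:
  fixes E :: "real^2 \<Rightarrow> complex"
  assumes r: "0 < r" "r < 1" and E: "C1_on (- {0}) E" and s: "s \<in> {r, 1}"
  shows "integral {0..2 * pi} (\<lambda>\<theta>. (cmod (E (polar s \<theta>)))\<^sup>2) \<le> (1 + 1 / (1 - r)) / r *
           (\<integral>x. (cmod (E x))\<^sup>2 + (norm (classical_grad E x))\<^sup>2 \<partial>lebesgue_on (annulus r))"
proof -
  define h where "h x = (1 + 1 / (1 - r)) / r * ((cmod (E x))\<^sup>2 + (norm (classical_grad E x))\<^sup>2)" for x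
  have h: "continuous_on (- {0}) h"
    unfolding h_def by (intro continuous_intros C1_on_imp_continuous_on[OF E] continuous_on_classical_grad[OF E])
  have c: "continuous_on (cbox (0, r) (2 * pi, 1)) (\<lambda>(\<theta>, \<rho>). \<rho> * h (polar \<rho> \<theta>))"
    unfolding case_prod_unfold using r
    by (intro continuous_intros continuous_on_compose2[OF h]) (auto simp: cbox_Pair_eq polar_ne_0)
  have "integral {0..2 * pi} (\<lambda>\<theta>. (cmod (E (polar s \<theta>)))\<^sup>2)
      \<le> integral {0..2 * pi} (\<lambda>\<theta>. integral {r..1} (\<lambda>\<rho>. \<rho> * h (polar \<rho> \<theta>)))"
  proof (rule integral_le)
    show "(\<lambda>\<theta>. (cmod (E (polar s \<theta>)))\<^sup>2) integrable_on {0..2 * pi}"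
      using r s by (intro integrable_continuous_real continuous_intros
          continuous_on_compose2[OF C1_on_imp_continuous_on[OF E]]) (auto simp: polar_ne_0)
    show "(\<lambda>\<theta>. integral {r..1} (\<lambda>\<rho>. \<rho> * h (polar \<rho> \<theta>))) integrable_on {0..2 * pi}"
      using integral_integrable_2dim[OF c] by simp
  qed (unfold h_def, rule trace_inequality_ray[OF assms])
  also have "\<dots> = (\<integral>x. h x \<partial>lebesgue_on (annulus r))"
    by (rule polar_integral_annulus[OF r h, symmetric])
  finally show ?thesis unfolding h_def by simp
qed

text \<open>Substitution of arc length \<open>t = s \<theta>\<close>, which produces the factor
  \<open>s\<close>; the half-open and the closed parameter interval differ by a null set.\<close>

lemma integral_arc_measure:
  fixes F :: "real^2 \<Rightarrow> real"
  assumes s: "s > 0" and F: "continuous_on UNIV F"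
  shows "(\<integral>x. F x \<partial>arc_measure s) = s * integral {0..2 * pi} (\<lambda>\<theta>. F (polar s \<theta>))"
proof -
  have cont: "continuous_on UNIV (\<lambda>t. polar s (t / s))"
    using s by (intro continuous_intros) auto
  then have "(\<lambda>t. polar s (t / s)) \<in> borel \<rightarrow>\<^sub>M borel" by (rule borel_measurable_continuous_onI)
  then have meas: "(\<lambda>t. polar s (t / s)) \<in> restrict_space lborel {0..<2 * pi * s} \<rightarrow>\<^sub>M restrict_space borel (sphere 0 s)"
    using s by (intro measurable_restrict_space2 measurable_restrict_space1) auto
  have cF: "continuous_on A (\<lambda>\<theta>. F (polar s (\<theta> / s)))" for A
    using s by (intro continuous_on_compose2[OF F] continuous_intros) auto
  have "(\<integral>x. F x \<partial>arc_measure s) = (\<integral>t. F (polar s (t / s)) \<partial>restrict_space lborel {0..<2 * pi * s})"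
    unfolding arc_measure_def
    by (rule integral_distr[OF meas]) (intro measurable_restrict_space1 borel_measurable_continuous_onI F)
  also have "\<dots> = (\<integral>t\<in>{0..<2 * pi * s}. F (polar s (t / s)) \<partial>lborel)"
    by (simp add: integral_restrict_space set_lebesgue_integral_def)
  also have "\<dots> = (\<integral>t\<in>{0..2 * pi * s}. F (polar s (t / s)) \<partial>lborel)"
  proof (rule set_integral_cong_set)
    show "AE x in lborel. (x \<in> {0..2 * pi * s}) = (x \<in> {0..<2 * pi * s})"
      using AE_lborel_singleton[of "2 * pi * s"] by (rule AE_mp) (auto intro!: AE_I2)
    have "(\<lambda>t. F (polar s (t / s))) \<in> borel_measurable lborel"
      using borel_measurable_continuous_onI[OF cF] by simp
    then show "set_borel_measurable lborel {0..<2 * pi * s} (\<lambda>t. F (polar s (t / s)))"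
      "set_borel_measurable lborel {0..2 * pi * s} (\<lambda>t. F (polar s (t / s)))"
      unfolding set_borel_measurable_def by (intro borel_measurable_scaleR borel_measurable_indicator; simp)+
  qed
  also have "\<dots> = integral {0..2 * pi * s} (\<lambda>t. F (polar s (t / s)))"
    by (rule set_borel_integral_eq_integral(2)[OF borel_integrable_atLeastAtMost'[OF cF]])
  also have "\<dots> = s * integral {0..2 * pi} (\<lambda>\<theta>. F (polar s \<theta>))"
  proof -
    have "((\<lambda>t. F (polar s (t / s))) has_integral integral {0..2 * pi * s} (\<lambda>t. F (polar s (t / s)))) (cbox 0 (2 * pi * s))"
      using cF by (simp add: integrable_integral integrable_continuous_real)
    from has_integral_affinity[OF this, of s 0] s
    have "((\<lambda>\<theta>. F (polar s \<theta>)) has_integral integral {0..2 * pi * s} (\<lambda>t. F (polar s (t / s))) / s)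
        ((\<lambda>x. x / s) ` {0..2 * pi * s})"
      by simp
    moreover have "(\<lambda>x. x / s) ` {0..2 * pi * s} = {0..2 * pi}"
      using s by (simp add: image_divide_atLeastAtMost)
    ultimately show ?thesis using s by (simp add: integral_unique)
  qed
  finally show ?thesis .
qed

lemma H1_norm_power2_eq:
  assumes r: "0 < r" and u: "C1_on (- {0}) u" and eq: "\<And>x. x \<in> annulus r \<Longrightarrow> v x = u x"
  shows "(H1_norm (annulus r) v)\<^sup>2 =
      (\<integral>x. (cmod (u x))\<^sup>2 + (norm (classical_grad u x))\<^sup>2 \<partial>lebesgue_on (annulus r))"
proof -
  note cl = closure_annulus_subset[OF r]
  have int: "integrable (lebesgue_on (annulus r)) (\<lambda>x. (cmod (u x))\<^sup>2)"
     "integrable (lebesgue_on (annulus r)) (\<lambda>x. (norm (classical_grad u x))\<^sup>2)"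
    by (rule integrable_lebesgue_on_if_continuous_on[OF open_annulus bounded_annulus _ cl],
        intro continuous_intros C1_on_imp_continuous_on[OF u] continuous_on_classical_grad[OF u])+
  have AE: "AE x in lebesgue_on (annulus r). weak_grad (annulus r) v x = classical_grad u x"
    using eq by (rule AE_weak_grad_eq_classical_grad[OF open_annulus bounded_annulus u cl])
  have "(\<integral>x. (norm (weak_grad (annulus r) v x))\<^sup>2 \<partial>lebesgue_on (annulus r))
      = (\<integral>x. (norm (classical_grad u x))\<^sup>2 \<partial>lebesgue_on (annulus r))"
  proof (rule integral_cong_AE)
    show "(\<lambda>x. (norm (weak_grad (annulus r) v x))\<^sup>2) \<in> borel_measurable (lebesgue_on (annulus r))"
      using is_weak_grad_weak_grad[OF open_annulus bounded_annulus u cl eq]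
      by (auto simp: is_weak_grad_def square_integrable_on_def)
    show "(\<lambda>x. (norm (classical_grad u x))\<^sup>2) \<in> borel_measurable (lebesgue_on (annulus r))"
      using int(2) by (rule borel_measurable_integrable)
    show "AE x in lebesgue_on (annulus r). (norm (weak_grad (annulus r) v x))\<^sup>2 = (norm (classical_grad u x))\<^sup>2"
      using AE by (rule AE_mp) (auto intro!: AE_I2)
  qed
  moreover have "(\<integral>x. (cmod (v x))\<^sup>2 \<partial>lebesgue_on (annulus r)) = (\<integral>x. (cmod (u x))\<^sup>2 \<partial>lebesgue_on (annulus r))"
    using eq by (intro Bochner_Integration.integral_cong) (auto simp: space_restrict_space)
  ultimately show ?thesis
    using int by (simp add: H1_norm_def)
qed

text \<open>The approximants \<open>\<Phi> k\<close> have boundary integrals tending to 0 and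
  approach \<open>v\<close> in the norm of H^1. The trace inequality for
  \<open>\<Phi> k - u\<close>, which is C^1 across the circles, shows that they also approach
  \<open>u\<close> on the boundary.\<close>

lemma vanishing_trace_imp_boundary_integral_eq_0:
  assumes r: "0 < r" "r < 1" and u: "C1_on (- {0}) u" and eq: "\<And>x. x \<in> annulus r \<Longrightarrow> v x = u x"
    and v: "vanishing_trace r v" and s: "s \<in> {r, 1}"
  shows "integral {0..2 * pi} (\<lambda>\<theta>. (cmod (u (polar s \<theta>)))\<^sup>2) = 0"
proof -
  obtain \<Phi> where smooth: "\<forall>k::nat. smooth (\<Phi> k)"
    and lim: "(\<lambda>k. H1_norm (annulus r) (\<lambda>x. \<Phi> k x - v x)) \<longlonglongrightarrow> 0"
    and bd: "\<forall>s\<in>{r, 1}. (\<lambda>k. \<integral>x. (cmod (\<Phi> k x))\<^sup>2 \<partial>arc_measure s) \<longlonglongrightarrow> 0"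
    using v unfolding vanishing_trace_def by (elim exE conjE)
  have lim_bd: "(\<lambda>k. \<integral>x. (cmod (\<Phi> k x))\<^sup>2 \<partial>arc_measure s) \<longlonglongrightarrow> 0"
    using bd s by (rule bspec)
  have "s > 0" using r s by auto
  define C where "C = (1 + 1 / (1 - r)) / r"
  let ?I = "\<lambda>f. integral {0..2 * pi} (\<lambda>\<theta>. (cmod (f (polar s \<theta>)))\<^sup>2)"
  have C1\<Phi>: "C1_on S (\<Phi> k)" for k S using smooth by (simp add: smooth_imp_C1_on)
  have C1: "C1_on (- {0}) (\<lambda>x. \<Phi> k x - u x)" for k using C1\<Phi> u by (rule C1_on_diff)
  have norm: "(H1_norm (annulus r) (\<lambda>x. \<Phi> k x - v x))\<^sup>2 =
      (\<integral>x. (cmod (\<Phi> k x - u x))\<^sup>2 + (norm (classical_grad (\<lambda>x. \<Phi> k x - u x) x))\<^sup>2 \<partial>lebesgue_on (annulus r))" for k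
    by (rule H1_norm_power2_eq[OF r(1) C1]) (simp add: eq)
  \<comment> \<open>The factors 2 come from splitting \<open>u\<close> into \<open>\<Phi> k\<close>
    and \<open>\<Phi> k - u\<close> inside a square, and \<open>1 / s\<close> converts arc length
    back to the angle.\<close>
  have le: "?I u \<le> 2 / s * (\<integral>x. (cmod (\<Phi> k x))\<^sup>2 \<partial>arc_measure s) + 2 * C * (H1_norm (annulus r) (\<lambda>x. \<Phi> k x - v x))\<^sup>2" for k
  proof -
    have int: "(\<lambda>\<theta>. (cmod (f (polar s \<theta>)))\<^sup>2) integrable_on {0..2 * pi}" if "C1_on (- {0}) f" for f :: "real^2 \<Rightarrow> complex"
      using r s by (intro integrable_continuous_real continuous_intros
          continuous_on_compose2[OF C1_on_imp_continuous_on[OF that]]) (auto simp: polar_ne_0)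
    have "?I u \<le> integral {0..2 * pi} (\<lambda>\<theta>. 2 * (cmod (\<Phi> k (polar s \<theta>)))\<^sup>2 + 2 * (cmod (\<Phi> k (polar s \<theta>) - u (polar s \<theta>)))\<^sup>2)"
    proof (rule integral_le)
      show "(\<lambda>\<theta>. 2 * (cmod (\<Phi> k (polar s \<theta>)))\<^sup>2 + 2 * (cmod (\<Phi> k (polar s \<theta>) - u (polar s \<theta>)))\<^sup>2) integrable_on {0..2 * pi}"
        by (intro integrable_add integrable_on_mult_right int C1 C1\<Phi>)
      fix \<theta>
      have "(cmod b)\<^sup>2 \<le> 2 * (cmod a)\<^sup>2 + 2 * (cmod (a - b))\<^sup>2" for a b
      proof -
        have "cmod b \<le> cmod a + cmod (a - b)" by (metis add.commute norm_minus_commute norm_triangle_sub)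
        then have "(cmod b)\<^sup>2 \<le> (cmod a + cmod (a - b))\<^sup>2" by (intro power_mono) auto
        also have "\<dots> \<le> 2 * (cmod a)\<^sup>2 + 2 * (cmod (a - b))\<^sup>2"
          using zero_le_power2[of "cmod a - cmod (a - b)"] by (simp add: power2_sum power2_diff)
        finally show ?thesis .
      qed
      then show "(cmod (u (polar s \<theta>)))\<^sup>2 \<le> 2 * (cmod (\<Phi> k (polar s \<theta>)))\<^sup>2 + 2 * (cmod (\<Phi> k (polar s \<theta>) - u (polar s \<theta>)))\<^sup>2" .
    qed (rule int[OF u])
    also have "\<dots> = 2 * ?I (\<Phi> k) + 2 * ?I (\<lambda>x. \<Phi> k x - u x)"
      using int[OF C1\<Phi>] int[OF C1] by (simp add: integral_add integrable_on_mult_right)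
    also have "?I (\<Phi> k) = (\<integral>x. (cmod (\<Phi> k x))\<^sup>2 \<partial>arc_measure s) / s"
      using \<open>s > 0\<close> by (subst integral_arc_measure[OF \<open>s > 0\<close> continuous_on_power[OF continuous_on_norm[OF C1_on_imp_continuous_on[OF C1\<Phi>]]]]) simp
    also have "?I (\<lambda>x. \<Phi> k x - u x) \<le> C * (H1_norm (annulus r) (\<lambda>x. \<Phi> k x - v x))\<^sup>2"
      unfolding C_def norm by (rule trace_inequality[OF r C1 s])
    finally show ?thesis by simp
  qed
  have "(\<lambda>k. 2 / s * (\<integral>x. (cmod (\<Phi> k x))\<^sup>2 \<partial>arc_measure s) + 2 * C * (H1_norm (annulus r) (\<lambda>x. \<Phi> k x - v x))\<^sup>2)
      \<longlonglongrightarrow> 2 / s * 0 + 2 * C * 0\<^sup>2"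
    by (intro tendsto_intros lim lim_bd)
  then have "?I u \<le> 2 / s * 0 + 2 * C * 0\<^sup>2"
    by (rule LIMSEQ_le_const) (use le in auto)
  then have "?I u \<le> 0" by simp
  moreover have "0 \<le> ?I u" by (rule Henstock_Kurzweil_Integration.integral_nonneg)
    (use r s in \<open>auto intro!: integrable_continuous_real continuous_intros
          continuous_on_compose2[OF C1_on_imp_continuous_on[OF u]] simp: polar_ne_0\<close>)
  ultimately show ?thesis by simp
qed

section \<open>Bessel functions on rays\<close>

definition entire_coeffs :: "(nat \<Rightarrow> 'a::{real_normed_field,banach}) \<Rightarrow> bool" where
  "entire_coeffs a \<longleftrightarrow> (\<forall>x. summable (\<lambda>k. a k * x ^ k))"

lemma entire_coeffs_add: "entire_coeffs a \<Longrightarrow> entire_coeffs b \<Longrightarrow> entire_coeffs (\<lambda>k. a k + b k)"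
  by (auto simp: entire_coeffs_def distrib_right intro: summable_add)

lemma entire_coeffs_cmult: "entire_coeffs a \<Longrightarrow> entire_coeffs (\<lambda>k. c * a k)"
  by (auto simp: entire_coeffs_def mult.assoc intro: summable_mult)

text \<open>Multiplying the k-th coefficient by k is the Euler operator \<open>x d/dx\<close>, and
  \<open>diffs\<close> is the coefficient sequence of the derivative. Convergence of the new series
  is obtained along the way.\<close>

lemma entire_coeffs_sums_of_nat:
  assumes "entire_coeffs a"
  shows "(\<lambda>k. of_nat k * a k * x ^ k) sums (x * (\<Sum>k. diffs a k * x ^ k))"
proof -
  have "summable (\<lambda>k. diffs a k * x ^ k)"
    using assms by (auto simp: entire_coeffs_def intro: termdiff_converges_all)
  from sums_mult[OF diffs_equiv[OF this], of x]
  have "(\<lambda>k. x * (of_nat k * a k * x ^ (k - Suc 0))) sums (x * (\<Sum>k. diffs a k * x ^ k))" .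
  moreover have "x * (of_nat k * a k * x ^ (k - Suc 0)) = of_nat k * a k * x ^ k" for k
    by (cases k) auto
  ultimately show ?thesis by simp
qed

lemma entire_coeffs_of_nat_mult: "entire_coeffs a \<Longrightarrow> entire_coeffs (\<lambda>k. of_nat k * a k)"
  unfolding entire_coeffs_def[of "\<lambda>k. of_nat k * a k"]
  by (auto intro: sums_summable[OF entire_coeffs_sums_of_nat])

lemma entire_coeffs_index_mult:
  assumes "entire_coeffs a"
  shows "entire_coeffs (\<lambda>k. of_nat (2 * k + m) * a k)"
proof -
  have "(\<lambda>k. of_nat (2 * k + m) * a k) = (\<lambda>k. 2 * (of_nat k * a k) + of_nat m * a k)"
    by (simp add: algebra_simps)
  then show ?thesis
    using entire_coeffs_add[OF entire_coeffs_cmult[OF entire_coeffs_of_nat_mult[OF assms]] entire_coeffs_cmult[OF assms]]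
    by simp
qed

lemma entire_coeffs_Suc:
  assumes "entire_coeffs a"
  shows "entire_coeffs (\<lambda>k. a (Suc k))"
  unfolding entire_coeffs_def
proof
  fix x
  show "summable (\<lambda>k. a (Suc k) * x ^ k)"
    using assms summable_powser_split_head[of a x] by (simp add: entire_coeffs_def)
qed

lemma entire_coeffs_comparison:
  fixes a :: "nat \<Rightarrow> 'a::{real_normed_field,banach}"
  assumes "entire_coeffs b" "\<And>k. norm (a k) \<le> b k"
  shows "entire_coeffs a"
  unfolding entire_coeffs_def
proof
  fix x :: 'a
  show "summable (\<lambda>k. a k * x ^ k)"
  proof (rule summable_comparison_test)
    show "summable (\<lambda>k. b k * norm x ^ k)" using assms(1) by (simp add: entire_coeffs_def)
    show "\<exists>N. \<forall>n\<ge>N. norm (a n * x ^ n) \<le> b n * norm x ^ n"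
      by (intro exI[of _ 0] allI impI) (simp add: norm_mult norm_power assms(2) mult_right_mono)
  qed
qed

lemma entire_coeffs_inverse_fact: "entire_coeffs (\<lambda>k. 1 / fact k :: real)"
proof -
  have "summable (\<lambda>k. 1 / fact k * x ^ k)" for x :: real
    using summable_exp[of x] by (simp add: divide_inverse)
  then show ?thesis by (simp add: entire_coeffs_def)
qed

text \<open>A Frobenius series at the regular singular point 0 with exponent \<open>m\<close> in
  even steps, as it occurs in both kinds of Bessel functions.\<close>

definition frobenius :: "nat \<Rightarrow> (nat \<Rightarrow> complex) \<Rightarrow> complex \<Rightarrow> complex" where
  "frobenius m a t = (\<Sum>k. a k * t ^ (2 * k + m))"

lemma frobenius_term: "x * t ^ (2 * k + m) = t ^ m * (x * (t\<^sup>2) ^ k)" for x t :: complex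
  unfolding power_add power_mult by (simp only: mult_ac)

lemma frobenius_eq: "frobenius m a t = t ^ m * (\<Sum>k. a k * (t\<^sup>2) ^ k)" if "entire_coeffs a"
proof -
  have "summable (\<lambda>k. a k * (t\<^sup>2) ^ k)" using that by (simp add: entire_coeffs_def)
  from suminf_mult[OF this, of "t ^ m"] show ?thesis
    by (simp only: frobenius_def frobenius_term)
qed

lemma summable_frobenius:
  fixes t :: complex
  assumes "entire_coeffs a"
  shows "summable (\<lambda>k. a k * t ^ (2 * k + m))"
proof -
  have "summable (\<lambda>k. t ^ m * (a k * (t\<^sup>2) ^ k))"
    using assms by (intro summable_mult) (simp add: entire_coeffs_def)
  then show ?thesis by (simp only: frobenius_term)
qed

lemma frobenius_cmult: "entire_coeffs a \<Longrightarrow> frobenius m (\<lambda>k. c * a k) t = c * frobenius m a t"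
  unfolding frobenius_def using suminf_mult[OF summable_frobenius] by (simp add: mult.assoc)

lemma frobenius_add:
  "entire_coeffs a \<Longrightarrow> entire_coeffs b \<Longrightarrow> frobenius m (\<lambda>k. a k + b k) t = frobenius m a t + frobenius m b t"
  unfolding frobenius_def using suminf_add[OF summable_frobenius[of a t m] summable_frobenius[of b t m]]
  by (simp add: distrib_right)

lemma frobenius_shift:
  assumes "entire_coeffs a"
  shows "frobenius m a t = a 0 * t ^ m + t\<^sup>2 * frobenius m (\<lambda>k. a (Suc k)) t"
proof -
  have "(\<Sum>k. a (Suc k) * t ^ (2 * Suc k + m)) = frobenius m a t - a 0 * t ^ m"
    using suminf_split_head[OF summable_frobenius[OF assms, of t m]] by (simp add: frobenius_def)
  moreover have "(\<Sum>k. a (Suc k) * t ^ (2 * Suc k + m)) = t\<^sup>2 * frobenius m (\<lambda>k. a (Suc k)) t"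
    unfolding frobenius_def suminf_mult[OF summable_frobenius[OF entire_coeffs_Suc[OF assms]], symmetric]
    by (simp add: power_add power2_eq_square mult_ac)
  ultimately show ?thesis by (simp add: algebra_simps)
qed

text \<open>Each power \<open>t ^ (2 * k + m)\<close> is an eigenfunction of \<open>t d/dt\<close>
  with eigenvalue \<open>2 * k + m\<close>. Working with \<open>t d/dt\<close> keeps the shape of
  the series, so the derivative is this operator divided by \<open>t\<close>.\<close>

lemma frobenius_has_field_derivative:
  assumes a: "entire_coeffs a" and t: "t \<noteq> 0"
  shows "(frobenius m a has_field_derivative frobenius m (\<lambda>k. of_nat (2 * k + m) * a k) t / t) (at t)"
proof -
  define P where "P x = (\<Sum>k. a k * x ^ k)" for x
  define P' where "P' x = (\<Sum>k. diffs a k * x ^ k)" for x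
  have "(P has_field_derivative P' (t\<^sup>2)) (at (t\<^sup>2))"
    unfolding P_def[abs_def] P'_def using a
    by (intro termdiffs_strong_converges_everywhere) (simp add: entire_coeffs_def)
  then have "((\<lambda>t. P (t\<^sup>2)) has_field_derivative P' (t\<^sup>2) * (2 * t)) (at t)"
    by (rule DERIV_chain2) (auto intro!: derivative_eq_intros)
  then have "((\<lambda>t. t ^ m * P (t\<^sup>2)) has_field_derivative
      of_nat m * t ^ (m - Suc 0) * P (t\<^sup>2) + P' (t\<^sup>2) * (2 * t) * t ^ m) (at t)"
    by (intro DERIV_mult) (auto intro!: derivative_eq_intros)
  moreover have "of_nat m * t ^ (m - Suc 0) * P (t\<^sup>2) + P' (t\<^sup>2) * (2 * t) * t ^ m
      = frobenius m (\<lambda>k. of_nat (2 * k + m) * a k) t / t"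
  proof -
    have "(\<lambda>k. of_nat (2 * k + m) * a k) = (\<lambda>k. 2 * (of_nat k * a k) + of_nat m * a k)"
      by (simp add: algebra_simps)
    then have "frobenius m (\<lambda>k. of_nat (2 * k + m) * a k) t
        = 2 * frobenius m (\<lambda>k. of_nat k * a k) t + of_nat m * frobenius m a t"
      using a by (simp add: frobenius_add frobenius_cmult entire_coeffs_cmult entire_coeffs_of_nat_mult)
    moreover have "frobenius m (\<lambda>k. of_nat k * a k) t = t ^ m * (t\<^sup>2 * P' (t\<^sup>2))"
      using sums_unique[OF entire_coeffs_sums_of_nat[OF a, of "t\<^sup>2"]]
      by (simp add: frobenius_eq[OF entire_coeffs_of_nat_mult[OF a]] P'_def)
    moreover have "frobenius m a t = t ^ m * P (t\<^sup>2)" by (simp add: frobenius_eq[OF a] P_def)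
    \<comment> \<open>For \<open>m = 0\<close> the exponent \<open>m - Suc 0\<close> is truncated,
      but then the factor \<open>of_nat m\<close> annihilates both sides.\<close>
    moreover have "of_nat m * t ^ m = t * (of_nat m * t ^ (m - Suc 0))" by (cases m) auto
    moreover have "2 * (T * (t\<^sup>2 * Q)) + M * (T * R) = t * (A * R + Q * (2 * t) * T)"
      if "M * T = t * A" for T Q M R A :: complex
      using that by algebra
    ultimately have "frobenius m (\<lambda>k. of_nat (2 * k + m) * a k) t
        = t * (of_nat m * t ^ (m - Suc 0) * P (t\<^sup>2) + P' (t\<^sup>2) * (2 * t) * t ^ m)"
      by metis
    then show ?thesis using t by simp
  qed
  moreover have "frobenius m a = (\<lambda>t. t ^ m * P (t\<^sup>2))"
    by (simp add: fun_eq_iff frobenius_eq[OF a] P_def)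
  ultimately show ?thesis by simp
qed

lemma frobenius_has_vector_derivative:
  assumes "entire_coeffs a" "\<tau> \<noteq> 0" "\<rho> > 0"
  shows "((\<lambda>\<rho>. frobenius m a (\<tau> * of_real \<rho>)) has_vector_derivative
     frobenius m (\<lambda>k. of_nat (2 * k + m) * a k) (\<tau> * of_real \<rho>) / of_real \<rho>) (at \<rho>)"
proof -
  have "((\<lambda>\<rho>. \<tau> * of_real \<rho>) has_vector_derivative \<tau>) (at \<rho>)"
    by (auto intro!: derivative_eq_intros)
  from field_vector_diff_chain_at[OF this frobenius_has_field_derivative[OF assms(1)]] assms
  show ?thesis by (simp add: o_def)
qed

text \<open>Bessel's equation of order \<open>m\<close> for \<open>\<rho> \<mapsto> y \<rho>\<close> as a first-order system in \<open>y\<close> and \<open>z = \<rho> y'\<close>,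
  where \<open>q\<close> stands for \<open>\<kappa>\<^sup>2\<close>.\<close>

definition bessel_system :: "nat \<Rightarrow> complex \<Rightarrow> (real \<Rightarrow> complex) \<Rightarrow> (real \<Rightarrow> complex) \<Rightarrow> bool" where
  "bessel_system m q y z \<longleftrightarrow> (\<forall>\<rho>>0.
     (y has_vector_derivative z \<rho> / of_real \<rho>) (at \<rho>) \<and>
     (z has_vector_derivative ((of_nat m)\<^sup>2 - q * (of_real \<rho>)\<^sup>2) * y \<rho> / of_real \<rho>) (at \<rho>))"

lemma bessel_system_lincomb:
  assumes "bessel_system m q y z" "bessel_system m q y' z'"
  shows "bessel_system m q (\<lambda>\<rho>. a * y \<rho> + b * y' \<rho>) (\<lambda>\<rho>. a * z \<rho> + b * z' \<rho>)"
  unfolding bessel_system_def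
proof (intro allI impI conjI)
  fix \<rho> :: real assume "\<rho> > 0"
  then have d: "(y has_vector_derivative z \<rho> / of_real \<rho>) (at \<rho>)"
    "(z has_vector_derivative ((of_nat m)\<^sup>2 - q * (of_real \<rho>)\<^sup>2) * y \<rho> / of_real \<rho>) (at \<rho>)"
    "(y' has_vector_derivative z' \<rho> / of_real \<rho>) (at \<rho>)"
    "(z' has_vector_derivative ((of_nat m)\<^sup>2 - q * (of_real \<rho>)\<^sup>2) * y' \<rho> / of_real \<rho>) (at \<rho>)"
    using assms by (auto simp: bessel_system_def)
  have lin: "c * (a * Y + b * Y') / R = a * (c * Y / R) + b * (c * Y' / R)" for c Y Y' R :: complex
    by (simp add: add_divide_distrib distrib_left mult_ac)
  show "((\<lambda>\<rho>. a * y \<rho> + b * y' \<rho>) has_vector_derivative (a * z \<rho> + b * z' \<rho>) / of_real \<rho>) (at \<rho>)"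
    using has_vector_derivative_add[OF has_vector_derivative_mult_right[OF d(1)] has_vector_derivative_mult_right[OF d(3)]]
    by (simp add: add_divide_distrib)
  show "((\<lambda>\<rho>. a * z \<rho> + b * z' \<rho>) has_vector_derivative
      ((of_nat m)\<^sup>2 - q * (of_real \<rho>)\<^sup>2) * (a * y \<rho> + b * y' \<rho>) / of_real \<rho>) (at \<rho>)"
    unfolding lin
    by (rule has_vector_derivative_add[OF has_vector_derivative_mult_right[OF d(2)] has_vector_derivative_mult_right[OF d(4)]])
qed

section \<open>The Bessel function of the first kind\<close>

definition J_coeff :: "nat \<Rightarrow> nat \<Rightarrow> complex" where
  "J_coeff m k = (-1) ^ k / (fact k * fact (m + k))"

text \<open>Bessel's equation at the level of coefficients.\<close>

lemma J_coeff_Suc: "of_nat (Suc k) * of_nat (m + Suc k) * J_coeff m (Suc k) = - J_coeff m k"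
  by (simp add: J_coeff_def divide_simps del: of_nat_Suc of_nat_add)

lemma norm_J_coeff_le: "norm (J_coeff m k) \<le> 1 / fact k"
proof -
  have "norm (J_coeff m k) = 1 / (fact k * fact (m + k))"
    by (simp add: J_coeff_def norm_divide norm_mult norm_power)
  also have "\<dots> \<le> 1 / (fact k * 1)"
    by (intro divide_left_mono mult_left_mono) (auto simp: fact_ge_1)
  finally show ?thesis by simp
qed

lemma entire_coeffs_J: "entire_coeffs (J_coeff m)"
  by (rule entire_coeffs_comparison[OF entire_coeffs_inverse_fact norm_J_coeff_le])

lemma bessel_J_eq_frobenius: "bessel_J m z = frobenius m (J_coeff m) (z / 2)"
  by (simp add: bessel_J_def frobenius_def J_coeff_def)

text \<open>The square of the Euler operator multiplies coefficients by
  \<open>(2 * k + m)^2\<close>, which exceeds \<open>m^2\<close> by \<open>4 * k * (k + m)\<close>.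
  By the recurrence this excess, moved by one index, is \<open>-4\<close> times the original
  coefficient, and the move costs a factor \<open>t^2\<close>.\<close>

lemma bessel_J_system_aux:
  fixes t :: complex
  shows "frobenius m (\<lambda>k. of_nat (2 * k + m) * (of_nat (2 * k + m) * J_coeff m k)) t
       = ((of_nat m)\<^sup>2 - 4 * t\<^sup>2) * frobenius m (J_coeff m) t"
proof -
  define b where "b k = 4 * (of_nat k * (of_nat (m + k) * J_coeff m k))" for k
  have b_eq: "b = (\<lambda>k. 4 * (of_nat k * (of_nat k * J_coeff m k) + of_nat m * (of_nat k * J_coeff m k)))"
    by (simp add: b_def fun_eq_iff algebra_simps)
  have b: "entire_coeffs b"
    unfolding b_eq by (intro entire_coeffs_cmult entire_coeffs_add entire_coeffs_of_nat_mult entire_coeffs_J)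
  have "(\<lambda>k. of_nat (2 * k + m) * (of_nat (2 * k + m) * J_coeff m k)) = (\<lambda>k. (of_nat m)\<^sup>2 * J_coeff m k + b k)"
    by (simp add: b_def fun_eq_iff algebra_simps power2_eq_square)
  then have "frobenius m (\<lambda>k. of_nat (2 * k + m) * (of_nat (2 * k + m) * J_coeff m k)) t
      = (of_nat m)\<^sup>2 * frobenius m (J_coeff m) t + frobenius m b t"
    using b entire_coeffs_J by (simp add: frobenius_add frobenius_cmult entire_coeffs_cmult)
  \<comment> \<open>The term of index 0 drops out because \<open>b 0 = 0\<close>.\<close>
  also have "frobenius m b t = t\<^sup>2 * frobenius m (\<lambda>k. b (Suc k)) t"
    using frobenius_shift[OF b, of m t] by (simp add: b_def)
  also have "(\<lambda>k. b (Suc k)) = (\<lambda>k. -4 * J_coeff m k)"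
    using J_coeff_Suc[of _ m] by (simp add: b_def fun_eq_iff mult.assoc del: of_nat_Suc)
  also have "frobenius m (\<lambda>k. -4 * J_coeff m k) t = -4 * frobenius m (J_coeff m) t"
    by (rule frobenius_cmult[OF entire_coeffs_J])
  finally show ?thesis by (simp add: algebra_simps)
qed

lemma bessel_J_system:
  assumes "\<kappa> \<noteq> 0"
  shows "bessel_system m (\<kappa>\<^sup>2) (\<lambda>\<rho>. bessel_J m (\<kappa> * of_real \<rho>))
           (\<lambda>\<rho>. frobenius m (\<lambda>k. of_nat (2 * k + m) * J_coeff m k) (\<kappa> / 2 * of_real \<rho>))"
  unfolding bessel_system_def
proof (intro allI impI conjI)
  fix \<rho> :: real assume \<rho>: "\<rho> > 0"
  show "((\<lambda>\<rho>. bessel_J m (\<kappa> * of_real \<rho>)) has_vector_derivative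
      frobenius m (\<lambda>k. of_nat (2 * k + m) * J_coeff m k) (\<kappa> / 2 * of_real \<rho>) / of_real \<rho>) (at \<rho>)"
    using frobenius_has_vector_derivative[OF entire_coeffs_J, of "\<kappa> / 2" \<rho> m] assms \<rho>
    by (simp add: bessel_J_eq_frobenius)
  show "((\<lambda>\<rho>. frobenius m (\<lambda>k. of_nat (2 * k + m) * J_coeff m k) (\<kappa> / 2 * of_real \<rho>)) has_vector_derivative
      ((of_nat m)\<^sup>2 - \<kappa>\<^sup>2 * (of_real \<rho>)\<^sup>2) * bessel_J m (\<kappa> * of_real \<rho>) / of_real \<rho>) (at \<rho>)"
    using frobenius_has_vector_derivative[OF entire_coeffs_index_mult[OF entire_coeffs_J[of m], of m], of "\<kappa> / 2" \<rho> m] assms \<rho>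
    unfolding bessel_J_system_aux by (simp add: bessel_J_eq_frobenius power_divide power_mult_distrib)
qed

section \<open>The Bessel function of the second kind\<close>

definition Y_coeff :: "nat \<Rightarrow> nat \<Rightarrow> complex" where
  "Y_coeff m k = (Digamma (of_nat (k + 1)) + Digamma (of_nat (m + k + 1))) * J_coeff m k"

text \<open>Each step of the recurrence adds at most 1. This crude linear growth is harmless against
  the factorial decay of \<open>J_coeff\<close>.\<close>

lemma norm_Digamma_of_nat_le: "norm (Digamma (of_nat (n + 1) :: complex)) \<le> norm (Digamma (1 :: complex)) + real n"
proof (induction n)
  case (Suc n)
  have "Digamma (of_nat (Suc n + 1) :: complex) = Digamma (of_nat (n + 1)) + 1 / of_nat (n + 1)"
  proof -
    have ne: "of_nat (n + 1) \<noteq> (0 :: complex)" unfolding of_nat_eq_0_iff by simp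
    have eq: "of_nat (Suc n + 1) = of_nat (n + 1) + (1 :: complex)" by simp
    show ?thesis unfolding eq by (rule Digamma_plus1[OF ne])
  qed
  also have "norm \<dots> \<le> norm (Digamma (of_nat (n + 1) :: complex)) + norm (1 / of_nat (n + 1) :: complex)"
    by (rule norm_triangle_ineq)
  also have "norm (1 / of_nat (n + 1) :: complex) \<le> 1"
    by (simp only: norm_divide norm_of_nat norm_one) simp
  finally show ?case using Suc by simp
qed simp

lemma entire_coeffs_Y: "entire_coeffs (Y_coeff m)"
proof (rule entire_coeffs_comparison)
  define A where "A = 2 * norm (Digamma (1 :: complex))"
  have "entire_coeffs (\<lambda>k. A * (1 / fact k) + of_nat (2 * k + m) * (1 / fact k) :: real)"
    by (intro entire_coeffs_add entire_coeffs_cmult entire_coeffs_index_mult entire_coeffs_inverse_fact)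
  then show "entire_coeffs (\<lambda>k. (A + real (2 * k + m)) * (1 / fact k))"
    by (simp add: add_divide_distrib)
  fix k
  have "norm (Digamma (of_nat (k + 1) :: complex) + Digamma (of_nat (m + k + 1))) \<le> A + real (2 * k + m)"
    using norm_triangle_ineq[of "Digamma (of_nat (k + 1) :: complex)" "Digamma (of_nat (m + k + 1))"]
      norm_Digamma_of_nat_le[of k] norm_Digamma_of_nat_le[of "m + k"]
    by (simp add: A_def)
  then show "norm (Y_coeff m k) \<le> (A + real (2 * k + m)) * (1 / fact k)"
    unfolding Y_coeff_def norm_mult using norm_J_coeff_le[of m k]
    by (intro mult_mono) (auto simp: A_def)
qed

definition Y_polar :: "nat \<Rightarrow> complex \<Rightarrow> complex" where
  "Y_polar m t = (\<Sum>k<m. fact (m - k - 1) / fact k * (t ^ (2 * k) / t ^ m))"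

lemma bessel_Y_eq_frobenius:
  "bessel_Y m z = of_real (2 / pi) * Ln (z / 2) * bessel_J m z
     - of_real (1 / pi) * Y_polar m (z / 2) - of_real (1 / pi) * frobenius m (Y_coeff m) (z / 2)"
  by (simp add: bessel_Y_def frobenius_def J_coeff_def Y_coeff_def Y_polar_def)

text \<open>Compared with the first kind, the Digamma factors grow by
  \<open>1 / (k + 1) + 1 / (m + k + 1)\<close> per step and thereby spoil the recurrence. The defect
  is four times the series of \<open>t d/dt J\<close> without its first term; in
  \<open>bessel_Y\<close> the series is cancelled by the logarithm and the missing term by the
  finite sum.\<close>

lemma Y_coeff_identity:
  fixes t :: complex
  shows "frobenius m (\<lambda>k. of_nat (2 * k + m) * (of_nat (2 * k + m) * Y_coeff m k)) t
       = ((of_nat m)\<^sup>2 - 4 * t\<^sup>2) * frobenius m (Y_coeff m) t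
         + 4 * (frobenius m (\<lambda>k. of_nat (2 * k + m) * J_coeff m k) t - of_nat m * J_coeff m 0 * t ^ m)"
proof -
  define b where "b k = 4 * (of_nat k * (of_nat (m + k) * Y_coeff m k))" for k
  have b_eq: "b = (\<lambda>k. 4 * (of_nat k * (of_nat k * Y_coeff m k) + of_nat m * (of_nat k * Y_coeff m k)))"
    by (simp add: b_def fun_eq_iff algebra_simps)
  have b: "entire_coeffs b"
    unfolding b_eq by (intro entire_coeffs_cmult entire_coeffs_add entire_coeffs_of_nat_mult entire_coeffs_Y)
  define c where "c k = of_nat (2 * k + m) * J_coeff m k" for k
  have c: "entire_coeffs c"
    unfolding c_def[abs_def] by (rule entire_coeffs_index_mult[OF entire_coeffs_J])
  have "(\<lambda>k. of_nat (2 * k + m) * (of_nat (2 * k + m) * Y_coeff m k)) = (\<lambda>k. (of_nat m)\<^sup>2 * Y_coeff m k + b k)"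
    by (simp add: b_def fun_eq_iff algebra_simps power2_eq_square)
  then have "frobenius m (\<lambda>k. of_nat (2 * k + m) * (of_nat (2 * k + m) * Y_coeff m k)) t
      = (of_nat m)\<^sup>2 * frobenius m (Y_coeff m) t + frobenius m b t"
    using b entire_coeffs_Y by (simp add: frobenius_add frobenius_cmult entire_coeffs_cmult)
  also have "frobenius m b t = t\<^sup>2 * frobenius m (\<lambda>k. b (Suc k)) t"
    using frobenius_shift[OF b, of m t] by (simp add: b_def)
  also have "(\<lambda>k. b (Suc k)) = (\<lambda>k. 4 * c (Suc k) + -4 * Y_coeff m k)"
  proof
    fix k
    define d where "d k = Digamma (of_nat (k + 1)) + Digamma (of_nat (m + k + 1) :: complex)" for k
    have nz: "of_nat (Suc k) \<noteq> (0::complex)" "of_nat (m + Suc k) \<noteq> (0::complex)"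
      by (simp_all only: of_nat_eq_0_iff)
    have shift: "of_nat (Suc k + 1) = of_nat (Suc k) + (1::complex)"
      "of_nat (m + Suc k + 1) = of_nat (m + Suc k) + (1::complex)" "m + k + 1 = m + Suc k" "k + 1 = Suc k"
      by simp_all
    have "d (Suc k) = d k + 1 / of_nat (Suc k) + 1 / of_nat (m + Suc k)"
      unfolding d_def shift Digamma_plus1[OF nz(1)] Digamma_plus1[OF nz(2)] by (simp only: add_ac)
    moreover have "(x + 1 / of_nat (Suc k) + 1 / of_nat (m + Suc k)) * (of_nat (Suc k) * of_nat (m + Suc k))
        = x * (of_nat (Suc k) * of_nat (m + Suc k)) + of_nat (2 * Suc k + m)" for x :: complex
    proof -
      have "(x + 1 / a + 1 / b) * (a * b) = x * (a * b) + (b + a)" if "a \<noteq> 0" "b \<noteq> 0" for a b :: complex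
        using that by (simp add: field_simps)
      from this[OF nz] show ?thesis by simp
    qed
    ultimately have d: "d (Suc k) * (of_nat (Suc k) * of_nat (m + Suc k))
        = d k * (of_nat (Suc k) * of_nat (m + Suc k)) + of_nat (2 * Suc k + m)" by simp
    have "b (Suc k) = 4 * (d (Suc k) * (of_nat (Suc k) * of_nat (m + Suc k))) * J_coeff m (Suc k)"
      by (simp add: b_def Y_coeff_def d_def mult_ac del: of_nat_Suc)
    also have "\<dots> = 4 * d k * (of_nat (Suc k) * of_nat (m + Suc k) * J_coeff m (Suc k)) + 4 * c (Suc k)"
      unfolding d c_def by (simp only: distrib_left distrib_right mult_ac)
    also have "\<dots> = 4 * c (Suc k) + -4 * Y_coeff m k"
      unfolding J_coeff_Suc by (simp add: Y_coeff_def d_def)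
    finally show "b (Suc k) = 4 * c (Suc k) + -4 * Y_coeff m k" .
  qed
  also have "frobenius m (\<lambda>k. 4 * c (Suc k) + -4 * Y_coeff m k) t
      = 4 * frobenius m (\<lambda>k. c (Suc k)) t + -4 * frobenius m (Y_coeff m) t"
    using entire_coeffs_Suc[OF c] entire_coeffs_Y
    by (simp only: frobenius_add entire_coeffs_cmult frobenius_cmult)
  \<comment> \<open>Shifting \<open>c\<close> back by one index recovers all of its terms except the
    first.\<close>
  also have "t\<^sup>2 * (4 * frobenius m (\<lambda>k. c (Suc k)) t + -4 * frobenius m (Y_coeff m) t)
      = 4 * (frobenius m c t - of_nat m * J_coeff m 0 * t ^ m) - 4 * t\<^sup>2 * frobenius m (Y_coeff m) t"
    using frobenius_shift[OF c, of m t] by (simp add: c_def algebra_simps)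
  finally have eq: "frobenius m (\<lambda>k. of_nat (2 * k + m) * (of_nat (2 * k + m) * Y_coeff m k)) t
      = (of_nat m)\<^sup>2 * frobenius m (Y_coeff m) t
        + (4 * (frobenius m c t - of_nat m * J_coeff m 0 * t ^ m) - 4 * t\<^sup>2 * frobenius m (Y_coeff m) t)" .
  have c_eq: "frobenius m (\<lambda>k. of_nat (2 * k + m) * J_coeff m k) t = frobenius m c t"
    by (simp only: c_def[abs_def])
  have "M * Y + (4 * (F - w) - 4 * s * Y) = (M - 4 * s) * Y + 4 * (F - w)" for M Y F w s :: complex
    by (simp add: algebra_simps)
  then show ?thesis unfolding eq c_eq .
qed

text \<open>Here \<open>(2 * k - m)^2 - m^2 = -4 * k * (m - k)\<close>, and this multiple of a term
  matches \<open>t^2\<close> times the term before it. The sum telescopes and leaves only the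
  contribution of the upper end.\<close>

lemma Y_polar_identity:
  fixes t :: complex
  assumes "t \<noteq> 0"
  shows "(\<Sum>k<m. (of_nat (2 * k) - of_nat m)\<^sup>2 * (fact (m - k - 1) / fact k * (t ^ (2 * k) / t ^ m)))
      = ((of_nat m)\<^sup>2 - 4 * t\<^sup>2) * Y_polar m t + 4 * (of_nat m * J_coeff m 0 * t ^ m)"
proof -
  \<comment> \<open>The reciprocal of \<open>fact (k - 1)\<close> has to count as 0 at
    \<open>k = 0\<close>, where truncated subtraction would give 1; hence the case
    distinction.\<close>
  define g where "g k = (if k = 0 then 0 else fact (m - k) / fact (k - 1) * (t ^ (2 * k) / t ^ m))" for k
  have "(\<Sum>k<m. (of_nat (2 * k) - of_nat m)\<^sup>2 * (fact (m - k - 1) / fact k * (t ^ (2 * k) / t ^ m)))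
        - ((of_nat m)\<^sup>2 - 4 * t\<^sup>2) * Y_polar m t
      = (\<Sum>k<m. (of_nat (2 * k) - of_nat m)\<^sup>2 * (fact (m - k - 1) / fact k * (t ^ (2 * k) / t ^ m))
        - ((of_nat m)\<^sup>2 - 4 * t\<^sup>2) * (fact (m - k - 1) / fact k * (t ^ (2 * k) / t ^ m)))"
    by (simp add: Y_polar_def sum_subtractf sum_distrib_left)
  also have "\<dots> = (\<Sum>k<m. 4 * (g (Suc k) - g k))"
  proof (rule sum.cong)
    fix k assume "k \<in> {..<m}"
    then have k: "k < m" by simp
    let ?e = "fact (m - k - 1) / fact k :: complex" and ?p = "t ^ (2 * k) / t ^ m"
    have gS: "g (Suc k) = ?e * (t\<^sup>2 * ?p)"
      by (simp add: g_def power2_eq_square)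
    have g: "g k = of_nat k * of_nat (m - k) * ?e * ?p"
    proof (cases k)
      case (Suc j)
      have f: "fact (m - k) = of_nat (m - k) * (fact (m - k - 1) :: complex)"
        using k by (simp add: fact_reduce)
      have f': "fact k = of_nat k * (fact (k - 1) :: complex)"
        using Suc by (simp add: fact_reduce)
      have "of_nat k \<noteq> (0 :: complex)" using Suc by (simp del: of_nat_Suc)
      then have "fact (m - k) / fact (k - 1) = of_nat k * of_nat (m - k) * ?e"
        unfolding f f' by simp
      then show ?thesis using Suc by (simp add: g_def)
    qed (simp add: g_def)
    have "(of_nat (2 * k) - of_nat m)\<^sup>2 - ((of_nat m)\<^sup>2 - 4 * t\<^sup>2) = 4 * t\<^sup>2 - 4 * of_nat k * (of_nat (m - k) :: complex)"
      using k by (simp add: of_nat_diff power2_eq_square algebra_simps)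
    then show "(of_nat (2 * k) - of_nat m)\<^sup>2 * (?e * ?p) - ((of_nat m)\<^sup>2 - 4 * t\<^sup>2) * (?e * ?p) = 4 * (g (Suc k) - g k)"
      unfolding gS g by algebra
  qed simp
  also have "\<dots> = 4 * (g m - g 0)"
    by (simp only: sum_distrib_left[symmetric] sum_lessThan_telescope)
  also have "\<dots> = 4 * (of_nat m * J_coeff m 0 * t ^ m)"
  proof (cases m)
    case (Suc j)
    have "t ^ (2 * m) / t ^ m = t ^ m"
      using assms by (simp add: mult_2 power_add)
    moreover have "fact m = of_nat m * (fact (m - 1) :: complex)"
      using Suc by (simp add: fact_reduce)
    moreover have "of_nat m \<noteq> (0 :: complex)" using Suc by (simp del: of_nat_Suc)
    ultimately show ?thesis by (simp add: g_def J_coeff_def)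
  qed (simp add: g_def)
  finally show ?thesis by (simp add: algebra_simps)
qed

text \<open>Along a ray the argument is constant, so
  \<open>Ln (\<tau> \<rho>) = ln \<rho> + Ln \<tau>\<close>. The branch cut is therefore no
  obstacle, even if the ray lies on it.\<close>

lemma has_vector_derivative_Ln_ray:
  assumes "\<tau> \<noteq> 0" "\<rho> > 0"
  shows "((\<lambda>\<rho>. Ln (\<tau> * of_real \<rho>)) has_vector_derivative 1 / of_real \<rho>) (at \<rho>)"
proof -
  have "((\<lambda>\<rho>. of_real (ln \<rho>) + Ln \<tau>) has_vector_derivative 1 / of_real \<rho>) (at \<rho>)"
    using assms(2) by (auto intro!: derivative_eq_intros has_vector_derivative_of_real
        simp: has_real_derivative_iff_has_vector_derivative[symmetric] divide_inverse)
  then show ?thesis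
    by (rule has_vector_derivative_transform_within_open[of _ _ _ "{0<..}"])
      (use assms in \<open>auto simp: Ln_times_of_real Ln_of_real mult.commute[of \<tau>]\<close>)
qed

lemma has_vector_derivative_powi_ray:
  fixes \<tau> :: complex
  assumes "\<tau> \<noteq> 0" "\<rho> > 0"
  shows "((\<lambda>\<rho>. (\<tau> * of_real \<rho>) ^ i / (\<tau> * of_real \<rho>) ^ j) has_vector_derivative
      (of_nat i - of_nat j) * ((\<tau> * of_real \<rho>) ^ i / (\<tau> * of_real \<rho>) ^ j) / of_real \<rho>) (at \<rho>)"
proof -
  have t: "\<tau> * of_real \<rho> \<noteq> 0" using assms by simp
  have 1: "((\<lambda>\<rho>. \<tau> * of_real \<rho>) has_vector_derivative \<tau>) (at \<rho>)"
    by (auto intro!: derivative_eq_intros)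
  have p: "of_nat n * t ^ (n - Suc 0) = of_nat n * t ^ n / t" if "t \<noteq> 0" for n and t :: complex
    using that by (cases n) auto
  have "((\<lambda>t. t ^ i / t ^ j) has_field_derivative (of_nat i - of_nat j) * (t ^ i / t ^ j) / t) (at t)" if "t \<noteq> 0" for t :: complex
    using that by (auto intro!: derivative_eq_intros simp: p) (simp add: field_simps)
  from field_vector_diff_chain_at[OF 1 this[OF t]] assms
  show ?thesis by (simp add: o_def)
qed

text \<open>None of the three parts of \<open>bessel_Y\<close> solves Bessel's equation in general,
  but their defects cancel. The companion is left existential because later steps use only the
  system it satisfies.\<close>

lemma bessel_Y_system:
  assumes \<kappa>: "\<kappa> \<noteq> 0"
  shows "\<exists>z. bessel_system m (\<kappa>\<^sup>2) (\<lambda>\<rho>. bessel_Y m (\<kappa> * of_real \<rho>)) z"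
proof -
  define \<tau> where "\<tau> = \<kappa> / 2"
  have \<tau>: "\<tau> \<noteq> 0" using \<kappa> by (simp add: \<tau>_def)
  define J where "J \<rho> = bessel_J m (\<kappa> * of_real \<rho>)" for \<rho>
  define zJ where "zJ \<rho> = frobenius m (\<lambda>k. of_nat (2 * k + m) * J_coeff m k) (\<tau> * of_real \<rho>)" for \<rho>
  define L where "L \<rho> = Ln (\<tau> * of_real \<rho>)" for \<rho>
  define S1 where "S1 \<rho> = Y_polar m (\<tau> * of_real \<rho>)" for \<rho>
  define e where "e k = (fact (m - k - 1) / fact k :: complex)" for k
  define pw where "pw k \<rho> = (\<tau> * of_real \<rho>) ^ (2 * k) / (\<tau> * of_real \<rho>) ^ m" for k \<rho>
  define z1 where "z1 \<rho> = (\<Sum>k<m. (of_nat (2 * k) - of_nat m) * (e k * pw k \<rho>))" for \<rho>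
  define S2 where "S2 \<rho> = frobenius m (Y_coeff m) (\<tau> * of_real \<rho>)" for \<rho>
  define z2 where "z2 \<rho> = frobenius m (\<lambda>k. of_nat (2 * k + m) * Y_coeff m k) (\<tau> * of_real \<rho>)" for \<rho>
  \<comment> \<open>This is \<open>\<rho>\<close> times the derivative of \<open>bessel_Y\<close>
    along the ray; the summand \<open>J\<close> stems from \<open>\<rho>\<close> times the
    derivative of the logarithm being 1.\<close>
  define z where "z \<rho> = of_real (2 / pi) * (J \<rho> + L \<rho> * zJ \<rho>) - of_real (1 / pi) * z1 \<rho> - of_real (1 / pi) * z2 \<rho>" for \<rho>
  have Y: "bessel_Y m (\<kappa> * of_real \<rho>) = of_real (2 / pi) * (L \<rho> * J \<rho>) - of_real (1 / pi) * S1 \<rho> - of_real (1 / pi) * S2 \<rho>" for \<rho>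
    by (simp add: bessel_Y_eq_frobenius L_def J_def S1_def S2_def \<tau>_def)
  have "bessel_system m (\<kappa>\<^sup>2) (\<lambda>\<rho>. bessel_Y m (\<kappa> * of_real \<rho>)) z"
    unfolding bessel_system_def
  proof (intro allI impI)
    fix \<rho> :: real assume \<rho>: "\<rho> > 0"
    let ?R = "of_real \<rho> :: complex"
    let ?q = "(of_nat m)\<^sup>2 - \<kappa>\<^sup>2 * ?R\<^sup>2"
    have \<rho>0: "?R \<noteq> 0" using \<rho> by simp
    have q: "?q = (of_nat m)\<^sup>2 - 4 * (\<tau> * ?R)\<^sup>2"
      by (simp add: \<tau>_def power_mult_distrib power_divide)
    have dJ: "(J has_vector_derivative zJ \<rho> / ?R) (at \<rho>)"
      and dzJ: "(zJ has_vector_derivative ?q * J \<rho> / ?R) (at \<rho>)"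
      using bessel_J_system[OF \<kappa>, of m] \<rho> unfolding bessel_system_def J_def[abs_def] zJ_def[abs_def] \<tau>_def by auto
    have dL: "(L has_vector_derivative 1 / ?R) (at \<rho>)"
      unfolding L_def[abs_def] by (rule has_vector_derivative_Ln_ray[OF \<tau> \<rho>])
    have dpw: "(pw k has_vector_derivative (of_nat (2 * k) - of_nat m) * pw k \<rho> / ?R) (at \<rho>)" for k
      unfolding pw_def[abs_def] by (rule has_vector_derivative_powi_ray[OF \<tau> \<rho>])
    have S1_eq: "S1 = (\<lambda>\<rho>. \<Sum>k<m. e k * pw k \<rho>)"
      by (simp add: S1_def[abs_def] Y_polar_def e_def pw_def)
    have dS1: "(S1 has_vector_derivative z1 \<rho> / ?R) (at \<rho>)"
    proof -
      have "(S1 has_vector_derivative (\<Sum>k<m. e k * ((of_nat (2 * k) - of_nat m) * pw k \<rho> / ?R))) (at \<rho>)"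
        unfolding S1_eq by (intro has_vector_derivative_sum has_vector_derivative_mult_right dpw)
      moreover have "(\<Sum>k<m. e k * ((of_nat (2 * k) - of_nat m) * pw k \<rho> / ?R)) = z1 \<rho> / ?R"
        by (simp add: z1_def sum_divide_distrib mult_ac)
      ultimately show ?thesis by simp
    qed
    have dz1: "(z1 has_vector_derivative (?q * S1 \<rho> + 4 * (of_nat m * J_coeff m 0 * (\<tau> * ?R) ^ m)) / ?R) (at \<rho>)"
    proof -
      have "(z1 has_vector_derivative (\<Sum>k<m. (of_nat (2 * k) - of_nat m) * (e k * ((of_nat (2 * k) - of_nat m) * pw k \<rho> / ?R)))) (at \<rho>)"
        unfolding z1_def[abs_def] by (intro has_vector_derivative_sum has_vector_derivative_mult_right dpw)
      moreover have "(\<Sum>k<m. (of_nat (2 * k) - of_nat m) * (e k * ((of_nat (2 * k) - of_nat m) * pw k \<rho> / ?R)))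
          = (\<Sum>k<m. (of_nat (2 * k) - of_nat m)\<^sup>2 * (e k * pw k \<rho>)) / ?R"
        by (simp add: sum_divide_distrib power2_eq_square mult_ac)
      moreover have "(\<Sum>k<m. (of_nat (2 * k) - of_nat m)\<^sup>2 * (e k * pw k \<rho>))
          = ?q * S1 \<rho> + 4 * (of_nat m * J_coeff m 0 * (\<tau> * ?R) ^ m)"
        unfolding q e_def pw_def S1_def using \<tau> \<rho>0 by (intro Y_polar_identity) simp
      ultimately show ?thesis by simp
    qed
    have dS2: "(S2 has_vector_derivative z2 \<rho> / ?R) (at \<rho>)"
      unfolding S2_def[abs_def] z2_def by (rule frobenius_has_vector_derivative[OF entire_coeffs_Y \<tau> \<rho>])
    have dz2: "(z2 has_vector_derivative (?q * S2 \<rho> + 4 * (zJ \<rho> - of_nat m * J_coeff m 0 * (\<tau> * ?R) ^ m)) / ?R) (at \<rho>)"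
      using frobenius_has_vector_derivative[OF entire_coeffs_index_mult[OF entire_coeffs_Y[of m], of m] \<tau> \<rho>, of m]
      unfolding Y_coeff_identity z2_def[abs_def] S2_def q zJ_def .
    have "((\<lambda>\<rho>. bessel_Y m (\<kappa> * of_real \<rho>)) has_vector_derivative
        of_real (2 / pi) * (L \<rho> * (zJ \<rho> / ?R) + 1 / ?R * J \<rho>) - of_real (1 / pi) * (z1 \<rho> / ?R) - of_real (1 / pi) * (z2 \<rho> / ?R)) (at \<rho>)"
      unfolding Y by (intro has_vector_derivative_diff has_vector_derivative_mult_right has_vector_derivative_mult dL dJ dS1 dS2)
    moreover have "of_real (2 / pi) * (L \<rho> * (zJ \<rho> / ?R) + 1 / ?R * J \<rho>) - of_real (1 / pi) * (z1 \<rho> / ?R) - of_real (1 / pi) * (z2 \<rho> / ?R) = z \<rho> / ?R"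
      unfolding z_def by (simp add: diff_divide_distrib add_divide_distrib distrib_left)
    moreover have "(z has_vector_derivative of_real (2 / pi) * (zJ \<rho> / ?R + (L \<rho> * (?q * J \<rho> / ?R) + 1 / ?R * zJ \<rho>))
        - of_real (1 / pi) * ((?q * S1 \<rho> + 4 * (of_nat m * J_coeff m 0 * (\<tau> * ?R) ^ m)) / ?R)
        - of_real (1 / pi) * ((?q * S2 \<rho> + 4 * (zJ \<rho> - of_nat m * J_coeff m 0 * (\<tau> * ?R) ^ m)) / ?R)) (at \<rho>)"
      unfolding z_def[abs_def]
      by (intro has_vector_derivative_diff has_vector_derivative_add has_vector_derivative_mult_right has_vector_derivative_mult dL dJ dzJ dz1 dz2)
    moreover have "of_real (2 / pi) * (zJ \<rho> / ?R + (L \<rho> * (?q * J \<rho> / ?R) + 1 / ?R * zJ \<rho>))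
        - of_real (1 / pi) * ((?q * S1 \<rho> + 4 * (of_nat m * J_coeff m 0 * (\<tau> * ?R) ^ m)) / ?R)
        - of_real (1 / pi) * ((?q * S2 \<rho> + 4 * (zJ \<rho> - of_nat m * J_coeff m 0 * (\<tau> * ?R) ^ m)) / ?R)
      = ?q * bessel_Y m (\<kappa> * of_real \<rho>) / ?R"
    proof -
      have pi2: "complex_of_real (2 / pi) = 2 * of_real (1 / pi)" by simp
      \<comment> \<open>Up to the common \<open>1 / R\<close>, the defects are
        \<open>2 * a * zj\<close> from the logarithm, \<open>-4 * b * w\<close> from the finite sum
        and \<open>-4 * b * (zj - w)\<close> from the Digamma series; they add up to 0 exactly
        because \<open>a = 2 * b\<close>.\<close>
      have gen: "a * (zj / R + (l * (q * j / R) + 1 / R * zj)) - b * ((q * s1 + 4 * w) / R) - b * ((q * s2 + 4 * (zj - w)) / R)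
        = q * (a * (l * j) - b * s1 - b * s2) / R" if "a = 2 * b" for a b zj R l q j s1 s2 w :: complex
        unfolding that by (simp add: divide_inverse algebra_simps)
      show ?thesis unfolding Y by (rule gen[OF pi2])
    qed
    ultimately show "((\<lambda>\<rho>. bessel_Y m (\<kappa> * of_real \<rho>)) has_vector_derivative z \<rho> / ?R) (at \<rho>) \<and>
        (z has_vector_derivative ?q * bessel_Y m (\<kappa> * of_real \<rho>) / ?R) (at \<rho>)"
      by simp
  qed
  then show ?thesis by blast
qed

section \<open>Separated functions\<close>

text \<open>Carries the derivative of the angular factor along with it. Sine is excluded for
  \<open>m = 0\<close>, where the separated function would vanish identically.\<close>

definition angular :: "nat \<Rightarrow> (real \<Rightarrow> real) \<Rightarrow> (real \<Rightarrow> real) \<Rightarrow> bool" where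
  "angular m \<phi> \<phi>' \<longleftrightarrow> (\<phi> = sin \<and> \<phi>' = cos \<and> m \<noteq> 0) \<or> (\<phi> = cos \<and> \<phi>' = (\<lambda>t. - sin t))"

lemma angular_derivative: "angular m \<phi> \<phi>' \<Longrightarrow> (\<phi> has_real_derivative \<phi>' t) (at t)"
  by (auto simp: angular_def intro: DERIV_sin DERIV_cos)

lemma angular_continuous: "angular m \<phi> \<phi>' \<Longrightarrow> continuous_on S \<phi> \<and> continuous_on S \<phi>'"
  by (auto simp: angular_def intro!: continuous_intros)

lemma has_integral_sin_cos_power2:
  assumes "m \<noteq> 0"
  shows "((\<lambda>\<theta>. (cos (real m * \<theta>))\<^sup>2) has_integral pi) {0..2 * pi}"
    and "((\<lambda>\<theta>. (sin (real m * \<theta>))\<^sup>2) has_integral pi) {0..2 * pi}"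
proof -
  \<comment> \<open>The oscillating part of the primitives of both squares, read off from the
    double-angle formulas; it is 0 at both ends of the period.\<close>
  define G where "G \<theta> = sin (2 * (real m * \<theta>)) / (4 * real m)" for \<theta>
  have "sin (2 * (real m * (2 * pi))) = 0"
    using sin_npi[of "4 * m"] by (simp add: mult_ac)
  then have G: "G (2 * pi) = 0" "G 0 = 0" by (simp_all add: G_def)
  have dG: "(G has_real_derivative cos (2 * (real m * \<theta>)) / 2) (at \<theta>)" for \<theta>
    unfolding G_def[abs_def] using assms by (auto intro!: derivative_eq_intros simp: field_simps)
  have "((\<lambda>\<theta>. \<theta> / 2 + G \<theta>) has_real_derivative (cos (real m * \<theta>))\<^sup>2) (at \<theta>)" for \<theta>
    by (auto intro!: derivative_eq_intros dG simp: cos_double_cos diff_divide_distrib)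
  then have "((\<lambda>\<theta>. (cos (real m * \<theta>))\<^sup>2) has_integral (2 * pi / 2 + G (2 * pi)) - (0 / 2 + G 0)) {0..2 * pi}"
    by (intro fundamental_theorem_of_calculus)
      (auto simp: has_real_derivative_iff_has_vector_derivative intro: has_vector_derivative_at_within)
  then show "((\<lambda>\<theta>. (cos (real m * \<theta>))\<^sup>2) has_integral pi) {0..2 * pi}" by (simp add: G)
  have "((\<lambda>\<theta>. \<theta> / 2 - G \<theta>) has_real_derivative (sin (real m * \<theta>))\<^sup>2) (at \<theta>)" for \<theta>
    by (auto intro!: derivative_eq_intros dG simp: cos_double_sin diff_divide_distrib)
  then have "((\<lambda>\<theta>. (sin (real m * \<theta>))\<^sup>2) has_integral (2 * pi / 2 - G (2 * pi)) - (0 / 2 - G 0)) {0..2 * pi}"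
    by (intro fundamental_theorem_of_calculus)
      (auto simp: has_real_derivative_iff_has_vector_derivative intro: has_vector_derivative_at_within)
  then show "((\<lambda>\<theta>. (sin (real m * \<theta>))\<^sup>2) has_integral pi) {0..2 * pi}" by (simp add: G)
qed

text \<open>The factor \<open>m^2\<close> stays on both sides of the second claim so that it covers
  \<open>m = 0\<close>: there the integral of the squared derivative is 0, but
  \<open>a_const m * pi\<close> is not.\<close>

lemma angular_integral:
  assumes "angular m \<phi> \<phi>'"
  shows "integral {0..2 * pi} (\<lambda>\<theta>. (\<phi> (real m * \<theta>))\<^sup>2) = a_const m * pi"
    and "(real m)\<^sup>2 * integral {0..2 * pi} (\<lambda>\<theta>. (\<phi>' (real m * \<theta>))\<^sup>2) = (real m)\<^sup>2 * (a_const m * pi)"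
proof -
  have "integral {0..2 * pi} (\<lambda>\<theta>. (\<phi> (real m * \<theta>))\<^sup>2) = a_const m * pi \<and>
    (real m)\<^sup>2 * integral {0..2 * pi} (\<lambda>\<theta>. (\<phi>' (real m * \<theta>))\<^sup>2) = (real m)\<^sup>2 * (a_const m * pi)"
  proof (cases "m = 0")
    case True
    then show ?thesis using assms by (auto simp: angular_def a_const_def)
  next
    case False
    then show ?thesis
      using has_integral_sin_cos_power2[OF False, THEN integral_unique] assms
      by (auto simp: angular_def a_const_def)
  qed
  then show "integral {0..2 * pi} (\<lambda>\<theta>. (\<phi> (real m * \<theta>))\<^sup>2) = a_const m * pi"
    and "(real m)\<^sup>2 * integral {0..2 * pi} (\<lambda>\<theta>. (\<phi>' (real m * \<theta>))\<^sup>2) = (real m)\<^sup>2 * (a_const m * pi)"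
    by blast+
qed

text \<open>The angle has to lie strictly inside the period, because the essential supremum will be
  tested on an open parameter interval. For cosine this rules out the angle 0.\<close>

lemma angular_attains_max:
  assumes "angular m \<phi> \<phi>'"
  obtains \<theta> where "0 < \<theta>" "\<theta> < 2 * pi" "\<bar>\<phi> (real m * \<theta>)\<bar> = 1"
proof -
  consider "\<phi> = sin" "m \<noteq> 0" | "\<phi> = cos" "m \<noteq> 0" | "\<phi> = cos" "m = 0"
    using assms by (auto simp: angular_def)
  then show thesis
  proof cases
    case 1
    have "pi / (2 * real m) \<le> pi / 2" using 1(2) by (intro divide_left_mono) auto
    then have "pi / (2 * real m) < 2 * pi" using pi_gt_zero by linarith
    then show ?thesis using 1 by (intro that[of "pi / (2 * real m)"]) auto
  next
    case 2
    have "pi / real m \<le> pi / 1" using 2(2) by (intro divide_left_mono) auto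
    then have "pi / real m < 2 * pi" using pi_gt_zero by linarith
    then show ?thesis using 2 by (intro that[of "pi / real m"]) auto
  next
    case 3
    then show ?thesis by (intro that[of pi]) auto
  qed
qed

lemma sphere_polar:
  assumes "norm x = s"
  obtains \<theta> where "\<theta> \<in> {0..<2 * pi}" "x = polar s \<theta>"
  using assms polar_representation[of x] by metis

text \<open>The product form is demanded at every positive radius and every real angle, not only
  where \<open>v\<close> and \<open>w\<close> are prescribed, so that it can be differentiated on
  the boundary circles and across the angle 0.\<close>

definition separated :: "nat \<Rightarrow> (real \<Rightarrow> real) \<Rightarrow> (real \<Rightarrow> complex) \<Rightarrow> (real^2 \<Rightarrow> complex) \<Rightarrow> bool" where
  "separated m \<phi> F u \<longleftrightarrow> C1_on (- {0}) u \<and>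
     (\<forall>\<rho>>0. \<forall>\<theta>. u (polar \<rho> \<theta>) = F \<rho> * of_real (\<phi> (real m * \<theta>)))"

lemma C1_on_radial:
  fixes F :: "real \<Rightarrow> complex"
  assumes F: "\<And>\<rho>. \<rho> > 0 \<Longrightarrow> (F has_vector_derivative F' \<rho>) (at \<rho>)" and F': "continuous_on {0<..} F'"
  shows "C1_on (- {0}) (\<lambda>x::real^2. F (norm x))"
proof (rule C1_onI)
  fix x :: "real^2" assume "x \<in> - {0}"
  then have x: "x \<noteq> 0" by simp
  have "(norm has_derivative (\<lambda>h. h \<bullet> sgn x)) (at x)"
    using GDERIV_norm[OF x] by (simp add: gderiv_def)
  from has_derivative_compose[OF this F[of "norm x", unfolded has_vector_derivative_def]] x
  show "((\<lambda>x. F (norm x)) has_derivative (\<lambda>h. (h \<bullet> sgn x) *\<^sub>R F' (norm x))) (at x)" by simp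
next
  fix b :: "real^2"
  show "continuous_on (- {0}) (\<lambda>x. (b \<bullet> sgn x) *\<^sub>R F' (norm x))"
    by (intro continuous_intros continuous_on_compose2[OF F']) auto
qed

text \<open>With \<open>B\<close> the real or imaginary part, this function is
  \<open>\<rho> ^ m\<close> times \<open>cos (m \<theta>)\<close> or
  \<open>sin (m \<theta>)\<close>, expressed without an angle.\<close>

lemma C1_on_harmonic:
  fixes B :: "complex \<Rightarrow> real"
  assumes B: "bounded_linear B"
  shows "C1_on S (\<lambda>x::real^2. complex_of_real (B (Complex (x $ 1) (x $ 2) ^ m)))"
proof (rule C1_onI)
  have L: "bounded_linear (\<lambda>x::real^2. Complex (x $ 1) (x $ 2))"
  proof -
    have "(\<lambda>x::real^2. Complex (x $ 1) (x $ 2)) = (\<lambda>x. of_real (x $ 1) + \<i> * of_real (x $ 2))"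
      by (simp add: complex_eq_iff fun_eq_iff)
    moreover have "bounded_linear (\<lambda>x::real^2. of_real (x $ 1) + \<i> * of_real (x $ 2))"
      by (intro bounded_linear_add bounded_linear_const_mult bounded_linear_compose[OF bounded_linear_of_real] bounded_linear_vec_nth)
    ultimately show ?thesis by simp
  qed
  have B': "bounded_linear (\<lambda>z. complex_of_real (B z))"
    by (rule bounded_linear_compose[OF bounded_linear_of_real B])
  fix x :: "real^2"
  show "((\<lambda>x. complex_of_real (B (Complex (x $ 1) (x $ 2) ^ m))) has_derivative
     (\<lambda>h. of_real (B (of_nat m * Complex (h $ 1) (h $ 2) * Complex (x $ 1) (x $ 2) ^ (m - 1))))) (at x)"
    by (rule bounded_linear.has_derivative[OF B'])
      (rule has_derivative_power[OF bounded_linear_imp_has_derivative[OF L]])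
next
  fix b :: "real^2"
  have "continuous_on S (\<lambda>x::real^2. Complex (x $ 1) (x $ 2))"
    by (intro continuous_on_Complex continuous_intros)
  then show "continuous_on S (\<lambda>x. complex_of_real (B (of_nat m * Complex (b $ 1) (b $ 2) * Complex (x $ 1) (x $ 2) ^ (m - 1))))"
    by (intro continuous_intros bounded_linear.continuous_on[OF B])
qed

text \<open>A globally continuous angle does not exist on the punctured plane. Instead the angular
  factor is taken from the real or imaginary part of \<open>(x + i y) ^ m\<close>, and the radial
  factor \<open>F \<rho> / \<rho> ^ m\<close> compensates for its modulus.\<close>

lemma separated_exists:
  assumes \<phi>: "angular m \<phi> \<phi>'" and F: "\<And>\<rho>. \<rho> > 0 \<Longrightarrow> (F has_vector_derivative F' \<rho>) (at \<rho>)"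
    and F': "continuous_on {0<..} F'"
  shows "\<exists>u. separated m \<phi> F u"
proof -
  define B where "B = (if \<phi> = cos then Re else Im)"
  have B: "bounded_linear B" by (simp add: B_def bounded_linear_Re bounded_linear_Im)
  have B_cis: "B (of_real R * cis t) = R * \<phi> t" for R t
    using \<phi> by (auto simp: angular_def B_def)
  define G where "G \<rho> = F \<rho> / of_real (\<rho> ^ m)" for \<rho>
  have cF: "continuous_on {0<..} F"
    using F by (intro continuous_at_imp_continuous_on) (auto intro: has_vector_derivative_continuous)
  have dG: "(G has_vector_derivative
      F \<rho> * of_real (- (real m * \<rho> ^ (m - 1)) / (\<rho> ^ m)\<^sup>2) + F' \<rho> * of_real (1 / \<rho> ^ m)) (at \<rho>)" if "\<rho> > 0" for \<rho>
  proof -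
    have "((\<lambda>\<rho>. 1 / \<rho> ^ m) has_real_derivative - (real m * \<rho> ^ (m - 1)) / (\<rho> ^ m)\<^sup>2) (at \<rho>)"
      using that by (auto intro!: derivative_eq_intros simp: power2_eq_square)
    then have "((\<lambda>\<rho>. complex_of_real (1 / \<rho> ^ m)) has_vector_derivative of_real (- (real m * \<rho> ^ (m - 1)) / (\<rho> ^ m)\<^sup>2)) (at \<rho>)"
      by (intro has_vector_derivative_of_real) (simp add: has_real_derivative_iff_has_vector_derivative)
    from has_vector_derivative_mult[OF F[OF that] this]
    show ?thesis by (simp add: G_def[abs_def])
  qed
  have "C1_on (- {0}) (\<lambda>x::real^2. G (norm x))"
    by (rule C1_on_radial[OF dG]) (auto intro!: continuous_intros cF F')
  moreover have "C1_on (- {0}) (\<lambda>x::real^2. complex_of_real (B (Complex (x $ 1) (x $ 2) ^ m)))"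
    by (rule C1_on_harmonic[OF B])
  ultimately have "C1_on (- {0}) (\<lambda>x::real^2. G (norm x) * complex_of_real (B (Complex (x $ 1) (x $ 2) ^ m)))"
    by (rule C1_on_mult)
  moreover have "G (norm (polar \<rho> \<theta>)) * complex_of_real (B (Complex (polar \<rho> \<theta> $ 1) (polar \<rho> \<theta> $ 2) ^ m))
      = F \<rho> * of_real (\<phi> (real m * \<theta>))" if "\<rho> > 0" for \<rho> \<theta>
  proof -
    have "Complex (polar \<rho> \<theta> $ 1) (polar \<rho> \<theta> $ 2) = of_real \<rho> * cis \<theta>"
      by (simp add: complex_eq_iff)
    then have "Complex (polar \<rho> \<theta> $ 1) (polar \<rho> \<theta> $ 2) ^ m = of_real (\<rho> ^ m) * cis (real m * \<theta>)"
      by (simp add: power_mult_distrib Complex.DeMoivre)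
    then show ?thesis
      using that by (simp only: B_cis norm_polar) (simp add: G_def)
  qed
  ultimately show ?thesis unfolding separated_def by blast
qed

text \<open>Differentiating along the ray and along the circle once by the chain rule and once in
  the product form gives the same vector derivatives; the circle is traversed with speed
  \<open>\<rho>\<close>, hence the final division.\<close>

lemma separated_derivatives:
  assumes u: "separated m \<phi> F u" and \<phi>: "angular m \<phi> \<phi>'" and \<rho>: "\<rho> > 0"
    and F: "(F has_vector_derivative F') (at \<rho>)"
  shows "frechet_derivative u (at (polar \<rho> \<theta>)) (polar 1 \<theta>) = F' * of_real (\<phi> (real m * \<theta>))"
    and "frechet_derivative u (at (polar \<rho> \<theta>)) (polar 1 (\<theta> + pi / 2))
       = F \<rho> * of_real (real m * \<phi>' (real m * \<theta>)) / of_real \<rho>"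
proof -
  have C1: "C1_on (- {0}) u" using u by (simp add: separated_def)
  have val: "\<And>\<rho> \<theta>. \<rho> > 0 \<Longrightarrow> u (polar \<rho> \<theta>) = F \<rho> * of_real (\<phi> (real m * \<theta>))"
    using u by (simp add: separated_def)
  have "((\<lambda>\<rho>. F \<rho> * of_real (\<phi> (real m * \<theta>))) has_vector_derivative F' * of_real (\<phi> (real m * \<theta>))) (at \<rho>)"
    using F by (rule has_vector_derivative_mult_left)
  then have radial: "((\<lambda>\<rho>. u (polar \<rho> \<theta>)) has_vector_derivative F' * of_real (\<phi> (real m * \<theta>))) (at \<rho>)"
    by (rule has_vector_derivative_transform_within_open[of _ _ _ "{0<..}"]) (use \<rho> val in auto)
  show "frechet_derivative u (at (polar \<rho> \<theta>)) (polar 1 \<theta>) = F' * of_real (\<phi> (real m * \<theta>))"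
    by (rule vector_derivative_unique_at[OF has_vector_derivative_polar_radius[OF C1] radial]) (use \<rho> in simp)
  have "((\<lambda>\<theta>. \<phi> (real m * \<theta>)) has_real_derivative \<phi>' (real m * \<theta>) * real m) (at \<theta>)"
    by (rule DERIV_chain2[OF angular_derivative[OF \<phi>]]) (auto intro!: derivative_eq_intros)
  then have "((\<lambda>\<theta>. F \<rho> * of_real (\<phi> (real m * \<theta>))) has_vector_derivative F \<rho> * of_real (\<phi>' (real m * \<theta>) * real m)) (at \<theta>)"
    by (intro has_vector_derivative_mult_right has_vector_derivative_of_real)
      (simp add: has_real_derivative_iff_has_vector_derivative)
  moreover have "((\<lambda>\<theta>. F \<rho> * of_real (\<phi> (real m * \<theta>))) has_vector_derivative
      \<rho> *\<^sub>R frechet_derivative u (at (polar \<rho> \<theta>)) (polar 1 (\<theta> + pi / 2))) (at \<theta>)"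
    using has_vector_derivative_polar_angle[OF C1, of \<rho> \<theta>] \<rho> val by simp
  ultimately have "\<rho> *\<^sub>R frechet_derivative u (at (polar \<rho> \<theta>)) (polar 1 (\<theta> + pi / 2)) = F \<rho> * of_real (\<phi>' (real m * \<theta>) * real m)"
    by (rule vector_derivative_unique_at[symmetric])
  then show "frechet_derivative u (at (polar \<rho> \<theta>)) (polar 1 (\<theta> + pi / 2))
       = F \<rho> * of_real (real m * \<phi>' (real m * \<theta>)) / of_real \<rho>"
    using \<rho> by (simp add: scaleR_conv_of_real field_simps)
qed

text \<open>Two products are provided for because gradients contribute both the square of
  \<open>\<phi>\<close> (radial part) and the square of \<open>\<phi>'\<close> (tangential part).
  The real formula is applied to the real and the imaginary part, both of the form
  \<open>L\<close>.\<close>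

lemma polar_integral_annulus_complex:
  fixes h :: "real^2 \<Rightarrow> complex"
  assumes r: "0 < r" "r < 1" and h: "continuous_on (- {0}) h"
    and A: "continuous_on {r..1} A" and B: "continuous_on {r..1} B"
    and a: "continuous_on {0..2 * pi} a" and b: "continuous_on {0..2 * pi} b"
    and eq: "\<And>\<rho> \<theta>. \<rho> \<in> {r..1} \<Longrightarrow> of_real \<rho> * h (polar \<rho> \<theta>) = A \<rho> * of_real (a \<theta>) + B \<rho> * of_real (b \<theta>)"
  shows "(\<integral>x. h x \<partial>lebesgue_on (annulus r))
       = integral {r..1} A * of_real (integral {0..2 * pi} a) + integral {r..1} B * of_real (integral {0..2 * pi} b)"
proof -
  have int: "integrable (lebesgue_on (annulus r)) h"
    using open_annulus bounded_annulus h closure_annulus_subset[OF r(1)]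
    by (rule integrable_lebesgue_on_if_continuous_on)
  have key: "L (\<integral>x. h x \<partial>lebesgue_on (annulus r))
      = L (integral {r..1} A * of_real (integral {0..2 * pi} a) + integral {r..1} B * of_real (integral {0..2 * pi} b))"
    if L: "bounded_linear L" for L :: "complex \<Rightarrow> real"
  proof -
    have lin: "L (x + y) = L x + L y" "L (x * of_real c) = L x * c" "L (of_real c * x) = c * L x" for x y c
      using L linear_add[OF bounded_linear.linear] linear_cmul[OF bounded_linear.linear, of L c x]
      by (auto simp: scaleR_conv_of_real mult.commute)
    have LI: "integral S (\<lambda>x. L (f x)) = L (integral S f)" if "f integrable_on S" for f and S :: "real set"
      using integral_linear[OF that L] by (simp add: o_def)
    have cL: "continuous_on S (\<lambda>x. L (f x))" if "continuous_on S f" for S :: "'b::topological_space set" and f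
      by (rule bounded_linear.continuous_on[OF L that])
    have intA: "A integrable_on {r..1}" "B integrable_on {r..1}" "a integrable_on {0..2*pi}" "b integrable_on {0..2*pi}"
      using A B a b by (auto intro: integrable_continuous_real)
    have intL: "(\<lambda>\<rho>. L (A \<rho>)) integrable_on {r..1}" "(\<lambda>\<rho>. L (B \<rho>)) integrable_on {r..1}"
      using A B by (auto intro!: integrable_continuous_real cL)
    have "L (\<integral>x. h x \<partial>lebesgue_on (annulus r)) = (\<integral>x. L (h x) \<partial>lebesgue_on (annulus r))"
      by (rule integral_bounded_linear[OF L int, symmetric])
    also have "\<dots> = integral {0..2 * pi} (\<lambda>\<theta>. integral {r..1} (\<lambda>\<rho>. \<rho> * L (h (polar \<rho> \<theta>))))"
      by (rule polar_integral_annulus[OF r cL[OF h]])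
    also have "\<dots> = integral {0..2 * pi} (\<lambda>\<theta>. integral {r..1} (\<lambda>\<rho>. L (A \<rho>) * a \<theta> + L (B \<rho>) * b \<theta>))"
      using eq by (intro Henstock_Kurzweil_Integration.integral_cong) (simp flip: lin(3), simp add: lin)
    also have "\<dots> = integral {0..2 * pi} (\<lambda>\<theta>. integral {r..1} (\<lambda>\<rho>. L (A \<rho>)) * a \<theta> + integral {r..1} (\<lambda>\<rho>. L (B \<rho>)) * b \<theta>)"
      by (intro Henstock_Kurzweil_Integration.integral_cong, subst Henstock_Kurzweil_Integration.integral_add)
        (auto intro!: integrable_on_mult_left intL)
    also have "\<dots> = integral {r..1} (\<lambda>\<rho>. L (A \<rho>)) * integral {0..2 * pi} a + integral {r..1} (\<lambda>\<rho>. L (B \<rho>)) * integral {0..2 * pi} b"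
      by (subst Henstock_Kurzweil_Integration.integral_add) (auto intro!: integrable_on_mult_right intA)
    also have "\<dots> = L (integral {r..1} A * of_real (integral {0..2 * pi} a) + integral {r..1} B * of_real (integral {0..2 * pi} b))"
      by (simp add: LI intA lin)
    finally show ?thesis .
  qed
  show ?thesis
    using key[OF bounded_linear_Re] key[OF bounded_linear_Im] by (intro complex_eqI)
qed

text \<open>The upper bound holds at every point. For the lower bound a single angle where the
  angular factor has modulus 1 is only a null set; but the parameters at which the modulus of
  \<open>f\<close> does not exceed the essential supremum form a closed set of full measure in an
  open interval, and such a set contains the whole interval.\<close>

lemma Linf_norm_arc_measure:
  assumes \<phi>: "angular m \<phi> \<phi>'" and s: "s > 0"
    and f: "\<And>\<theta>. \<theta> \<in> {0..<2 * pi} \<Longrightarrow> f (polar s \<theta>) = c * of_real (\<phi> (real m * \<theta>))"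
  shows "Linf_norm (arc_measure s) f = cmod c"
proof -
  \<comment> \<open>A separated function with constant profile \<open>c\<close> shows that
    \<open>f\<close> is continuous on the circle, also where the period closes up, and hence
    measurable.\<close>
  obtain u where u: "separated m \<phi> (\<lambda>_. c) u"
    using separated_exists[OF \<phi>, where F="\<lambda>_. c" and F'="\<lambda>_. 0", OF has_vector_derivative_const continuous_on_const]
    by (elim exE)
  have fu: "f x = u x" if x: "x \<in> sphere 0 s" for x
  proof -
    obtain \<theta> where "\<theta> \<in> {0..<2 * pi}" "x = polar s \<theta>"
      using sphere_polar[of x s] x by auto
    then show ?thesis using f u s by (simp add: separated_def)
  qed
  have "continuous_on (sphere 0 s) u"
    using u s by (auto simp: separated_def intro: continuous_on_subset[OF C1_on_imp_continuous_on])
  then have "continuous_on (sphere 0 s) f" by (rule continuous_on_eq) (use fu in auto)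
  then have "continuous_on (sphere 0 s) (\<lambda>x. ereal (cmod (f x)))"
    by (intro continuous_on_ereal continuous_intros)
  then have meas: "(\<lambda>x. ereal (cmod (f x))) \<in> borel_measurable (restrict_space borel (sphere 0 s))"
    by (rule borel_measurable_continuous_on_restrict)
  have meas_arc: "(\<lambda>x. ereal (cmod (f x))) \<in> borel_measurable (arc_measure s)"
    using meas by (simp add: arc_measure_def cong: measurable_cong_sets)
  have polar: "(\<lambda>t. polar s (t / s)) \<in> restrict_space lborel {0..<2 * pi * s} \<rightarrow>\<^sub>M restrict_space borel (sphere 0 s)"
  proof -
    have "continuous_on UNIV (\<lambda>t. polar s (t / s))" using s by (intro continuous_intros) auto
    then have "(\<lambda>t. polar s (t / s)) \<in> borel \<rightarrow>\<^sub>M borel" by (rule borel_measurable_continuous_onI)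
    then show ?thesis using s by (intro measurable_restrict_space2 measurable_restrict_space1) auto
  qed
  have \<phi>1: "\<bar>\<phi> t\<bar> \<le> 1" for t using \<phi> by (auto simp: angular_def)
  have "esssup (arc_measure s) (\<lambda>x. ereal (cmod (f x))) = ereal (cmod c)"
  proof (rule antisym)
    have "cmod (f x) \<le> cmod c" if x: "x \<in> sphere 0 s" for x
    proof -
      obtain \<theta> where "\<theta> \<in> {0..<2 * pi}" "x = polar s \<theta>"
        using sphere_polar[of x s] x by auto
      then show ?thesis using f \<phi>1 by (simp add: norm_mult mult_left_le)
    qed
    then show "esssup (arc_measure s) (\<lambda>x. ereal (cmod (f x))) \<le> ereal (cmod c)"
      by (intro esssup_I[OF meas_arc] AE_I2) (auto simp: arc_measure_def space_restrict_space)
  next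
    define e where "e = esssup (arc_measure s) (\<lambda>x. ereal (cmod (f x)))"
    have ae: "AE x in arc_measure s. ereal (cmod (f x)) \<le> e"
      unfolding e_def by (rule esssup_AE)
    have sets: "{x \<in> space (restrict_space borel (sphere 0 s)). ereal (cmod (f x)) \<le> e} \<in> sets (restrict_space borel (sphere 0 s))"
      using meas by (intro borel_measurable_le) auto
    have "AE t in restrict_space lborel {0..<2 * pi * s}. ereal (cmod (f (polar s (t / s)))) \<le> e"
      using ae unfolding arc_measure_def AE_distr_iff[OF polar sets] .
    then have "AE t in lborel. t \<in> {0..<2 * pi * s} \<longrightarrow> ereal (cmod (f (polar s (t / s)))) \<le> e"
      by (simp add: AE_restrict_space_iff)
    moreover have "f (polar s (t / s)) = c * of_real (\<phi> (real m * (t / s)))" if "t \<in> {0<..<2 * pi * s}" for t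
      by (rule f) (use that s in \<open>simp add: pos_divide_less_eq\<close>)
    ultimately have "AE t in lborel. t \<in> {0<..<2 * pi * s} \<longrightarrow> t \<in> {t. ereal (cmod (c * of_real (\<phi> (real m * (t / s))))) \<le> e}"
      by (elim AE_mp) (auto intro!: AE_I2)
    then have AE: "AE t\<in>{0<..<2 * pi * s} in lebesgue. t \<in> {t. ereal (cmod (c * of_real (\<phi> (real m * (t / s))))) \<le> e}"
      by (rule AE_completion)
    have closed: "closed {t. ereal (cmod (c * of_real (\<phi> (real m * (t / s))))) \<le> e}"
    proof -
      have "continuous_on UNIV (\<lambda>t. \<phi> (real m * (t / s)))"
        by (rule continuous_on_compose2[of UNIV \<phi>])
          (use angular_continuous[OF \<phi>] s in \<open>auto intro!: continuous_intros\<close>)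
      then show ?thesis
        by (intro closed_Collect_le continuous_on_ereal continuous_on_norm continuous_on_mult
            continuous_on_of_real continuous_on_const)
    qed
    obtain \<theta> where \<theta>: "0 < \<theta>" "\<theta> < 2 * pi" "\<bar>\<phi> (real m * \<theta>)\<bar> = 1"
      using angular_attains_max[OF \<phi>] .
    have "\<theta> * s \<in> {t. ereal (cmod (c * of_real (\<phi> (real m * (t / s))))) \<le> e}"
      by (rule mem_closed_if_AE_lebesgue_open[OF _ closed AE]) (use \<theta> s in auto)
    then show "ereal (cmod c) \<le> esssup (arc_measure s) (\<lambda>x. ereal (cmod (f x)))"
      using \<theta> s by (simp add: norm_mult e_def)
  qed
  then show ?thesis by (simp add: Linf_norm_def)
qed

section \<open>The transmission problem\<close>

lemma bessel_system_has_derivative: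
  assumes "bessel_system m q y z" "\<rho> > 0"
  shows "(y has_vector_derivative z \<rho> / of_real \<rho>) (at \<rho>)"
    and "(z has_vector_derivative ((of_nat m)\<^sup>2 - q * (of_real \<rho>)\<^sup>2) * y \<rho> / of_real \<rho>) (at \<rho>)"
  using assms by (auto simp: bessel_system_def)

lemma bessel_system_continuous:
  assumes "bessel_system m q y z"
  shows "continuous_on {0<..} y" and "continuous_on {0<..} z"
  using bessel_system_has_derivative[OF assms]
  by (auto intro!: continuous_at_imp_continuous_on intro: has_vector_derivative_continuous)

text \<open>Multiplying Bessel's equation by \<open>\<rho>\<^sup>2 y'\<close> makes it exact (Pohozaev's identity); this is where
  \<open>\<kappa>\<^sup>2\<close> has to be real.\<close>

lemma bessel_system_Pohozaev:
  assumes y: "bessel_system m (of_real q) y z" and \<rho>: "\<rho> > 0"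
  shows "((\<lambda>\<rho>. (cmod (z \<rho>))\<^sup>2 + (q * \<rho>\<^sup>2 - (real m)\<^sup>2) * (cmod (y \<rho>))\<^sup>2) has_real_derivative
           2 * q * (\<rho> * (cmod (y \<rho>))\<^sup>2)) (at \<rho>)"
proof -
  define c where "c = (real m)\<^sup>2 - q * \<rho>\<^sup>2"
  \<comment> \<open>Because \<open>q\<close> is real, the right-hand side of the second equation is
    a real multiple of \<open>y\<close>, and a real factor can be pulled out of the real inner
    product with \<open>z\<close>.\<close>
  have c: "((of_nat m)\<^sup>2 - of_real q * (of_real \<rho>)\<^sup>2) * y \<rho> / of_real \<rho> = (c / \<rho>) *\<^sub>R y \<rho>"
    by (simp add: c_def scaleR_conv_of_real)
  have sq: "((\<lambda>\<rho>. (cmod (f \<rho>))\<^sup>2) has_real_derivative 2 * (f \<rho> \<bullet> f')) (at \<rho>)"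
    if "(f has_vector_derivative f') (at \<rho>)" for f :: "real \<Rightarrow> complex" and f'
  proof -
    have "((\<lambda>\<rho>. f \<rho> \<bullet> f \<rho>) has_derivative (\<lambda>h. f \<rho> \<bullet> (h *\<^sub>R f') + (h *\<^sub>R f') \<bullet> f \<rho>)) (at \<rho>)"
      using that by (intro has_derivative_inner) (auto simp: has_vector_derivative_def)
    then have "((\<lambda>\<rho>. f \<rho> \<bullet> f \<rho>) has_real_derivative 2 * (f \<rho> \<bullet> f')) (at \<rho>)"
      by (rule has_derivative_imp_has_field_derivative) (simp add: inner_commute)
    then show ?thesis by (simp add: dot_square_norm)
  qed
  have dy: "((\<lambda>\<rho>. (cmod (y \<rho>))\<^sup>2) has_real_derivative 2 * (y \<rho> \<bullet> z \<rho>) / \<rho>) (at \<rho>)"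
  proof -
    have "z \<rho> / of_real \<rho> = (1 / \<rho>) *\<^sub>R z \<rho>" by (simp add: scaleR_conv_of_real)
    then show ?thesis using sq[OF bessel_system_has_derivative(1)[OF y \<rho>]] by simp
  qed
  have dz: "((\<lambda>\<rho>. (cmod (z \<rho>))\<^sup>2) has_real_derivative 2 * (z \<rho> \<bullet> y \<rho>) * c / \<rho>) (at \<rho>)"
    using sq[OF bessel_system_has_derivative(2)[OF y \<rho>]] unfolding c by (simp add: mult_ac)
  have "((\<lambda>\<rho>. q * \<rho>\<^sup>2 - (real m)\<^sup>2) has_real_derivative 2 * q * \<rho>) (at \<rho>)"
    by (auto intro!: derivative_eq_intros)
  from DERIV_add[OF dz DERIV_mult[OF this dy]]
  have "((\<lambda>\<rho>. (cmod (z \<rho>))\<^sup>2 + (q * \<rho>\<^sup>2 - (real m)\<^sup>2) * (cmod (y \<rho>))\<^sup>2) has_real_derivative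
      2 * (z \<rho> \<bullet> y \<rho>) * c / \<rho> + (2 * q * \<rho> * (cmod (y \<rho>))\<^sup>2 + 2 * (y \<rho> \<bullet> z \<rho>) / \<rho> * (q * \<rho>\<^sup>2 - (real m)\<^sup>2))) (at \<rho>)" .
  moreover have "2 * (z \<rho> \<bullet> y \<rho>) * c / \<rho> + (2 * q * \<rho> * (cmod (y \<rho>))\<^sup>2 + 2 * (y \<rho> \<bullet> z \<rho>) / \<rho> * (q * \<rho>\<^sup>2 - (real m)\<^sup>2))
      = 2 * q * (\<rho> * (cmod (y \<rho>))\<^sup>2)"
  proof -
    have "y \<rho> \<bullet> z \<rho> = z \<rho> \<bullet> y \<rho>" by (rule inner_commute)
    moreover have "2 * A * (M - Q) / R + (2 * q * R * N + 2 * A / R * (Q - M)) = 2 * q * (R * N)" for A M Q R N :: real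
      by (simp add: divide_inverse algebra_simps)
    ultimately show ?thesis unfolding c_def by simp
  qed
  ultimately show ?thesis by (simp only:)
qed

lemma integral_difference_of_bessel_systems:
  assumes f: "bessel_system m (of_real q) f zf" and g: "bessel_system m (of_real (p * q)) g zg"
    and r: "0 < r" "r < 1" and q: "q \<noteq> 0"
    and eq: "f r = g r" "f 1 = g 1" "zf r = zg r" "zf 1 = zg 1"
  shows "integral {r..1} (\<lambda>\<rho>. \<rho> * ((cmod (f \<rho>))\<^sup>2 - p * (cmod (g \<rho>))\<^sup>2))
       = (1 - p) / 2 * ((cmod (f 1))\<^sup>2 - r\<^sup>2 * (cmod (f r))\<^sup>2)"
proof -
  define H where "H \<rho> = ((cmod (zf \<rho>))\<^sup>2 + (q * \<rho>\<^sup>2 - (real m)\<^sup>2) * (cmod (f \<rho>))\<^sup>2)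
      - ((cmod (zg \<rho>))\<^sup>2 + (p * q * \<rho>\<^sup>2 - (real m)\<^sup>2) * (cmod (g \<rho>))\<^sup>2)" for \<rho>
  have "(H has_real_derivative 2 * q * (\<rho> * (cmod (f \<rho>))\<^sup>2) - 2 * (p * q) * (\<rho> * (cmod (g \<rho>))\<^sup>2)) (at \<rho>)"
    if "\<rho> > 0" for \<rho>
    unfolding H_def[abs_def]
    by (rule DERIV_diff[OF bessel_system_Pohozaev[OF f that] bessel_system_Pohozaev[OF g that]])
  then have "((\<lambda>\<rho>. 2 * q * (\<rho> * (cmod (f \<rho>))\<^sup>2) - 2 * (p * q) * (\<rho> * (cmod (g \<rho>))\<^sup>2)) has_integral H 1 - H r) {r..1}"
    using r by (intro fundamental_theorem_of_calculus)
      (auto simp: has_real_derivative_iff_has_vector_derivative intro: has_vector_derivative_at_within)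
  then have "((\<lambda>\<rho>. 1 / (2 * q) * (2 * q * (\<rho> * (cmod (f \<rho>))\<^sup>2) - 2 * (p * q) * (\<rho> * (cmod (g \<rho>))\<^sup>2))) has_integral
      1 / (2 * q) * (H 1 - H r)) {r..1}"
    by (rule has_integral_mult_right)
  moreover have "1 / (2 * q) * (2 * q * (\<rho> * (cmod (f \<rho>))\<^sup>2) - 2 * (p * q) * (\<rho> * (cmod (g \<rho>))\<^sup>2))
      = \<rho> * ((cmod (f \<rho>))\<^sup>2 - p * (cmod (g \<rho>))\<^sup>2)" for \<rho>
    using q by (simp add: field_simps)
  moreover have "1 / (2 * q) * (H 1 - H r) = (1 - p) / 2 * ((cmod (f 1))\<^sup>2 - r\<^sup>2 * (cmod (f r))\<^sup>2)"
    unfolding H_def using q eq by (simp add: field_simps)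
  ultimately show ?thesis by (simp add: integral_unique)
qed

text \<open>Makes the diagonal pairs \<open>(\<eta>, \<eta>)\<close> admissible as test functions.
  The norm of 0 needs an argument, since the chosen weak gradient of 0 is known to vanish only
  almost everywhere.\<close>

lemma vanishing_trace_zero:
  assumes "0 < r"
  shows "vanishing_trace r (\<lambda>x. 0)"
proof -
  have "(H1_norm (annulus r) (\<lambda>x. 0))\<^sup>2
      = (\<integral>x. (cmod 0)\<^sup>2 + (norm (classical_grad (\<lambda>x. 0) x))\<^sup>2 \<partial>lebesgue_on (annulus r))"
    by (rule H1_norm_power2_eq[OF assms]) (auto intro: smooth_imp_C1_on simp: smooth_def Ck_const)
  also have "\<dots> = 0" by (simp add: classical_grad_def zero_vec_def)
  finally have "H1_norm (annulus r) (\<lambda>x. 0) = 0" by simp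
  then show ?thesis
    unfolding vanishing_trace_def
    by (intro exI[of _ "\<lambda>_ _. 0"]) (auto simp: smooth_def Ck_const)
qed

text \<open>The profile \<open>e\<close> equals 1 at \<open>s\<close> and 0 at the other end, so
  that only the boundary term at \<open>s\<close> survives. No integration by parts is carried out
  in the plane: in polar form the tested equation is the integral of an exact radial derivative.
  \<open>\<kappa>2\<close> may be any complex number.\<close>

lemma itp_weak_form_separated:
  assumes r: "0 < r" "r < 1" and weak: "\<And>y. y \<in> itp_space r \<Longrightarrow> itp_stiffness r (v, w) y = \<kappa>2 * itp_mass r (\<lambda>_. p) (v, w) y"
    and \<phi>: "angular m \<phi> \<phi>'"
    and f: "bessel_system m \<kappa>2 f zf" and g: "bessel_system m (of_real p * \<kappa>2) g zg"
    and u: "separated m \<phi> f u" "separated m \<phi> g u'"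
    and v: "\<And>x. x \<in> annulus r \<Longrightarrow> v x = u x" and w: "\<And>x. x \<in> annulus r \<Longrightarrow> w x = u' x"
    and s: "s \<in> {r, 1}"
  shows "zf s = zg s"
proof -
  define t where "t = r + 1 - s"
  have st: "s - t \<noteq> 0" using s r by (auto simp: t_def)
  define e :: "real \<Rightarrow> complex" where "e \<rho> = of_real ((\<rho> - t) / (s - t))" for \<rho>
  define e' :: complex where "e' = of_real (1 / (s - t))"
  have e: "(e has_vector_derivative e') (at \<rho>)" for \<rho>
    unfolding e_def[abs_def] e'_def
    by (intro has_vector_derivative_of_real)
      (use st in \<open>auto intro!: derivative_eq_intros simp flip: has_real_derivative_iff_has_vector_derivative\<close>)
  obtain \<eta> where \<eta>: "separated m \<phi> e \<eta>"
    using separated_exists[OF \<phi>, where F=e and F'="\<lambda>_. e'", OF e continuous_on_const] by (elim exE)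
  have C1: "C1_on (- {0}) u" "C1_on (- {0}) u'" "C1_on (- {0}) \<eta>"
    using u \<eta> by (auto simp: separated_def)
  have val: "u (polar \<rho> \<theta>) = f \<rho> * of_real (\<phi> (real m * \<theta>))" "u' (polar \<rho> \<theta>) = g \<rho> * of_real (\<phi> (real m * \<theta>))"
    "\<eta> (polar \<rho> \<theta>) = e \<rho> * of_real (\<phi> (real m * \<theta>))" if "\<rho> > 0" for \<rho> \<theta>
    using u \<eta> that by (auto simp: separated_def)
  note cl = closure_annulus_subset[OF r(1)]
  have "\<eta> \<in> H1 (annulus r)"
    by (rule H1_if_C1_on[OF open_annulus bounded_annulus C1(3) cl])
  then have mem: "(\<eta>, \<eta>) \<in> itp_space r"
    using vanishing_trace_zero[OF r(1)] by (simp add: itp_space_def)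
  define h1 where "h1 x = cinner (classical_grad u x) (classical_grad \<eta> x) - cinner (classical_grad u' x) (classical_grad \<eta> x)" for x
  define h2 where "h2 x = u x * cnj (\<eta> x) - of_real p * u' x * cnj (\<eta> x)" for x
  have ccin: "continuous_on S (\<lambda>x. cinner (a x) (b x))" if "continuous_on S a" "continuous_on S b"
    for S :: "(real^2) set" and a b :: "real^2 \<Rightarrow> complex^2"
    unfolding cinner_def by (intro continuous_intros that)
  have ch1: "continuous_on (- {0}) h1"
    unfolding h1_def by (intro continuous_on_diff ccin continuous_on_classical_grad C1)
  have ch2: "continuous_on (- {0}) h2"
    unfolding h2_def by (intro continuous_on_diff continuous_on_mult continuous_on_cnj continuous_on_const C1[THEN C1_on_imp_continuous_on])
  have int: "integrable (lebesgue_on (annulus r)) h1" "integrable (lebesgue_on (annulus r)) h2"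
    using ch1 ch2 by (auto intro: integrable_lebesgue_on_if_continuous_on[OF open_annulus bounded_annulus _ cl])
  note wg = is_weak_grad_weak_grad[OF open_annulus bounded_annulus _ cl]
  note ae = AE_weak_grad_eq_classical_grad[OF open_annulus bounded_annulus _ cl]
  have measg: "weak_grad (annulus r) a \<in> borel_measurable (lebesgue_on (annulus r))"
    if "C1_on (- {0}) b" "\<And>x. x \<in> annulus r \<Longrightarrow> a x = b x" for a b
    using wg[OF that] by (simp add: is_weak_grad_def square_integrable_on_def)
  have meascin: "(\<lambda>x. cinner (a x) (b x)) \<in> borel_measurable M"
    if "a \<in> borel_measurable M" "b \<in> borel_measurable M" for M :: "(real^2) measure" and a b :: "real^2 \<Rightarrow> complex^2"
  proof -
    have nth: "(\<lambda>x. c x $ i) \<in> borel_measurable M" if "c \<in> borel_measurable M" for c :: "real^2 \<Rightarrow> complex^2" and i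
      using measurable_compose[OF that, of "\<lambda>x. x $ i" borel]
      by (simp add: borel_measurable_continuous_onI continuous_on_component)
    show ?thesis
      unfolding cinner_def
      by (intro borel_measurable_sum borel_measurable_times nth that
        measurable_compose[OF nth[OF that(2)] borel_measurable_continuous_onI[OF continuous_on_cnj[OF continuous_on_id]]])
  qed
  have "itp_stiffness r (v, w) (\<eta>, \<eta>) = (\<integral>x. h1 x \<partial>lebesgue_on (annulus r))"
    unfolding itp_stiffness.simps
  proof (rule integral_cong_AE)
    show "(\<lambda>x. cinner (weak_grad (annulus r) v x) (weak_grad (annulus r) \<eta> x)
        - cinner (weak_grad (annulus r) w x) (weak_grad (annulus r) \<eta> x)) \<in> borel_measurable (lebesgue_on (annulus r))"
      by (intro borel_measurable_diff meascin measg[OF C1(1) v] measg[OF C1(2) w] measg[OF C1(3) refl])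
    show "h1 \<in> borel_measurable (lebesgue_on (annulus r))" using int(1) by (rule borel_measurable_integrable)
    show "AE x in lebesgue_on (annulus r). cinner (weak_grad (annulus r) v x) (weak_grad (annulus r) \<eta> x)
        - cinner (weak_grad (annulus r) w x) (weak_grad (annulus r) \<eta> x) = h1 x"
    proof -
      have "AE x in lebesgue_on (annulus r). weak_grad (annulus r) v x = classical_grad u x"
        "AE x in lebesgue_on (annulus r). weak_grad (annulus r) w x = classical_grad u' x"
        "AE x in lebesgue_on (annulus r). weak_grad (annulus r) \<eta> x = classical_grad \<eta> x"
        using v w by (simp_all add: ae[OF C1(1)] ae[OF C1(2)] ae[OF C1(3)])
      then show ?thesis by eventually_elim (simp add: h1_def)
    qed
  qed
  moreover have "itp_mass r (\<lambda>_. p) (v, w) (\<eta>, \<eta>) = (\<integral>x. h2 x \<partial>lebesgue_on (annulus r))"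
    unfolding itp_mass.simps using v w
    by (intro Bochner_Integration.integral_cong) (auto simp: space_restrict_space h2_def)
  ultimately have "(\<integral>x. h1 x \<partial>lebesgue_on (annulus r)) - \<kappa>2 * (\<integral>x. h2 x \<partial>lebesgue_on (annulus r)) = 0"
    using weak[OF mem] by simp
  then have h0: "(\<integral>x. h1 x - \<kappa>2 * h2 x \<partial>lebesgue_on (annulus r)) = 0"
    using int by simp
  \<comment> \<open>With the area weight \<open>\<rho>\<close>, the tested integrand is
    \<open>A\<close> times the square of \<open>\<phi>\<close> plus \<open>B\<close> times the
    square of \<open>m \<phi>'\<close>; \<open>B\<close> comes from the tangential derivatives,
    \<open>A\<close> from the radial ones and the mass term.\<close>
  define A where "A \<rho> = (zf \<rho> - zg \<rho>) * e' - \<kappa>2 * of_real \<rho> * (f \<rho> - of_real p * g \<rho>) * e \<rho>" for \<rho>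
  define B where "B \<rho> = (f \<rho> - g \<rho>) * e \<rho> / of_real \<rho>" for \<rho>
  have cont: "continuous_on {r..1} f" "continuous_on {r..1} g" "continuous_on {r..1} zf" "continuous_on {r..1} zg"
    using bessel_system_continuous[OF f] bessel_system_continuous[OF g] r
    by (auto elim!: continuous_on_subset)
  have ce: "continuous_on {r..1} e"
    unfolding e_def[abs_def] using st by (intro continuous_intros) auto
  have cA: "continuous_on {r..1} A" and cB: "continuous_on {r..1} B"
    unfolding A_def[abs_def] B_def[abs_def] using r by (auto intro!: continuous_intros cont ce)
  have c\<phi>: "continuous_on {0..2 * pi} (\<lambda>\<theta>. (\<phi> (real m * \<theta>))\<^sup>2)" "continuous_on {0..2 * pi} (\<lambda>\<theta>. (real m)\<^sup>2 * (\<phi>' (real m * \<theta>))\<^sup>2)"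
    using angular_continuous[OF \<phi>, of UNIV]
    by (auto intro!: continuous_intros continuous_on_compose2[of UNIV \<phi>] continuous_on_compose2[of UNIV \<phi>'])
  have polar_eq: "of_real \<rho> * (h1 (polar \<rho> \<theta>) - \<kappa>2 * h2 (polar \<rho> \<theta>))
      = A \<rho> * of_real ((\<phi> (real m * \<theta>))\<^sup>2) + B \<rho> * of_real ((real m)\<^sup>2 * (\<phi>' (real m * \<theta>))\<^sup>2)"
    if "\<rho> \<in> {r..1}" for \<rho> \<theta>
  proof -
    have \<rho>: "\<rho> > 0" using that r by simp
    have diff: "u differentiable at (polar \<rho> \<theta>)" "u' differentiable at (polar \<rho> \<theta>)" "\<eta> differentiable at (polar \<rho> \<theta>)"
      using C1 \<rho> by (auto simp: C1_on_def polar_ne_0)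
    note du = separated_derivatives[OF u(1) \<phi> \<rho> bessel_system_has_derivative(1)[OF f \<rho>], of \<theta>]
    note du' = separated_derivatives[OF u(2) \<phi> \<rho> bessel_system_has_derivative(1)[OF g \<rho>], of \<theta>]
    note d\<eta> = separated_derivatives[OF \<eta> \<phi> \<rho> e, of \<theta>]
    have real_e: "cnj (e \<rho>) = e \<rho>" "cnj e' = e'" by (simp_all add: e_def e'_def)
    define R P Q M :: complex where "R = of_real \<rho>" and "P = of_real (\<phi> (real m * \<theta>))"
      and "Q = of_real (\<phi>' (real m * \<theta>))" and "M = of_real (real m)"
    have real: "cnj R = R" "cnj P = P" "cnj Q = Q" "cnj M = M"
      by (simp_all add: R_def P_def Q_def M_def)
    have R: "R \<noteq> 0" using \<rho> by (simp add: R_def)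
    have h1: "h1 (polar \<rho> \<theta>) = (zf \<rho> / R * P) * (e' * P) + (f \<rho> * (M * Q) / R) * (e \<rho> * (M * Q) / R)
        - ((zg \<rho> / R * P) * (e' * P) + (g \<rho> * (M * Q) / R) * (e \<rho> * (M * Q) / R))"
      unfolding h1_def cinner_classical_grad_polar[OF diff(1,3), of \<theta>] cinner_classical_grad_polar[OF diff(2,3), of \<theta>]
        du du' d\<eta> complex_cnj_mult complex_cnj_divide real_e of_real_mult
        R_def[symmetric] P_def[symmetric] Q_def[symmetric] M_def[symmetric] real ..
    have h2: "h2 (polar \<rho> \<theta>) = (f \<rho> * P) * (e \<rho> * P) - of_real p * (g \<rho> * P) * (e \<rho> * P)"
      unfolding h2_def val[OF \<rho>] complex_cnj_mult real_e P_def[symmetric] real ..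
    have "R * ((zf' / R * P) * (e1 * P) + (ff * (M * Q) / R) * (ee * (M * Q) / R)
        - ((zg' / R * P) * (e1 * P) + (gg * (M * Q) / R) * (ee * (M * Q) / R))
        - \<kappa>2 * ((ff * P) * (ee * P) - p' * (gg * P) * (ee * P)))
      = ((zf' - zg') * e1 - \<kappa>2 * R * (ff - p' * gg) * ee) * P\<^sup>2 + (ff - gg) * ee / R * (M\<^sup>2 * Q\<^sup>2)"
      for zf' zg' e1 ff gg ee p' :: complex
      using R by (simp add: field_simps power2_eq_square)
    then show ?thesis
      unfolding h1 h2 A_def B_def of_real_mult of_real_power
        R_def[symmetric] P_def[symmetric] Q_def[symmetric] M_def[symmetric] by simp
  qed
  define N where "N = a_const m * pi"
  have N: "N \<noteq> 0" by (simp add: N_def a_const_def)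
  have "integral {r..1} A * of_real (integral {0..2 * pi} (\<lambda>\<theta>. (\<phi> (real m * \<theta>))\<^sup>2))
      + integral {r..1} B * of_real (integral {0..2 * pi} (\<lambda>\<theta>. (real m)\<^sup>2 * (\<phi>' (real m * \<theta>))\<^sup>2)) = 0"
    using polar_integral_annulus_complex[OF r _ cA cB c\<phi> polar_eq] h0 ch1 ch2
    by (simp add: continuous_on_diff continuous_on_mult)
  moreover have "integral {0..2 * pi} (\<lambda>\<theta>. (\<phi> (real m * \<theta>))\<^sup>2) = N"
    "integral {0..2 * pi} (\<lambda>\<theta>. (real m)\<^sup>2 * (\<phi>' (real m * \<theta>))\<^sup>2) = (real m)\<^sup>2 * N"
    using angular_integral[OF \<phi>] by (simp_all add: N_def)
  ultimately have "of_real N * (integral {r..1} A + (of_nat m)\<^sup>2 * integral {r..1} B) = 0"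
    by (simp only: of_real_mult of_real_power of_real_of_nat_eq) (simp add: algebra_simps)
  then have AB: "integral {r..1} A + (of_nat m)\<^sup>2 * integral {r..1} B = 0" using N by simp
  \<comment> \<open>The product rule and the two Bessel systems turn \<open>zf'\<close> and
    \<open>zg'\<close> into the mass and tangential terms. So the equation \<open>AB\<close> says
    that \<open>(zf - zg) * e\<close> takes equal values at both ends.\<close>
  have dk: "((\<lambda>\<rho>. (zf \<rho> - zg \<rho>) * e \<rho>) has_vector_derivative A \<rho> + (of_nat m)\<^sup>2 * B \<rho>) (at \<rho>)" if "\<rho> \<in> {r..1}" for \<rho>
  proof -
    have \<rho>: "\<rho> > 0" using that r by simp
    have "((\<lambda>\<rho>. (zf \<rho> - zg \<rho>) * e \<rho>) has_vector_derivative
      (zf \<rho> - zg \<rho>) * e' + (((of_nat m)\<^sup>2 - \<kappa>2 * (of_real \<rho>)\<^sup>2) * f \<rho> / of_real \<rho>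
        - ((of_nat m)\<^sup>2 - of_real p * \<kappa>2 * (of_real \<rho>)\<^sup>2) * g \<rho> / of_real \<rho>) * e \<rho>) (at \<rho>)"
      by (intro has_vector_derivative_mult has_vector_derivative_diff e bessel_system_has_derivative(2)[OF f \<rho>]
          bessel_system_has_derivative(2)[OF g \<rho>])
    moreover have "(zf \<rho> - zg \<rho>) * e' + (((of_nat m)\<^sup>2 - \<kappa>2 * (of_real \<rho>)\<^sup>2) * f \<rho> / of_real \<rho>
        - ((of_nat m)\<^sup>2 - of_real p * \<kappa>2 * (of_real \<rho>)\<^sup>2) * g \<rho> / of_real \<rho>) * e \<rho> = A \<rho> + (of_nat m)\<^sup>2 * B \<rho>"
      using \<rho> unfolding A_def B_def by (simp add: field_simps power2_eq_square)
    ultimately show ?thesis by simp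
  qed
  have "((\<lambda>\<rho>. A \<rho> + (of_nat m)\<^sup>2 * B \<rho>) has_integral (zf 1 - zg 1) * e 1 - (zf r - zg r) * e r) {r..1}"
    using r dk by (intro fundamental_theorem_of_calculus) (auto intro: has_vector_derivative_at_within)
  moreover have "((\<lambda>\<rho>. A \<rho> + (of_nat m)\<^sup>2 * B \<rho>) has_integral integral {r..1} A + (of_nat m)\<^sup>2 * integral {r..1} B) {r..1}"
    using cA cB by (intro has_integral_add has_integral_mult_right integrable_integral integrable_continuous_real)
  ultimately have "(zf 1 - zg 1) * e 1 - (zf r - zg r) * e r = 0"
    unfolding AB by (rule has_integral_unique)
  moreover have "e s = 1" "e t = 0" using st by (auto simp: e_def)
  ultimately show ?thesis using s by (auto simp: t_def)
qed

text \<open>On the circle of radius \<open>s\<close> the difference \<open>v - w\<close> is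
  represented by \<open>(f s - g s) * \<phi> (m \<theta>)\<close>, and the angular factor has a
  positive square integral.\<close>

lemma itp_space_separated_boundary:
  assumes r: "0 < r" "r < 1" and vw: "(v, w) \<in> itp_space r" and \<phi>: "angular m \<phi> \<phi>'"
    and u: "separated m \<phi> f u" "separated m \<phi> g u'"
    and v: "\<And>x. x \<in> annulus r \<Longrightarrow> v x = u x" and w: "\<And>x. x \<in> annulus r \<Longrightarrow> w x = u' x"
    and s: "s \<in> {r, 1}"
  shows "f s = g s"
proof -
  have s0: "s > 0" using s r by auto
  have C1: "C1_on (- {0}) (\<lambda>x. u x - u' x)"
    using u by (auto simp: separated_def intro: C1_on_diff)
  have trace: "vanishing_trace r (\<lambda>x. v x - w x)" using vw by (simp add: itp_space_def)
  have "0 = integral {0..2 * pi} (\<lambda>\<theta>. (cmod (u (polar s \<theta>) - u' (polar s \<theta>)))\<^sup>2)"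
    by (rule vanishing_trace_imp_boundary_integral_eq_0[OF r C1 _ trace s, symmetric]) (simp add: v w)
  also have "\<dots> = integral {0..2 * pi} (\<lambda>\<theta>. (cmod (f s - g s))\<^sup>2 * (\<phi> (real m * \<theta>))\<^sup>2)"
  proof -
    have "u (polar s \<theta>) - u' (polar s \<theta>) = (f s - g s) * of_real (\<phi> (real m * \<theta>))" for \<theta>
      using u s0 by (simp add: separated_def left_diff_distrib)
    then show ?thesis by (simp add: norm_mult power_mult_distrib)
  qed
  also have "\<dots> = (cmod (f s - g s))\<^sup>2 * (a_const m * pi)"
    using angular_integral(1)[OF \<phi>] by simp
  finally show ?thesis by (simp add: a_const_def split: if_splits)
qed

theorem proposition3:
  fixes r pmin pmax :: real and P :: "real set" and m :: nat
    and \<kappa> \<alpha> \<beta> \<gamma> \<delta> :: "real \<Rightarrow> complex"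
    and v w :: "real \<Rightarrow> real^2 \<Rightarrow> complex"
    and \<phi> :: "real \<Rightarrow> real"
  assumes r: "0 < r" "r < 1"
    and P: "P = {pmin<..<pmax}" "P \<subseteq> {0<..} - {1}"
    and traj: "continuous_eigenpair_trajectory r P (\<lambda>p _. p) \<kappa> v w"
    and semisimple: "finite {p \<in> P. \<not> itp_semisimple r (\<lambda>_. p) (\<kappa> p)}"
    and cont: "continuous_on P \<alpha>" "continuous_on P \<beta>" "continuous_on P \<gamma>" "continuous_on P \<delta>"
    and nonzero: "\<forall>p\<in>P. (\<alpha> p, \<beta> p, \<gamma> p, \<delta> p) \<noteq> (0, 0, 0, 0)"
    and \<phi>: "\<phi> = sin \<and> m \<noteq> 0 \<or> \<phi> = cos"
    and v: "\<forall>p\<in>P. \<forall>\<rho>\<in>{r..1}. \<forall>\<theta>\<in>{0..<2 * pi}.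
      v p (polar \<rho> \<theta>) =
        (\<alpha> p * bessel_J m (\<kappa> p * of_real \<rho>) + \<beta> p * bessel_Y m (\<kappa> p * of_real \<rho>))
        * of_real (\<phi> (real m * \<theta>))"
    and w: "\<forall>p\<in>P. \<forall>\<rho>\<in>{r..1}. \<forall>\<theta>\<in>{0..<2 * pi}.
      w p (polar \<rho> \<theta>) =
        (\<gamma> p * bessel_J m (of_real (sqrt p) * \<kappa> p * of_real \<rho>)
         + \<delta> p * bessel_Y m (of_real (sqrt p) * \<kappa> p * of_real \<rho>))
        * of_real (\<phi> (real m * \<theta>))"
  shows "\<forall>p\<in>P. (\<kappa> p)\<^sup>2 \<in> \<real> \<longrightarrow>
    simplified_indicator r m p (v p) (w p)
      = (Linf_norm (arc_measure 1) (v p))\<^sup>2 - r\<^sup>2 * (Linf_norm (arc_measure r) (v p))\<^sup>2"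
proof (intro ballI impI)
  fix p assume p: "p \<in> P" and "(\<kappa> p)\<^sup>2 \<in> \<real>"
  then obtain q where q: "(\<kappa> p)\<^sup>2 = of_real q" by (auto elim: Reals_cases)
  have p0: "p > 0" "p \<noteq> 1" using P(2) p by auto
  obtain \<phi>' where ang: "angular m \<phi> \<phi>'" using \<phi> by (auto simp: angular_def)
  have eig: "itp_eigenpair r (\<lambda>_. p) (\<kappa> p) (v p, w p)"
    using traj p by (simp add: continuous_eigenpair_trajectory_def)
  then have \<kappa>: "\<kappa> p \<noteq> 0" and space: "(v p, w p) \<in> itp_space r"
    and weak: "\<And>y. y \<in> itp_space r \<Longrightarrow> itp_stiffness r (v p, w p) y = of_real q * itp_mass r (\<lambda>_. p) (v p, w p) y"
    by (auto simp: itp_eigenpair_def itp_space_nonzero_def q)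
  have q0: "q \<noteq> 0" using \<kappa> q by auto
  define f where "f \<rho> = \<alpha> p * bessel_J m (\<kappa> p * of_real \<rho>) + \<beta> p * bessel_Y m (\<kappa> p * of_real \<rho>)" for \<rho>
  define g where "g \<rho> = \<gamma> p * bessel_J m (of_real (sqrt p) * \<kappa> p * of_real \<rho>)
         + \<delta> p * bessel_Y m (of_real (sqrt p) * \<kappa> p * of_real \<rho>)" for \<rho>
  have sys: "\<exists>z. bessel_system m (k\<^sup>2) (\<lambda>\<rho>. a * bessel_J m (k * of_real \<rho>) + b * bessel_Y m (k * of_real \<rho>)) z"
    if "k \<noteq> 0" for k a b
    using bessel_J_system[OF that, of m] bessel_Y_system[OF that, of m] bessel_system_lincomb by blast
  obtain zf where zf: "bessel_system m (of_real q) f zf"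
    using sys[OF \<kappa>] unfolding f_def[abs_def] q by blast
  have "of_real (sqrt p) * \<kappa> p \<noteq> 0" using \<kappa> p0 by simp
  moreover have "(of_real (sqrt p) * \<kappa> p)\<^sup>2 = of_real (p * q)"
    using p0 q by (simp add: power_mult_distrib flip: of_real_power)
  ultimately obtain zg where zg: "bessel_system m (of_real (p * q)) g zg"
    using sys[of "of_real (sqrt p) * \<kappa> p"] unfolding g_def[abs_def] by metis
  have ex: "\<exists>u. separated m \<phi> y u" if "bessel_system m k y z" for k y z
    using bessel_system_has_derivative(1)[OF that] bessel_system_continuous(2)[OF that]
    by (intro separated_exists[OF ang, where F'="\<lambda>\<rho>. z \<rho> / of_real \<rho>"]) (auto intro!: continuous_intros)
  obtain u u' where u: "separated m \<phi> f u" "separated m \<phi> g u'"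
    using ex[OF zf] ex[OF zg] by blast
  \<comment> \<open>The hypotheses on \<open>v\<close> and \<open>w\<close> cover angles in
    \<open>{0..<2 * pi}\<close> only, and every point has a representation with such an
    angle.\<close>
  have vu: "v p x = u x" and wu: "w p x = u' x" if x: "x \<in> annulus r" for x
  proof -
    obtain \<theta> where \<theta>: "\<theta> \<in> {0..<2 * pi}" "x = polar (norm x) \<theta>" by (rule polar_representation)
    have \<rho>: "norm x \<in> {r..1}" "norm x > 0" using x r by (auto simp: annulus_iff)
    have "v p (polar (norm x) \<theta>) = u (polar (norm x) \<theta>)" "w p (polar (norm x) \<theta>) = u' (polar (norm x) \<theta>)"
      using v w p \<theta>(1) \<rho> u by (auto simp: separated_def f_def g_def)
    then show "v p x = u x" "w p x = u' x" by (simp_all flip: \<theta>(2))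
  qed
  have bdry: "f s = g s" "zf s = zg s" if "s \<in> {r, 1}" for s
    using itp_space_separated_boundary[OF r space ang u vu wu that]
      itp_weak_form_separated[OF r weak ang zf _ u vu wu that, of zg] zg by auto
  define h where "h x = (cmod (u x))\<^sup>2 - p * (cmod (u' x))\<^sup>2" for x
  have ch: "continuous_on (- {0}) h"
    unfolding h_def using u by (intro continuous_intros C1_on_imp_continuous_on) (auto simp: separated_def)
  have "(\<integral>x. (cmod (v p x))\<^sup>2 - p * (cmod (w p x))\<^sup>2 \<partial>lebesgue_on (annulus r)) = (\<integral>x. h x \<partial>lebesgue_on (annulus r))"
    using vu wu by (intro Bochner_Integration.integral_cong) (auto simp: space_restrict_space h_def)
  also have "\<dots> = integral {0..2 * pi} (\<lambda>\<theta>. integral {r..1} (\<lambda>\<rho>. \<rho> * h (polar \<rho> \<theta>)))"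
    by (rule polar_integral_annulus[OF r ch])
  also have "\<dots> = integral {0..2 * pi} (\<lambda>\<theta>. integral {r..1} (\<lambda>\<rho>. \<rho> * ((cmod (f \<rho>))\<^sup>2 - p * (cmod (g \<rho>))\<^sup>2)) * (\<phi> (real m * \<theta>))\<^sup>2)"
  proof -
    have "\<rho> * h (polar \<rho> \<theta>) = \<rho> * ((cmod (f \<rho>))\<^sup>2 - p * (cmod (g \<rho>))\<^sup>2) * (\<phi> (real m * \<theta>))\<^sup>2" if "\<rho> \<in> {r..1}" for \<rho> \<theta>
      using that r u by (simp add: h_def separated_def norm_mult power_mult_distrib algebra_simps)
    then have "integral {r..1} (\<lambda>\<rho>. \<rho> * h (polar \<rho> \<theta>))
        = integral {r..1} (\<lambda>\<rho>. \<rho> * ((cmod (f \<rho>))\<^sup>2 - p * (cmod (g \<rho>))\<^sup>2) * (\<phi> (real m * \<theta>))\<^sup>2)" for \<theta>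
      by (intro Henstock_Kurzweil_Integration.integral_cong)
    then show ?thesis by simp
  qed
  \<comment> \<open>The factor \<open>a_const m * pi\<close> is the angular integral,
    \<open>(1 - p) / 2\<close> comes from the radial one; their product is what the prefactor in
    \<open>simplified_indicator\<close> normalises.\<close>
  also have "\<dots> = (1 - p) / 2 * ((cmod (f 1))\<^sup>2 - r\<^sup>2 * (cmod (f r))\<^sup>2) * (a_const m * pi)"
    using angular_integral(1)[OF ang] integral_difference_of_bessel_systems[OF zf zg r q0] bdry by simp
  finally have "simplified_indicator r m p (v p) (w p) = (cmod (f 1))\<^sup>2 - r\<^sup>2 * (cmod (f r))\<^sup>2"
    using p0 unfolding simplified_indicator_def by (simp add: a_const_def field_simps)
  moreover have "Linf_norm (arc_measure s) (v p) = cmod (f s)" if "s \<in> {r, 1}" for s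
    using that r v p by (intro Linf_norm_arc_measure[OF ang]) (auto simp: f_def)
  ultimately show "simplified_indicator r m p (v p) (w p)
      = (Linf_norm (arc_measure 1) (v p))\<^sup>2 - r\<^sup>2 * (Linf_norm (arc_measure r) (v p))\<^sup>2"
    by simp
qed

end
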